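(* Let $(M_1,\tilde g_1)$ and $(M_2,\tilde g_2)$ be pseudo-Riemannian manifolds with cometrics $g_1,g_2$, let $\Pi_i$ be a bivector field on $M_i$ ($i=1,2$), let $f$ be a positive smooth function on $M_1$ and $\mu$ a smooth function on $M_1$. If $f$ is a Casimir function (of $\Pi_1$) and $\mu$ is a nonzero essentially constant function, then the triple $(M_1\times M_2,g^f,\Pi^\mu)$ is flat if and only if $(M_1,g_1,\Pi_1)$ and $(M_2,g_2,\Pi_2)$ are flat.
   Context: For a bivector field $\Pi$ on $M$, the anchor map $\sharp_\Pi:T^*M\to TM$ is given by $\beta(\sharp_\Pi(\alpha))=\Pi(\alpha,\beta)$, and the Koszul bracket of 1-forms is $[\alpha,\beta]_\Pi=\mathcal L_{\sharp_\Pi(\alpha)}\beta-\mathcal L_{\sharp_\Pi(\beta)}\alpha-d(\Pi(\alpha,\beta))$. A function $\varphi$ is Casimir if $\sharp_\Pi(d\varphi)=0$. A function is essentially constant if it is constant on each connected component. A contravariant connection with respect to $\Pi$ is an $\mathbb R$-bilinear map $\mathcal D:\Gamma(T^*M)\times\Gamma(T^*M)\to\Gamma(T^*M)$ with $\mathcal D_{\varphi\alpha}\beta=\varphi\mathcal D_\alpha\beta$ and $\mathcal D_\alpha(\varphi\beta)=\varphi\mathcal D_\alpha\beta+\sharp_\Pi(\alpha)(\varphi)\beta$. The cometric of a pseudo-Riemannian metric $\tilde g$ is the induced metric $g$ on $T^*M$. The Levi-Civita contravariant connection of $(g,\Pi)$ is the unique contravariant connection with respect to $\Pi$ satisfying $\sharp_\Pi(\alpha).g(\beta,\gamma)=g(\mathcal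 D_\alpha\beta,\gamma)+g(\beta,\mathcal D_\alpha\gamma)$ and $\mathcal D_\alpha\beta-\mathcal D_\beta\alpha=[\alpha,\beta]_\Pi$. The triple $(M,g,\Pi)$ is flat if the curvature $\mathcal R(\alpha,\beta)=\mathcal D_\alpha\mathcal D_\beta-\mathcal D_\beta\mathcal D_\alpha-\mathcal D_{[\alpha,\beta]_\Pi}$ of its Levi-Civita contravariant connection vanishes identically. With $\sigma_i:M_1\times M_2\to M_i$ the projections, lifts of functions and forms are $\omega_1^h=\sigma_1^*\omega_1$, $\omega_2^v=\sigma_2^*\omega_2$. The warped bivector field $\Pi^\mu$ is determined by $\Pi^\mu(\alpha_1^h,\beta_1^h)=\Pi_1(\alpha_1,\beta_1)^h$, $\Pi^\mu(\alpha_2^v,\beta_2^v)=\mu^h\Pi_2(\alpha_2,\beta_2)^v$, $\Pi^\mu(\alpha_1^h,\beta_2^v)=0$, and the contravariant warped metric $g^f$ by $g^f(\alpha_1^h,\beta_1^h)=g_1(\alpha_1,\beta_1)^h$, $g^f(\alpha_2^v,\beta_2^v)=f^hg_2(\alpha_2,\beta_2)^v$, $g^f(\alpha_1^h,\alpha_2^v)=0$. *)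

theory Defs
  imports "HOL-Analysis.Analysis"
begin

section \<open>Smooth maps on open subsets of Euclidean spaces\<close>

(* C^k on an open set S: all iterated directional derivatives up to order k exist,
   and they are differentiable (order < k), respectively continuous (order k). *)
primrec Ck_on ::
  "nat \<Rightarrow> 'e::euclidean_space set \<Rightarrow> ('e \<Rightarrow> 'b::real_normed_vector) \<Rightarrow> bool" where
  "Ck_on 0 S F \<longleftrightarrow> continuous_on S F"
| "Ck_on (Suc k) S F \<longleftrightarrow> (\<forall>x\<in>S. F differentiable (at x)) \<and>
     (\<forall>v. Ck_on k S (\<lambda>x. frechet_derivative F (at x) v))"

definition smooth_on :: "'e::euclidean_space set \<Rightarrow> ('e \<Rightarrow> 'b::real_normed_vector) \<Rightarrow> bool" where
  "smooth_on S F \<longleftrightarrow> (\<forall>k. Ck_on k S F)"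

section \<open>Smooth manifolds\<close>

record ('a, 'e) chart =
  source :: "'a set"
  coord :: "'a \<Rightarrow> 'e"
  param :: "'e \<Rightarrow> 'a"

abbreviation target :: "('a, 'e) chart \<Rightarrow> 'e set" where
  "target c \<equiv> coord c ` source c"

(* The underlying Hausdorff, second countable space is the whole type 'a, and 'e is the model
   space.  The smooth structure is the one generated by the atlas.  In addition every point p has
   a distinguished chart chart_at M p of the atlas; it is used only to identify the tangent space
   at p with 'e, and hence the cotangent space at p with the dual of 'e. *)
record ('a, 'e) manifold =
  atlas :: "('a, 'e) chart set"
  chart_at :: "'a \<Rightarrow> ('a, 'e) chart"

definition smooth_manifold ::
  "('a::{t2_space,second_countable_topology}, 'e::euclidean_space) manifold \<Rightarrow> bool" where
  "smooth_manifold M \<longleftrightarrow>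
     (\<forall>c\<in>atlas M. open (source c) \<and> open (target c) \<and>
        homeomorphism (source c) (target c) (coord c) (param c)) \<and>
     (\<forall>c\<in>atlas M. \<forall>c'\<in>atlas M.
        smooth_on (coord c ` (source c \<inter> source c')) (coord c' \<circ> param c)) \<and>
     (\<forall>p. chart_at M p \<in> atlas M \<and> p \<in> source (chart_at M p))"

definition smooth_fun :: "('a, 'e::euclidean_space) manifold \<Rightarrow> ('a \<Rightarrow> real) \<Rightarrow> bool" where
  "smooth_fun M \<phi> \<longleftrightarrow> (\<forall>c\<in>atlas M. smooth_on (target c) (\<phi> \<circ> param c))"

definition product_chart :: "('a, 'e) chart \<Rightarrow> ('b, 'd) chart \<Rightarrow> ('a \<times> 'b, 'e \<times> 'd) chart" where
  "product_chart c d = \<lparr> source = source c \<times> source d,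
     coord = map_prod (coord c) (coord d), param = map_prod (param c) (param d) \<rparr>"

definition product_manifold ::
  "('a, 'e) manifold \<Rightarrow> ('b, 'd) manifold \<Rightarrow> ('a \<times> 'b, 'e \<times> 'd) manifold" where
  "product_manifold M N = \<lparr> atlas = (\<lambda>(c, d). product_chart c d) ` (atlas M \<times> atlas N),
     chart_at = (\<lambda>(p, q). product_chart (chart_at M p) (chart_at N q)) \<rparr>"

section \<open>Tensor fields\<close>

(* Derivative at p of the coordinate change from c to c': it sends the components of a tangent
   vector at p with respect to c to its components with respect to c'. *)
definition transition_deriv ::
  "('a, 'e) chart \<Rightarrow> ('a, 'e::euclidean_space) chart \<Rightarrow> 'a \<Rightarrow> ('e \<Rightarrow>\<^sub>L 'e)" where
  "transition_deriv c c' p = Blinfun (frechet_derivative (coord c' \<circ> param c) (at (coord c p)))"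

(* Values of tensor fields at p are taken with respect to the chart chart_at M p. *)
type_synonym ('a, 'e) vfield = "'a \<Rightarrow> 'e"
type_synonym ('a, 'e) form = "'a \<Rightarrow> ('e \<Rightarrow>\<^sub>L real)"
type_synonym ('a, 'e) cov_tensor = "'a \<Rightarrow> 'e \<Rightarrow> 'e \<Rightarrow> real"
type_synonym ('a, 'e) con_tensor = "'a \<Rightarrow> ('e \<Rightarrow>\<^sub>L real) \<Rightarrow> ('e \<Rightarrow>\<^sub>L real) \<Rightarrow> real"

(* Components of tensor fields with respect to an arbitrary chart c, as functions on target c. *)
definition vfield_in ::
  "('a, 'e::euclidean_space) manifold \<Rightarrow> ('a, 'e) chart \<Rightarrow> ('a, 'e) vfield \<Rightarrow> 'e \<Rightarrow> 'e" where
  "vfield_in M c X x =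
     (let p = param c x in transition_deriv (chart_at M p) c p (X p))"

definition form_in ::
  "('a, 'e::euclidean_space) manifold \<Rightarrow> ('a, 'e) chart \<Rightarrow> ('a, 'e) form \<Rightarrow> 'e \<Rightarrow> ('e \<Rightarrow>\<^sub>L real)" where
  "form_in M c \<alpha> x =
     (let p = param c x in \<alpha> p o\<^sub>L transition_deriv c (chart_at M p) p)"

definition cov_tensor_in ::
  "('a, 'e::euclidean_space) manifold \<Rightarrow> ('a, 'e) chart \<Rightarrow> ('a, 'e) cov_tensor \<Rightarrow>
     'e \<Rightarrow> 'e \<Rightarrow> 'e \<Rightarrow> real" where
  "cov_tensor_in M c B x v w =
     (let p = param c x; T = transition_deriv c (chart_at M p) p in B p (T v) (T w))"

definition con_tensor_in ::
  "('a, 'e::euclidean_space) manifold \<Rightarrow> ('a, 'e) chart \<Rightarrow> ('a, 'e) con_tensor \<Rightarrow>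
     'e \<Rightarrow> ('e \<Rightarrow>\<^sub>L real) \<Rightarrow> ('e \<Rightarrow>\<^sub>L real) \<Rightarrow> real" where
  "con_tensor_in M c B x \<xi> \<eta> =
     (let p = param c x; T = transition_deriv (chart_at M p) c p in B p (\<xi> o\<^sub>L T) (\<eta> o\<^sub>L T))"

(* the space of smooth sections of the cotangent bundle *)
definition one_forms :: "('a, 'e::euclidean_space) manifold \<Rightarrow> ('a, 'e) form set" where
  "one_forms M = {\<alpha>. \<forall>c\<in>atlas M. smooth_on (target c) (form_in M c \<alpha>)}"

definition pseudo_riemannian_metric ::
  "('a, 'e::euclidean_space) manifold \<Rightarrow> ('a, 'e) cov_tensor \<Rightarrow> bool" where
  "pseudo_riemannian_metric M gt \<longleftrightarrow>
     (\<forall>p. bilinear (gt p) \<and> (\<forall>v w. gt p v w = gt p w v) \<and>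
          (\<forall>v. (\<forall>w. gt p v w = 0) \<longrightarrow> v = 0)) \<and>
     (\<forall>c\<in>atlas M. \<forall>v w. smooth_on (target c) (\<lambda>x. cov_tensor_in M c gt x v w))"

(* The metric identifies the tangent space at p with the cotangent space; metric_sharp is the
   inverse of v \<mapsto> gt p v, and the cometric is gt transported along this identification. *)
definition metric_sharp ::
  "('a, 'e::euclidean_space) cov_tensor \<Rightarrow> 'a \<Rightarrow> ('e \<Rightarrow>\<^sub>L real) \<Rightarrow> 'e" where
  "metric_sharp gt p \<xi> = (THE v. \<forall>w. gt p v w = \<xi> w)"

definition cometric :: "('a, 'e::euclidean_space) cov_tensor \<Rightarrow> ('a, 'e) con_tensor" where
  "cometric gt p \<xi> \<eta> = gt p (metric_sharp gt p \<xi>) (metric_sharp gt p \<eta>)"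

definition bivector_field ::
  "('a, 'e::euclidean_space) manifold \<Rightarrow> ('a, 'e) con_tensor \<Rightarrow> bool" where
  "bivector_field M P \<longleftrightarrow>
     (\<forall>p. bilinear (P p) \<and> (\<forall>\<xi> \<eta>. P p \<xi> \<eta> = - P p \<eta> \<xi>)) \<and>
     (\<forall>c\<in>atlas M. \<forall>\<xi> \<eta>. smooth_on (target c) (\<lambda>x. con_tensor_in M c P x \<xi> \<eta>))"

definition tensor_apply ::
  "('a, 'e::euclidean_space) con_tensor \<Rightarrow> ('a, 'e) form \<Rightarrow> ('a, 'e) form \<Rightarrow> 'a \<Rightarrow> real" where
  "tensor_apply B \<alpha> \<beta> p = B p (\<alpha> p) (\<beta> p)"

section \<open>Differential calculus\<close>

definition differential ::
  "('a, 'e::euclidean_space) manifold \<Rightarrow> ('a \<Rightarrow> real) \<Rightarrow> ('a, 'e) form" where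
  "differential M \<phi> p =
     (let c = chart_at M p in Blinfun (frechet_derivative (\<phi> \<circ> param c) (at (coord c p))))"

definition vfield_apply ::
  "('a, 'e::euclidean_space) manifold \<Rightarrow> ('a, 'e) vfield \<Rightarrow> ('a \<Rightarrow> real) \<Rightarrow> 'a \<Rightarrow> real" where
  "vfield_apply M X \<phi> p = differential M \<phi> p (X p)"

(* In local coordinates,
   (L_X beta)_j = sum_i (X^i d_i beta_j + beta_i d_j X^i),
   evaluated at p in the chart chart_at M p. *)
definition lie_derivative ::
  "('a, 'e::euclidean_space) manifold \<Rightarrow> ('a, 'e) vfield \<Rightarrow> ('a, 'e) form \<Rightarrow> ('a, 'e) form" where
  "lie_derivative M X \<beta> p =
     (let c = chart_at M p; x = coord c p; Xc = vfield_in M c X; \<beta>c = form_in M c \<beta>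
      in frechet_derivative \<beta>c (at x) (Xc x)
         + (\<beta>c x o\<^sub>L Blinfun (frechet_derivative Xc (at x))))"

definition sharp :: "('a, 'e::euclidean_space) con_tensor \<Rightarrow> ('a, 'e) form \<Rightarrow> ('a, 'e) vfield" where
  "sharp P \<alpha> p = (THE v. \<forall>\<beta>. blinfun_apply \<beta> v = P p (\<alpha> p) \<beta>)"

definition koszul_bracket ::
  "('a, 'e::euclidean_space) manifold \<Rightarrow> ('a, 'e) con_tensor \<Rightarrow>
     ('a, 'e) form \<Rightarrow> ('a, 'e) form \<Rightarrow> ('a, 'e) form" where
  "koszul_bracket M P \<alpha> \<beta> = (\<lambda>p. lie_derivative M (sharp P \<alpha>) \<beta> p
     - lie_derivative M (sharp P \<beta>) \<alpha> p - differential M (tensor_apply P \<alpha> \<beta>) p)"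

definition casimir ::
  "('a, 'e::euclidean_space) manifold \<Rightarrow> ('a, 'e) con_tensor \<Rightarrow> ('a \<Rightarrow> real) \<Rightarrow> bool" where
  "casimir M P \<phi> \<longleftrightarrow> sharp P (differential M \<phi>) = (\<lambda>p. 0)"

definition essentially_constant :: "('a::topological_space \<Rightarrow> real) \<Rightarrow> bool" where
  "essentially_constant \<phi> \<longleftrightarrow> (\<forall>p q. connected_component UNIV p q \<longrightarrow> \<phi> p = \<phi> q)"

section \<open>Contravariant connections and flatness\<close>

(* Only the values of a connection on smooth forms are meaningful. *)
type_synonym ('a, 'e) connection = "('a, 'e) form \<Rightarrow> ('a, 'e) form \<Rightarrow> ('a, 'e) form"

definition contravariant_connection ::
  "('a, 'e::euclidean_space) manifold \<Rightarrow> ('a, 'e) con_tensor \<Rightarrow> ('a, 'e) connection \<Rightarrow> bool" where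
  "contravariant_connection M P D \<longleftrightarrow>
     (\<forall>\<alpha>\<in>one_forms M. \<forall>\<beta>\<in>one_forms M. D \<alpha> \<beta> \<in> one_forms M) \<and>
     (\<forall>\<alpha>\<in>one_forms M. \<forall>\<alpha>'\<in>one_forms M. \<forall>\<beta>\<in>one_forms M. \<forall>a b::real.
        D (\<lambda>p. a *\<^sub>R \<alpha> p + b *\<^sub>R \<alpha>' p) \<beta> = (\<lambda>p. a *\<^sub>R D \<alpha> \<beta> p + b *\<^sub>R D \<alpha>' \<beta> p)) \<and>
     (\<forall>\<alpha>\<in>one_forms M. \<forall>\<beta>\<in>one_forms M. \<forall>\<beta>'\<in>one_forms M. \<forall>a b::real.
        D \<alpha> (\<lambda>p. a *\<^sub>R \<beta> p + b *\<^sub>R \<beta>' p) = (\<lambda>p. a *\<^sub>R D \<alpha> \<beta> p + b *\<^sub>R D \<alpha> \<beta>' p)) \<and>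
     (\<forall>\<phi>. smooth_fun M \<phi> \<longrightarrow> (\<forall>\<alpha>\<in>one_forms M. \<forall>\<beta>\<in>one_forms M.
        D (\<lambda>p. \<phi> p *\<^sub>R \<alpha> p) \<beta> = (\<lambda>p. \<phi> p *\<^sub>R D \<alpha> \<beta> p) \<and>
        D \<alpha> (\<lambda>p. \<phi> p *\<^sub>R \<beta> p) =
          (\<lambda>p. \<phi> p *\<^sub>R D \<alpha> \<beta> p + vfield_apply M (sharp P \<alpha>) \<phi> p *\<^sub>R \<beta> p)))"

definition is_levi_civita ::
  "('a, 'e::euclidean_space) manifold \<Rightarrow> ('a, 'e) con_tensor \<Rightarrow> ('a, 'e) con_tensor \<Rightarrow>
     ('a, 'e) connection \<Rightarrow> bool" where
  "is_levi_civita M g P D \<longleftrightarrow> contravariant_connection M P D \<and>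
     (\<forall>\<alpha>\<in>one_forms M. \<forall>\<beta>\<in>one_forms M. \<forall>\<gamma>\<in>one_forms M. \<forall>p.
        vfield_apply M (sharp P \<alpha>) (tensor_apply g \<beta> \<gamma>) p =
          tensor_apply g (D \<alpha> \<beta>) \<gamma> p + tensor_apply g \<beta> (D \<alpha> \<gamma>) p) \<and>
     (\<forall>\<alpha>\<in>one_forms M. \<forall>\<beta>\<in>one_forms M.
        (\<lambda>p. D \<alpha> \<beta> p - D \<beta> \<alpha> p) = koszul_bracket M P \<alpha> \<beta>)"

(* SOME rather than THE: the Levi-Civita connection is unique on smooth forms, while a value of
   type connection is unconstrained on other arguments.  The curvature on smooth forms does not
   depend on the choice. *)
definition levi_civita ::
  "('a, 'e::euclidean_space) manifold \<Rightarrow> ('a, 'e) con_tensor \<Rightarrow> ('a, 'e) con_tensor \<Rightarrow>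
     ('a, 'e) connection" where
  "levi_civita M g P = (SOME D. is_levi_civita M g P D)"

definition curvature ::
  "('a, 'e::euclidean_space) manifold \<Rightarrow> ('a, 'e) con_tensor \<Rightarrow> ('a, 'e) connection \<Rightarrow>
     ('a, 'e) form \<Rightarrow> ('a, 'e) form \<Rightarrow> ('a, 'e) form \<Rightarrow> ('a, 'e) form" where
  "curvature M P D \<alpha> \<beta> \<gamma> =
     (\<lambda>p. D \<alpha> (D \<beta> \<gamma>) p - D \<beta> (D \<alpha> \<gamma>) p - D (koszul_bracket M P \<alpha> \<beta>) \<gamma> p)"

definition flat ::
  "('a, 'e::euclidean_space) manifold \<Rightarrow> ('a, 'e) con_tensor \<Rightarrow> ('a, 'e) con_tensor \<Rightarrow> bool" where
  "flat M g P \<longleftrightarrow> (\<forall>\<alpha>\<in>one_forms M. \<forall>\<beta>\<in>one_forms M. \<forall>\<gamma>\<in>one_forms M.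
     curvature M P (levi_civita M g P) \<alpha> \<beta> \<gamma> = (\<lambda>p. 0))"

section \<open>Warped products\<close>

lift_definition inl_blinfun :: "'e::real_normed_vector \<Rightarrow>\<^sub>L ('e \<times> 'd::real_normed_vector)"
  is "\<lambda>u. (u, 0)"
  by (intro bounded_linear_Pair bounded_linear_ident bounded_linear_zero)

lift_definition inr_blinfun :: "'d::real_normed_vector \<Rightarrow>\<^sub>L ('e::real_normed_vector \<times> 'd)"
  is "\<lambda>w. (0, w)"
  by (intro bounded_linear_Pair bounded_linear_ident bounded_linear_zero)

(* At (p, q) the chart of the product is the product of the charts at p and q, so tangent and
   cotangent spaces split in the model space.  That these tensors satisfy the equations on lifted
   forms by which they are determined is proved below. *)
definition warped_bivector ::
  "('a \<Rightarrow> real) \<Rightarrow> ('a, 'e::euclidean_space) con_tensor \<Rightarrow> ('b, 'd::euclidean_space) con_tensor \<Rightarrow>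
     ('a \<times> 'b, 'e \<times> 'd) con_tensor" where
  "warped_bivector \<mu> P1 P2 = (\<lambda>(p, q) \<xi> \<eta>.
     P1 p (\<xi> o\<^sub>L inl_blinfun) (\<eta> o\<^sub>L inl_blinfun) +
     \<mu> p * P2 q (\<xi> o\<^sub>L inr_blinfun) (\<eta> o\<^sub>L inr_blinfun))"

definition warped_cometric ::
  "('a \<Rightarrow> real) \<Rightarrow> ('a, 'e::euclidean_space) con_tensor \<Rightarrow> ('b, 'd::euclidean_space) con_tensor \<Rightarrow>
     ('a \<times> 'b, 'e \<times> 'd) con_tensor" where
  "warped_cometric f g1 g2 = (\<lambda>(p, q) \<xi> \<eta>.
     g1 p (\<xi> o\<^sub>L inl_blinfun) (\<eta> o\<^sub>L inl_blinfun) +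
     f p * g2 q (\<xi> o\<^sub>L inr_blinfun) (\<eta> o\<^sub>L inr_blinfun))"

definition pullback ::
  "('a, 'e::euclidean_space) manifold \<Rightarrow> ('b, 'd::euclidean_space) manifold \<Rightarrow> ('a \<Rightarrow> 'b) \<Rightarrow>
     ('b, 'd) form \<Rightarrow> ('a, 'e) form" where
  "pullback M N F \<omega> p =
     (let c = chart_at M p; d = chart_at N (F p)
      in \<omega> (F p) o\<^sub>L Blinfun (frechet_derivative (coord d \<circ> F \<circ> param c) (at (coord c p))))"

abbreviation hlift where "hlift M1 M2 \<equiv> pullback (product_manifold M1 M2) M1 fst"
abbreviation vlift where "vlift M1 M2 \<equiv> pullback (product_manifold M1 M2) M2 snd"

lemma hlift_eq:
  assumes "smooth_manifold M1" "smooth_manifold M2"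
  shows "hlift M1 M2 \<alpha> (p, q) = \<alpha> p o\<^sub>L fst_blinfun"
proof -
  let ?c = "chart_at M1 p" and ?d = "chart_at M2 q"
  have M1: "?c \<in> atlas M1" "p \<in> source ?c" and M2: "?d \<in> atlas M2" "q \<in> source ?d"
    using assms by (simp_all add: smooth_manifold_def)
  have c: "open (target ?c)" "homeomorphism (source ?c) (target ?c) (coord ?c) (param ?c)"
    using assms(1) M1 unfolding smooth_manifold_def by blast+
  have d: "open (target ?d)" "homeomorphism (source ?d) (target ?d) (coord ?d) (param ?d)"
    using assms(2) M2 unfolding smooth_manifold_def by blast+
  let ?F = "coord ?c \<circ> fst \<circ> map_prod (param ?c) (param ?d)"
  have "(?F has_derivative fst) (at (coord ?c p, coord ?d q))"
  proof (rule has_derivative_transform_within_open)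
    show "(fst has_derivative fst) (at (coord ?c p, coord ?d q))"
      by (rule bounded_linear_imp_has_derivative[OF bounded_linear_fst])
    show "open (target ?c \<times> target ?d)" using c(1) d(1) by (rule open_Times)
    show "(coord ?c p, coord ?d q) \<in> target ?c \<times> target ?d" using M1(2) M2(2) by simp
    show "fst x = ?F x" if "x \<in> target ?c \<times> target ?d" for x
      using that homeomorphism_apply2[OF c(2), of "fst x"] by (cases x) simp
  qed
  then have "frechet_derivative ?F (at (coord ?c p, coord ?d q)) = fst"
    by (metis frechet_derivative_at)
  then show ?thesis
    by (simp add: pullback_def product_manifold_def product_chart_def fst_blinfun_def Let_def)
qed

lemma vlift_eq:
  assumes "smooth_manifold M1" "smooth_manifold M2"
  shows "vlift M1 M2 \<alpha> (p, q) = \<alpha> q o\<^sub>L snd_blinfun"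
proof -
  let ?c = "chart_at M1 p" and ?d = "chart_at M2 q"
  have M1: "?c \<in> atlas M1" "p \<in> source ?c" and M2: "?d \<in> atlas M2" "q \<in> source ?d"
    using assms by (simp_all add: smooth_manifold_def)
  have c: "open (target ?c)" "homeomorphism (source ?c) (target ?c) (coord ?c) (param ?c)"
    using assms(1) M1 unfolding smooth_manifold_def by blast+
  have d: "open (target ?d)" "homeomorphism (source ?d) (target ?d) (coord ?d) (param ?d)"
    using assms(2) M2 unfolding smooth_manifold_def by blast+
  let ?F = "coord ?d \<circ> snd \<circ> map_prod (param ?c) (param ?d)"
  have "(?F has_derivative snd) (at (coord ?c p, coord ?d q))"
  proof (rule has_derivative_transform_within_open)
    show "(snd has_derivative snd) (at (coord ?c p, coord ?d q))"
      by (rule bounded_linear_imp_has_derivative[OF bounded_linear_snd])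
    show "open (target ?c \<times> target ?d)" using c(1) d(1) by (rule open_Times)
    show "(coord ?c p, coord ?d q) \<in> target ?c \<times> target ?d" using M1(2) M2(2) by simp
    show "snd x = ?F x" if "x \<in> target ?c \<times> target ?d" for x
      using that homeomorphism_apply2[OF d(2), of "snd x"] by (cases x) simp
  qed
  then have "frechet_derivative ?F (at (coord ?c p, coord ?d q)) = snd"
    by (metis frechet_derivative_at)
  then show ?thesis
    by (simp add: pullback_def product_manifold_def product_chart_def snd_blinfun_def Let_def)
qed

lemma blinfun_lift_simps [simp]:
  "(\<xi> o\<^sub>L fst_blinfun) o\<^sub>L inl_blinfun = \<xi>" "(\<zeta> o\<^sub>L snd_blinfun) o\<^sub>L inl_blinfun = 0"
  "(\<xi> o\<^sub>L fst_blinfun) o\<^sub>L inr_blinfun = 0" "(\<zeta> o\<^sub>L snd_blinfun) o\<^sub>L inr_blinfun = \<zeta>"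
  by (auto intro!: blinfun_eqI simp: inl_blinfun.rep_eq inr_blinfun.rep_eq)

lemma warped_bivector_lifts:
  assumes "smooth_manifold M1" "smooth_manifold M2" "bivector_field M1 P1" "bivector_field M2 P2"
  shows
    "tensor_apply (warped_bivector \<mu> P1 P2) (hlift M1 M2 \<alpha>) (hlift M1 M2 \<beta>) =
       tensor_apply P1 \<alpha> \<beta> \<circ> fst"
    "tensor_apply (warped_bivector \<mu> P1 P2) (vlift M1 M2 \<gamma>) (vlift M1 M2 \<delta>) =
       (\<lambda>x. \<mu> (fst x) * tensor_apply P2 \<gamma> \<delta> (snd x))"
    "tensor_apply (warped_bivector \<mu> P1 P2) (hlift M1 M2 \<alpha>) (vlift M1 M2 \<gamma>) = (\<lambda>_. 0)"
proof -
  have "bilinear (P1 p)" "bilinear (P2 q)" for p q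
    using assms(3,4) unfolding bivector_field_def by blast+
  then show
    "tensor_apply (warped_bivector \<mu> P1 P2) (hlift M1 M2 \<alpha>) (hlift M1 M2 \<beta>) =
       tensor_apply P1 \<alpha> \<beta> \<circ> fst"
    "tensor_apply (warped_bivector \<mu> P1 P2) (vlift M1 M2 \<gamma>) (vlift M1 M2 \<delta>) =
       (\<lambda>x. \<mu> (fst x) * tensor_apply P2 \<gamma> \<delta> (snd x))"
    "tensor_apply (warped_bivector \<mu> P1 P2) (hlift M1 M2 \<alpha>) (vlift M1 M2 \<gamma>) = (\<lambda>_. 0)"
    by (auto simp: fun_eq_iff tensor_apply_def warped_bivector_def hlift_eq[OF assms(1,2)]
        vlift_eq[OF assms(1,2)] bilinear_lzero bilinear_rzero)
qed

lemma bilinear_cometric: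
  assumes "pseudo_riemannian_metric M gt"
  shows "bilinear (cometric gt p)"
proof -
  have b: "bilinear (gt p)" and n: "\<And>v. (\<forall>w. gt p v w = 0) \<Longrightarrow> v = 0"
    using assms unfolding pseudo_riemannian_metric_def by auto
  define L where "L v = (\<Sum>i\<in>Basis. gt p v i *\<^sub>R i)" for v
  have Li: "L v \<bullet> w = gt p v w" for v w
  proof -
    have "gt p v w = gt p v (\<Sum>i\<in>Basis. (w \<bullet> i) *\<^sub>R i)" by (simp add: euclidean_representation)
    also have "\<dots> = (\<Sum>i\<in>Basis. (w \<bullet> i) *\<^sub>R gt p v i)"
      using b unfolding bilinear_def by (simp add: linear_sum linear_scale)
    finally show ?thesis by (simp add: L_def inner_sum_left inner_commute[of w] mult.commute)
  qed
  have linL: "linear L"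
    by (rule linearI) (simp_all add: L_def bilinear_ladd[OF b] bilinear_lmul[OF b] scaleR_add_left
        sum.distrib scaleR_sum_right)
  have "inj L"
    unfolding linear_injective_0[OF linL] using n Li by (metis inner_zero_left)
  then have "surj L" using linear_injective_imp_surjective[OF linL] by blast
  have ex: "\<exists>v. \<forall>w. gt p v w = \<xi> w" for \<xi> :: "'b \<Rightarrow>\<^sub>L real"
  proof -
    obtain v where v: "L v = (\<Sum>i\<in>Basis. \<xi> i *\<^sub>R i)" using \<open>surj L\<close> by (metis surjD)
    have "gt p v w = \<xi> w" for w
    proof -
      have "\<xi> w = \<xi> (\<Sum>i\<in>Basis. (w \<bullet> i) *\<^sub>R i)" by (simp add: euclidean_representation)
      also have "\<dots> = (\<Sum>i\<in>Basis. (w \<bullet> i) *\<^sub>R \<xi> i)"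
        by (simp add: blinfun.sum_right blinfun.scaleR_right)
      finally show ?thesis
        by (simp add: Li[symmetric] v inner_sum_left inner_commute[of w] mult.commute)
    qed
    then show ?thesis by blast
  qed
  have uniq: "v = v'" if "\<forall>w. gt p v w = gt p v' w" for v v'
    using n[of "v - v'"] that by (simp add: bilinear_lsub[OF b])
  have sh: "gt p (metric_sharp gt p \<xi>) w = \<xi> w" for \<xi> :: "'b \<Rightarrow>\<^sub>L real" and w
  proof -
    obtain v where v: "\<forall>w. gt p v w = \<xi> w" using ex by blast
    then have "metric_sharp gt p \<xi> = v"
      unfolding metric_sharp_def by (intro the_equality) (auto intro: uniq)
    with v show ?thesis by simp
  qed
  have sym: "gt p v w = gt p w v" for v w
    using assms unfolding pseudo_riemannian_metric_def by auto
  have 1: "cometric gt p \<xi> \<eta> = \<xi> (metric_sharp gt p \<eta>)" for \<xi> \<eta>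
    by (simp add: cometric_def sh)
  have 2: "cometric gt p \<xi> \<eta> = \<eta> (metric_sharp gt p \<xi>)" for \<xi> \<eta>
    unfolding cometric_def by (subst sym) (rule sh)
  show ?thesis
    unfolding bilinear_def
  proof (intro conjI allI)
    show "linear (cometric gt p \<xi>)" for \<xi>
      by (rule linearI) (simp_all add: 2 blinfun.add_left blinfun.scaleR_left)
    show "linear (\<lambda>\<xi>. cometric gt p \<xi> \<eta>)" for \<eta>
      by (rule linearI) (simp_all add: 1 blinfun.add_left blinfun.scaleR_left)
  qed
qed

lemma warped_cometric_lifts:
  fixes f :: "'a::{t2_space,second_countable_topology} \<Rightarrow> real"
  assumes "smooth_manifold M1" "smooth_manifold M2"
    "pseudo_riemannian_metric M1 gt1" "pseudo_riemannian_metric M2 gt2"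
  defines "G \<equiv> warped_cometric f (cometric gt1) (cometric gt2)"
  shows
    "tensor_apply G (hlift M1 M2 \<alpha>) (hlift M1 M2 \<beta>) = tensor_apply (cometric gt1) \<alpha> \<beta> \<circ> fst"
    "tensor_apply G (vlift M1 M2 \<gamma>) (vlift M1 M2 \<delta>) =
       (\<lambda>x. f (fst x) * tensor_apply (cometric gt2) \<gamma> \<delta> (snd x))"
    "tensor_apply G (hlift M1 M2 \<alpha>) (vlift M1 M2 \<gamma>) = (\<lambda>_. 0)"
  using bilinear_cometric[OF assms(3)] bilinear_cometric[OF assms(4)]
  by (auto simp: fun_eq_iff tensor_apply_def G_def warped_cometric_def hlift_eq[OF assms(1,2)]
      vlift_eq[OF assms(1,2)] bilinear_lzero bilinear_rzero)

(* The values on lifts determine a bilinear form on the cotangent space of the product. *)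
lemma bilinear_eq_on_lifts:
  fixes B C :: "(('e::real_normed_vector \<times> 'd::real_normed_vector) \<Rightarrow>\<^sub>L real) \<Rightarrow> (('e \<times> 'd) \<Rightarrow>\<^sub>L real) \<Rightarrow> real"
  assumes "bilinear B" "bilinear C"
    and "\<And>\<xi> \<eta>. B (\<xi> o\<^sub>L fst_blinfun) (\<eta> o\<^sub>L fst_blinfun) = C (\<xi> o\<^sub>L fst_blinfun) (\<eta> o\<^sub>L fst_blinfun)"
    and "\<And>\<xi> \<zeta>. B (\<xi> o\<^sub>L fst_blinfun) (\<zeta> o\<^sub>L snd_blinfun) = C (\<xi> o\<^sub>L fst_blinfun) (\<zeta> o\<^sub>L snd_blinfun)"
    and "\<And>\<zeta> \<xi>. B (\<zeta> o\<^sub>L snd_blinfun) (\<xi> o\<^sub>L fst_blinfun) = C (\<zeta> o\<^sub>L snd_blinfun) (\<xi> o\<^sub>L fst_blinfun)"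
    and "\<And>\<zeta> \<theta>. B (\<zeta> o\<^sub>L snd_blinfun) (\<theta> o\<^sub>L snd_blinfun) = C (\<zeta> o\<^sub>L snd_blinfun) (\<theta> o\<^sub>L snd_blinfun)"
  shows "B = C"
proof (intro ext)
  fix \<xi> \<eta> :: "('e \<times> 'd) \<Rightarrow>\<^sub>L real"
  have *: "\<omega> = ((\<omega> o\<^sub>L inl_blinfun) o\<^sub>L fst_blinfun) + ((\<omega> o\<^sub>L inr_blinfun) o\<^sub>L snd_blinfun)"
    for \<omega> :: "('e \<times> 'd) \<Rightarrow>\<^sub>L real"
    by (auto intro!: blinfun_eqI
        simp: inl_blinfun.rep_eq inr_blinfun.rep_eq blinfun.add_left blinfun.add_right[symmetric])
  obtain \<xi>1 \<xi>2 \<eta>1 \<eta>2 where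
    "\<xi> = (\<xi>1 o\<^sub>L fst_blinfun) + (\<xi>2 o\<^sub>L snd_blinfun)"
    "\<eta> = (\<eta>1 o\<^sub>L fst_blinfun) + (\<eta>2 o\<^sub>L snd_blinfun)"
    using * by blast
  then show "B \<xi> \<eta> = C \<xi> \<eta>"
    by (simp add: assms(3-) bilinear_ladd[OF assms(1)] bilinear_radd[OF assms(1)]
        bilinear_ladd[OF assms(2)] bilinear_radd[OF assms(2)])
qed

end

theory Submission
  imports Defs
begin

text \<open>
The connection, the Koszul bracket and the curvature are linear over functions up to derivation terms,
and one-forms are locally generated by differentials of functions, on the product by differentials of
functions lifted from the factors.  So everything can be computed on lifts.  As \<open>f\<close> is Casimir and
\<open>d\<mu> = 0\<close>, the Koszul formula gives \<open>D \<alpha>\<^sup>h \<beta>\<^sup>h = (D\<^sub>1 \<alpha> \<beta>)\<^sup>h\<close>,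
\<open>D \<alpha>\<^sup>v \<beta>\<^sup>v = \<mu> (D\<^sub>2 \<alpha> \<beta>)\<^sup>v\<close> and zero on mixed lifts, whence the curvature on
lifts is \<open>R\<^sub>1\<^sup>h\<close>, \<open>\<mu>\<^sup>2 R\<^sub>2\<^sup>v\<close>, or zero in the mixed cases.

Since the bivector fields need not be Poisson, the curvature is not tensorial in its last argument: it is
so up to the defect \<open>[#\<alpha>, #\<beta>] - #[\<alpha>, \<beta>]\<close> of the anchor.  Flatness of the factors makes
their defects vanish, and the defect of the product is again determined on lifts, because on exact
forms it is the cyclic Jacobiator and hence tensorial in all three differentials.
\<close>

section \<open>Smooth maps\<close>

text \<open>The Levi-Civita connection is a \<open>SOME\<close>, so nothing about it is available
  until one has been constructed. Hence the Koszul formula must be represented by a smooth form,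
  which needs smoothness of the cometric, an inverse of the metric. From then on the connection is
  used only through its pairings g(D \<alpha> \<beta>, \<gamma>). Symmetry of second derivatives
  enters through the bracket of exact forms being exact. The product falls under the same theory
  because g^f is the cometric of an actual metric, gt1 + f^{-1} gt2. In the Koszul formula f occurs
  as a factor of the pairing of vertical forms, where it cancels, and under derivatives along the
  anchor, which the Casimir condition removes. Flat factors have no anchor defect because
  R(\<alpha>, \<beta>)(\<phi> \<gamma>) - \<phi> R(\<alpha>, \<beta>) \<gamma> is the defect times
  \<gamma>, and \<gamma> can be chosen nonzero at a given point. To descend from the product to M2,
  one point with \<mu> nonzero is enough: \<mu>^2 is divided out there, and R2 does not depend on
  the point of M1.\<close>

lemma Ck_on_SucD: "Ck_on (Suc k) S F \<Longrightarrow> Ck_on k S F"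
proof (induction k arbitrary: F)
  case 0
  then show ?case
    by (auto intro!: continuous_at_imp_continuous_on differentiable_imp_continuous_within)
qed auto

lemma Ck_on_subset: "Ck_on k S F \<Longrightarrow> T \<subseteq> S \<Longrightarrow> Ck_on k T F"
  by (induction k arbitrary: F) (auto intro: continuous_on_subset)

text \<open>\<open>frechet_derivative\<close> chooses among all derivatives, and both functions have
  the same ones; so this also covers points without a derivative.\<close>

lemma frechet_derivative_cong:
  assumes "open S" "x \<in> S" "\<And>y. y \<in> S \<Longrightarrow> F y = G y"
  shows "frechet_derivative F (at x) = frechet_derivative G (at x)"
proof -
  have "(F has_derivative D) (at x) \<longleftrightarrow> (G has_derivative D) (at x)" for D
    using assms has_derivative_transform_within_open[of F D x UNIV S G]
      has_derivative_transform_within_open[of G D x UNIV S F] by auto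
  then show ?thesis unfolding frechet_derivative_def by simp
qed

lemma differentiable_cong:
  assumes "open S" "x \<in> S" "\<And>y. y \<in> S \<Longrightarrow> F y = G y" "F differentiable (at x)"
  shows "G differentiable (at x)"
  using assms has_derivative_transform_within_open[of F _ x UNIV S G]
  unfolding differentiable_def by auto

lemma Ck_on_cong:
  assumes "open S" "\<And>x. x \<in> S \<Longrightarrow> F x = G x" "Ck_on k S F"
  shows "Ck_on k S G"
  using assms(2,3)
proof (induction k arbitrary: F G)
  case 0
  then show ?case by (simp cong: continuous_on_cong)
next
  case (Suc k)
  have "frechet_derivative F (at x) = frechet_derivative G (at x)" if "x \<in> S" for x
    by (rule frechet_derivative_cong[OF assms(1) that Suc.prems(1)])
  then have "Ck_on k S (\<lambda>x. frechet_derivative G (at x) v)" for v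
    using Suc.IH[of "\<lambda>x. frechet_derivative F (at x) v" "\<lambda>x. frechet_derivative G (at x) v"] Suc.prems(2)
    by auto
  moreover have "G differentiable (at x)" if "x \<in> S" for x
    using differentiable_cong[OF assms(1) that Suc.prems(1)] Suc.prems(2) that by auto
  ultimately show ?case by simp
qed

lemma Ck_on_local:
  assumes "\<And>x. x \<in> S \<Longrightarrow> \<exists>T. open T \<and> x \<in> T \<and> Ck_on k T F"
  shows "Ck_on k S F"
  using assms
proof (induction k arbitrary: F)
  case 0
  have "continuous (at x) F" if x: "x \<in> S" for x
    using 0[OF x] continuous_on_eq_continuous_at by auto
  then show ?case by (simp add: continuous_at_imp_continuous_on)
next
  case (Suc k)
  show ?case
    unfolding Ck_on.simps
  proof (intro conjI ballI allI)
    show "F differentiable (at x)" if "x \<in> S" for x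
      using Suc.prems[OF that] by auto
    show "Ck_on k S (\<lambda>x. frechet_derivative F (at x) v)" for v
    proof (rule Suc.IH)
      fix x assume "x \<in> S"
      from Suc.prems[OF this] show "\<exists>T. open T \<and> x \<in> T \<and> Ck_on k T (\<lambda>x. frechet_derivative F (at x) v)"
        by (auto simp del: split_paired_Ex)
    qed
  qed
qed

lemma frechet_derivative_eqI: "(F has_derivative D) (at x) \<Longrightarrow> frechet_derivative F (at x) = D"
  by (metis frechet_derivative_at)

text \<open>Exchanges the chosen derivative for an explicit formula, so that the closure rules below
  only have to supply a differentiation rule. Openness of S carries the exchange through the higher
  derivatives.\<close>

lemma Ck_on_SucI:
  assumes "open S" and "\<And>x. x \<in> S \<Longrightarrow> (F has_derivative D x) (at x)"
    and "\<And>v. Ck_on k S (\<lambda>x. D x v)"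
  shows "Ck_on (Suc k) S F"
proof -
  have "Ck_on k S (\<lambda>x. frechet_derivative F (at x) v)" for v
    by (rule Ck_on_cong[OF assms(1) _ assms(3)[of v]])
      (use frechet_derivative_eqI[OF assms(2)] in auto)
  then show ?thesis using assms(2) by (auto simp: differentiable_def)
qed

lemma Ck_on_SucE:
  assumes "Ck_on (Suc k) S F"
  obtains "\<And>x. x \<in> S \<Longrightarrow> (F has_derivative frechet_derivative F (at x)) (at x)"
    and "\<And>v. Ck_on k S (\<lambda>x. frechet_derivative F (at x) v)"
  using assms by (simp add: frechet_derivative_works)

lemma Ck_on_const: "open S \<Longrightarrow> Ck_on k S (\<lambda>x. c)"
  by (induction k arbitrary: c) (auto intro: Ck_on_SucI)

lemma Ck_on_linear:
  assumes "open S" "bounded_linear L" shows "Ck_on k S L"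
proof (cases k)
  case 0
  then show ?thesis using assms by (simp add: linear_continuous_on)
next
  case (Suc n)
  show ?thesis unfolding Suc
    by (rule Ck_on_SucI[OF assms(1), where D="\<lambda>_. L"])
      (auto intro: bounded_linear_imp_has_derivative assms Ck_on_const)
qed

lemma Ck_on_bounded_linear:
  assumes "open S" "bounded_linear L" "Ck_on k S F" shows "Ck_on k S (\<lambda>x. L (F x))"
  using assms(3)
proof (induction k arbitrary: F)
  case 0
  then show ?case using bounded_linear.continuous_on[OF assms(2)] by simp
next
  case (Suc k)
  obtain F: "\<And>x. x \<in> S \<Longrightarrow> (F has_derivative frechet_derivative F (at x)) (at x)"
    "\<And>v. Ck_on k S (\<lambda>x. frechet_derivative F (at x) v)" using Ck_on_SucE[OF Suc.prems] by blast
  show ?case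
    by (rule Ck_on_SucI[OF assms(1) bounded_linear.has_derivative[OF assms(2) F(1)] Suc.IH[OF F(2)]])
qed

lemma Ck_on_add:
  assumes "open S" "Ck_on k S F" "Ck_on k S G" shows "Ck_on k S (\<lambda>x. F x + G x)"
  using assms(2,3)
proof (induction k arbitrary: F G)
  case 0
  then show ?case by (simp add: continuous_on_add)
next
  case (Suc k)
  obtain F: "\<And>x. x \<in> S \<Longrightarrow> (F has_derivative frechet_derivative F (at x)) (at x)"
    "\<And>v. Ck_on k S (\<lambda>x. frechet_derivative F (at x) v)" using Ck_on_SucE[OF Suc.prems(1)] by blast
  obtain G: "\<And>x. x \<in> S \<Longrightarrow> (G has_derivative frechet_derivative G (at x)) (at x)"
    "\<And>v. Ck_on k S (\<lambda>x. frechet_derivative G (at x) v)" using Ck_on_SucE[OF Suc.prems(2)] by blast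
  show ?case
    by (rule Ck_on_SucI[OF assms(1) has_derivative_add[OF F(1) G(1)] Suc.IH[OF F(2) G(2)]])
qed

text \<open>Each term of the product rule leaves one factor undifferentiated, so the induction also
  needs F and G at the lower order.\<close>

lemma Ck_on_bilinear:
  assumes "open S" "bounded_bilinear B" "Ck_on k S F" "Ck_on k S G"
  shows "Ck_on k S (\<lambda>x. B (F x) (G x))"
  using assms(3,4)
proof (induction k arbitrary: F G)
  case 0
  then show ?case using bounded_bilinear.continuous_on[OF assms(2)] by simp
next
  case (Suc k)
  have FG: "Ck_on k S F" "Ck_on k S G" using Suc.prems Ck_on_SucD by blast+
  obtain F: "\<And>x. x \<in> S \<Longrightarrow> (F has_derivative frechet_derivative F (at x)) (at x)"
    "\<And>v. Ck_on k S (\<lambda>x. frechet_derivative F (at x) v)" using Ck_on_SucE[OF Suc.prems(1)] by blast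
  obtain G: "\<And>x. x \<in> S \<Longrightarrow> (G has_derivative frechet_derivative G (at x)) (at x)"
    "\<And>v. Ck_on k S (\<lambda>x. frechet_derivative G (at x) v)" using Ck_on_SucE[OF Suc.prems(2)] by blast
  show ?case
  proof (rule Ck_on_SucI[OF assms(1)])
    show "((\<lambda>x. B (F x) (G x)) has_derivative
      (\<lambda>v. B (F x) (frechet_derivative G (at x) v) + B (frechet_derivative F (at x) v) (G x))) (at x)"
      if "x \<in> S" for x
      using bounded_bilinear.FDERIV[OF assms(2)] F(1)[OF that] G(1)[OF that] by blast
    show "Ck_on k S (\<lambda>x. B (F x) (frechet_derivative G (at x) v) + B (frechet_derivative F (at x) v) (G x))"
      for v
      by (intro Ck_on_add[OF assms(1)] Suc.IH FG F G)
  qed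
qed

lemma Ck_on_sum:
  assumes "open S" "\<And>i. i \<in> I \<Longrightarrow> Ck_on k S (F i)" shows "Ck_on k S (\<lambda>x. \<Sum>i\<in>I. F i x)"
  using assms(2)
  by (induction I rule: infinite_finite_induct) (auto intro: Ck_on_const Ck_on_add assms(1))

lemma linear_euclidean_sum:
  fixes v :: "'e::euclidean_space"
  assumes "linear L" shows "L v = (\<Sum>i\<in>Basis. (v \<bullet> i) *\<^sub>R L i)"
proof -
  have "L v = L (\<Sum>i\<in>Basis. (v \<bullet> i) *\<^sub>R i)" by (simp add: euclidean_representation)
  also have "\<dots> = (\<Sum>i\<in>Basis. (v \<bullet> i) *\<^sub>R L i)"
    by (simp add: linear_sum[OF assms] linear_scale[OF assms])
  finally show ?thesis .
qed

text \<open>In the chain rule the direction fed to the derivative of F varies with x, whereas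
  \<open>Ck_on\<close> speaks of fixed directions. Expanding that direction in the basis turns the
  derivative into a sum of scalars times fixed directional derivatives of F composed with G, to
  which the induction hypothesis applies.\<close>

lemma Ck_on_compose:
  fixes F :: "'d::euclidean_space \<Rightarrow> 'b::real_normed_vector" and G :: "'e::euclidean_space \<Rightarrow> 'd"
  assumes "open S" "open T" "G ` S \<subseteq> T" "Ck_on k T F" "Ck_on k S G"
  shows "Ck_on k S (\<lambda>x. F (G x))"
  using assms(4,5)
proof (induction k arbitrary: F)
  case 0
  then show ?case using continuous_on_compose2[of T F S G] assms(3) by simp
next
  case (Suc k)
  have GS: "Ck_on k S G" using Suc.prems Ck_on_SucD by blast
  obtain F: "\<And>x. x \<in> T \<Longrightarrow> (F has_derivative frechet_derivative F (at x)) (at x)"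
    "\<And>v. Ck_on k T (\<lambda>x. frechet_derivative F (at x) v)" using Ck_on_SucE[OF Suc.prems(1)] by blast
  obtain G: "\<And>x. x \<in> S \<Longrightarrow> (G has_derivative frechet_derivative G (at x)) (at x)"
    "\<And>v. Ck_on k S (\<lambda>x. frechet_derivative G (at x) v)" using Ck_on_SucE[OF Suc.prems(2)] by blast
  let ?D = "\<lambda>x v. \<Sum>i\<in>Basis. (frechet_derivative G (at x) v \<bullet> i) *\<^sub>R frechet_derivative F (at (G x)) i"
  show ?case
  proof (rule Ck_on_SucI[OF assms(1)])
    fix x assume x: "x \<in> S"
    then have Fx: "(F has_derivative frechet_derivative F (at (G x))) (at (G x))"
      using assms(3) F(1) by auto
    have "((\<lambda>x. F (G x)) has_derivative (\<lambda>v. frechet_derivative F (at (G x)) (frechet_derivative G (at x) v))) (at x)"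
      using diff_chain_at[OF G(1)[OF x] Fx] by (simp add: o_def)
    also have "(\<lambda>v. frechet_derivative F (at (G x)) (frechet_derivative G (at x) v)) = ?D x"
      by (rule ext) (rule linear_euclidean_sum[OF has_derivative_linear[OF Fx]])
    finally show "((\<lambda>x. F (G x)) has_derivative ?D x) (at x)" .
  next
    fix v
    show "Ck_on k S (\<lambda>x. ?D x v)"
      by (intro Ck_on_sum[OF assms(1)] Ck_on_bilinear[OF assms(1) bounded_bilinear_scaleR]
          Ck_on_bounded_linear[OF assms(1) bounded_linear_inner_left] G Suc.IH F GS)
  qed
qed

lemma smooth_onD: "smooth_on S F \<Longrightarrow> Ck_on k S F"
  by (simp add: smooth_on_def)

lemma smooth_on_has_derivative:
  "smooth_on S F \<Longrightarrow> x \<in> S \<Longrightarrow> (F has_derivative frechet_derivative F (at x)) (at x)"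
  using smooth_onD[of S F "Suc 0"] by (simp add: frechet_derivative_works)

lemma smooth_on_continuous_on: "smooth_on S F \<Longrightarrow> continuous_on S F"
  using smooth_onD[of S F 0] by simp

lemma smooth_on_derivative: "smooth_on S F \<Longrightarrow> smooth_on S (\<lambda>x. frechet_derivative F (at x) v)"
  unfolding smooth_on_def by (metis Ck_on.simps(2))

lemma smooth_on_subset: "smooth_on S F \<Longrightarrow> T \<subseteq> S \<Longrightarrow> smooth_on T F"
  unfolding smooth_on_def using Ck_on_subset by blast

lemma smooth_on_cong:
  "open S \<Longrightarrow> (\<And>x. x \<in> S \<Longrightarrow> F x = G x) \<Longrightarrow> smooth_on S F \<Longrightarrow> smooth_on S G"
  unfolding smooth_on_def using Ck_on_cong by blast

lemma smooth_on_local: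
  "(\<And>x. x \<in> S \<Longrightarrow> \<exists>T. open T \<and> x \<in> T \<and> smooth_on T F) \<Longrightarrow> smooth_on S F"
  unfolding smooth_on_def by (meson Ck_on_local)

lemma smooth_on_const: "open S \<Longrightarrow> smooth_on S (\<lambda>x. c)"
  unfolding smooth_on_def using Ck_on_const by blast

lemma smooth_on_linear: "open S \<Longrightarrow> bounded_linear L \<Longrightarrow> smooth_on S L"
  unfolding smooth_on_def using Ck_on_linear by blast

lemma smooth_on_bounded_linear:
  "open S \<Longrightarrow> bounded_linear L \<Longrightarrow> smooth_on S F \<Longrightarrow> smooth_on S (\<lambda>x. L (F x))"
  unfolding smooth_on_def using Ck_on_bounded_linear by blast

lemma smooth_on_add:
  "open S \<Longrightarrow> smooth_on S F \<Longrightarrow> smooth_on S G \<Longrightarrow> smooth_on S (\<lambda>x. F x + G x)"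
  unfolding smooth_on_def using Ck_on_add by blast

lemma smooth_on_bilinear:
  "open S \<Longrightarrow> bounded_bilinear B \<Longrightarrow> smooth_on S F \<Longrightarrow> smooth_on S G \<Longrightarrow> smooth_on S (\<lambda>x. B (F x) (G x))"
  unfolding smooth_on_def using Ck_on_bilinear by blast

lemma smooth_on_sum:
  "open S \<Longrightarrow> (\<And>i. i \<in> I \<Longrightarrow> smooth_on S (F i)) \<Longrightarrow> smooth_on S (\<lambda>x. \<Sum>i\<in>I. F i x)"
  unfolding smooth_on_def by (auto intro: Ck_on_sum)

lemma smooth_on_compose:
  fixes F :: "'d::euclidean_space \<Rightarrow> 'b::real_normed_vector" and G :: "'e::euclidean_space \<Rightarrow> 'd"
  shows "open S \<Longrightarrow> open T \<Longrightarrow> G ` S \<subseteq> T \<Longrightarrow> smooth_on T F \<Longrightarrow> smooth_on S G \<Longrightarrow> smooth_on S (\<lambda>x. F (G x))"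
  unfolding smooth_on_def using Ck_on_compose by blast

lemmas smooth_on_scaleR = smooth_on_bilinear[OF _ bounded_bilinear_scaleR]
  and smooth_on_mult = smooth_on_bilinear[OF _ bounded_bilinear_mult]
  and smooth_on_inner_left = smooth_on_bounded_linear[OF _ bounded_linear_inner_left]
  and smooth_on_blinfun_apply = smooth_on_bilinear[OF _ bounded_bilinear_blinfun_apply]

lemma smooth_on_minus: "open S \<Longrightarrow> smooth_on S F \<Longrightarrow> smooth_on S (\<lambda>x. - F x)"
  by (rule smooth_on_bounded_linear[OF _ bounded_linear_minus[OF bounded_linear_ident]])

text \<open>Bootstrapping: the derivative is the derivative of F times two copies of the inverse
  itself, so order k of the inverse yields order k + 1.\<close>

lemma smooth_on_inverse:
  fixes F :: "'e::euclidean_space \<Rightarrow> real"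
  assumes "open S" "smooth_on S F" "\<And>x. x \<in> S \<Longrightarrow> F x \<noteq> 0"
  shows "smooth_on S (\<lambda>x. inverse (F x))"
proof -
  have "Ck_on k S (\<lambda>x. inverse (F x))" for k
  proof (induction k)
    case 0
    then show ?case using continuous_on_inverse smooth_on_continuous_on[OF assms(2)] assms(3) by auto
  next
    case (Suc k)
    show ?case
    proof (rule Ck_on_SucI[OF assms(1)])
      show "((\<lambda>x. inverse (F x)) has_derivative
        (\<lambda>v. - (inverse (F x) * frechet_derivative F (at x) v * inverse (F x)))) (at x)" if "x \<in> S" for x
        by (rule Deriv.has_derivative_inverse[OF assms(3)[OF that] smooth_on_has_derivative[OF assms(2) that]])
      show "Ck_on k S (\<lambda>x. - (inverse (F x) * frechet_derivative F (at x) v * inverse (F x)))" for v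
        by (intro Ck_on_bounded_linear[OF assms(1) bounded_linear_minus[OF bounded_linear_ident]]
            Ck_on_bilinear[OF assms(1) bounded_bilinear_mult] Suc smooth_onD[OF smooth_on_derivative[OF assms(2)]])
    qed
  qed
  then show ?thesis by (simp add: smooth_on_def)
qed

lemma blinfun_euclidean_sum:
  fixes F :: "'d::euclidean_space \<Rightarrow>\<^sub>L 'b::real_normed_vector"
  shows "F = (\<Sum>i\<in>Basis. blinfun_scaleR_left (F i) o\<^sub>L blinfun_inner_left i)"
proof (rule blinfun_eqI)
  fix v
  have "F v = (\<Sum>i\<in>Basis. (v \<bullet> i) *\<^sub>R F i)"
    by (rule linear_euclidean_sum[OF bounded_linear.linear[OF blinfun.bounded_linear_right]])
  then show "F v = (\<Sum>i\<in>Basis. blinfun_scaleR_left (F i) o\<^sub>L blinfun_inner_left i) v"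
    by (simp add: blinfun.sum_left)
qed

text \<open>An operator on a finite-dimensional space is a finite sum of bounded linear images of
  its values on the basis, so smoothness in operator norm can be tested on basis vectors.\<close>

lemma smooth_on_blinfun:
  fixes F :: "'e::euclidean_space \<Rightarrow> 'd::euclidean_space \<Rightarrow>\<^sub>L 'b::real_normed_vector"
  assumes "open S" "\<And>i. i \<in> Basis \<Longrightarrow> smooth_on S (\<lambda>x. F x i)"
  shows "smooth_on S F"
proof (rule smooth_on_cong[OF assms(1)])
  show "(\<Sum>i\<in>Basis. blinfun_scaleR_left (F x i) o\<^sub>L blinfun_inner_left i) = F x" for x
    using blinfun_euclidean_sum[of "F x"] by simp
  have bl: "bounded_linear (\<lambda>b::'b. blinfun_scaleR_left b o\<^sub>L L)" for L :: "'d \<Rightarrow>\<^sub>L real"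
    by (intro bounded_linear_compose[OF bounded_bilinear.bounded_linear_left[OF bounded_bilinear_blinfun_compose]
          bounded_linear_blinfun_scaleR_left])
  show "smooth_on S (\<lambda>x. \<Sum>i\<in>Basis. blinfun_scaleR_left (F x i) o\<^sub>L blinfun_inner_left i)"
    by (intro smooth_on_sum[OF assms(1)] smooth_on_bounded_linear[OF assms(1) bl] assms(2))
qed

lemma smooth_on_Pair:
  assumes "open S" "smooth_on S F" "smooth_on S G" shows "smooth_on S (\<lambda>x. (F x, G x))"
proof -
  have "smooth_on S (\<lambda>x. (F x, 0) + (0, G x))"
    by (intro smooth_on_add[OF assms(1)]
        smooth_on_bounded_linear[OF assms(1) bounded_linear_Pair[OF bounded_linear_ident bounded_linear_zero]]
        smooth_on_bounded_linear[OF assms(1) bounded_linear_Pair[OF bounded_linear_zero bounded_linear_ident]]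
        assms)
  then show ?thesis by simp
qed

lemma smooth_on_fst:
  assumes "open S" "open T" "smooth_on S F" shows "smooth_on (S \<times> T) (\<lambda>z. F (fst z))"
  by (rule smooth_on_compose[OF open_Times[OF assms(1,2)] assms(1) _ assms(3)])
    (auto intro: smooth_on_linear open_Times assms bounded_linear_fst)

lemma smooth_on_snd:
  assumes "open S" "open T" "smooth_on T F" shows "smooth_on (S \<times> T) (\<lambda>z. F (snd z))"
  by (rule smooth_on_compose[OF open_Times[OF assms(1,2)] assms(2) _ assms(3)])
    (auto intro: smooth_on_linear open_Times assms bounded_linear_snd)

section \<open>Smoothness of operator inversion\<close>

text \<open>Since w vanishes at x, continuity of u there is enough for the product rule: replacing u
  by its value at x costs o(1) times O(|y - x|). This differentiates an operator inverse before it
  is known to be differentiable.\<close>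

lemma has_derivative_bilinear_zero:
  assumes B: "bounded_bilinear B" and u: "(u \<longlongrightarrow> u x) (at x)"
    and w: "(w has_derivative D) (at x)" "w x = 0"
  shows "((\<lambda>y. B (u y) (w y)) has_derivative (\<lambda>v. B (u x) (D v))) (at x)"
proof -
  obtain K where K: "\<And>a b. norm (B a b) \<le> norm a * norm b * K" "K > 0"
    using bounded_bilinear.pos_bounded[OF B] by blast
  have lD: "bounded_linear D" using w(1) has_derivative_bounded_linear by blast
  obtain C where C: "\<And>v. norm (D v) \<le> norm v * C" "C > 0" using bounded_linear.pos_bounded[OF lD] by blast
  have w0: "((\<lambda>y. norm (w y - D (y - x)) / norm (y - x)) \<longlongrightarrow> 0) (at x)"
    using w unfolding has_derivative_iff_norm by simp
  \<comment> \<open>w is O(|y - x|): near x its remainder is below |y - x|, and C bounds the linear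
    part.\<close>
  have 1: "\<forall>\<^sub>F y in at x. norm (w y) \<le> (1 + C) * norm (y - x)"
  proof -
    have "\<forall>\<^sub>F y in at x. norm (w y - D (y - x)) / norm (y - x) < 1"
      using order_tendstoD(2)[OF w0, of 1] by simp
    moreover have "\<forall>\<^sub>F y in at x. y \<noteq> x" by (simp add: eventually_at_filter)
    ultimately show ?thesis
    proof eventually_elim
      case (elim y)
      then have "norm (w y - D (y - x)) < norm (y - x)" by simp
      moreover have "norm (w y) \<le> norm (w y - D (y - x)) + norm (D (y - x))"
        by (metis diff_add_cancel norm_triangle_ineq)
      ultimately show ?case using C(1)[of "y - x"] by (simp add: algebra_simps)
    qed
  qed
  have small: "((\<lambda>y. B (u y - u x) (w y)) has_derivative (\<lambda>v. 0)) (at x)"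
    unfolding has_derivative_iff_norm
  proof (intro conjI)
    have "((\<lambda>y. norm (u y - u x) * ((1 + C) * K)) \<longlongrightarrow> 0 * ((1 + C) * K)) (at x)"
      using u by (intro tendsto_mult tendsto_const) (simp add: LIM_zero tendsto_norm_zero)
    then have z: "((\<lambda>y. norm (u y - u x) * ((1 + C) * K)) \<longlongrightarrow> 0) (at x)" by simp
    have "\<forall>\<^sub>F y in at x. norm (norm (B (u y - u x) (w y)) / norm (y - x)) \<le> norm (u y - u x) * ((1 + C) * K)"
      using 1
    proof eventually_elim
      case (elim y)
      have "norm (B (u y - u x) (w y)) \<le> norm (u y - u x) * norm (w y) * K" by (rule K)
      also have "\<dots> \<le> norm (u y - u x) * ((1 + C) * norm (y - x)) * K"
        by (intro mult_left_mono mult_right_mono elim) (use K in auto)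
      finally have "norm (B (u y - u x) (w y)) \<le> norm (u y - u x) * ((1 + C) * K) * norm (y - x)"
        by (simp add: mult_ac)
      then show ?case
        using K(2) C(2) by (cases "y = x") (auto simp: divide_le_eq)
    qed
    from Lim_null_comparison[OF this z]
    show "((\<lambda>y. norm (B (u y - u x) (w y) - B (u x - u x) (w x) - 0) / norm (y - x)) \<longlongrightarrow> 0) (at x)"
      by (simp add: bounded_bilinear.zero_left[OF B])
  qed simp
  have "((\<lambda>y. B (u x) (w y)) has_derivative (\<lambda>v. B (u x) (D v))) (at x)"
    by (rule bounded_linear.has_derivative[OF bounded_bilinear.bounded_linear_right[OF B] w(1)])
  from has_derivative_add[OF small this] show ?thesis
    by (simp add: bounded_bilinear.diff_left[OF B])
qed

text \<open>The resolvent identity \<open>eq\<close> yields continuity of H, then an explicit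
  derivative built from H and the derivative of G; as for real inverses, this raises the order of
  smoothness one step at a time.\<close>

lemma smooth_on_blinfun_inverse:
  fixes G :: "'e::euclidean_space \<Rightarrow> 'd::real_normed_vector \<Rightarrow>\<^sub>L 'c::real_normed_vector"
    and H :: "'e \<Rightarrow> 'c \<Rightarrow>\<^sub>L 'd"
  assumes "open S" "smooth_on S G"
    and HG: "\<And>x v. x \<in> S \<Longrightarrow> H x (G x v) = v" and GH: "\<And>x v. x \<in> S \<Longrightarrow> G x (H x v) = v"
  shows "smooth_on S H"
proof -
  let ?G' = "\<lambda>x v. frechet_derivative G (at x) v"
  have eq: "H x - H x0 = - (H x o\<^sub>L ((G x - G x0) o\<^sub>L H x0))" if "x \<in> S" "x0 \<in> S" for x x0
    by (rule blinfun_eqI) (simp add: that HG GH blinfun.diff_left blinfun.diff_right blinfun.minus_left)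
  have lim: "(H \<longlongrightarrow> H x0) (at x0)" if x0: "x0 \<in> S" for x0
  proof -
    have ev: "\<forall>\<^sub>F x in at x0. x \<in> S" using assms(1) x0 by (simp add: eventually_at_in_open')
    have G0: "((\<lambda>x. norm (G x - G x0)) \<longlongrightarrow> 0) (at x0)"
      using smooth_on_continuous_on[OF assms(2)] assms(1) x0
      by (simp add: continuous_on_eq_continuous_at isCont_def LIM_zero tendsto_norm_zero)
    then have G1: "((\<lambda>x. norm (G x - G x0) * norm (H x0)) \<longlongrightarrow> 0) (at x0)"
      by (rule tendsto_mult_left_zero)
    have G2: "((\<lambda>x. 2 * norm (H x0) * (norm (G x - G x0) * norm (H x0))) \<longlongrightarrow> 0) (at x0)"
      by (rule tendsto_mult_right_zero[OF G1])
    have "\<forall>\<^sub>F x in at x0. norm (G x - G x0) * norm (H x0) < 1/2"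
      using order_tendstoD(2)[OF G1, of "1/2"] by simp
    with ev have "\<forall>\<^sub>F x in at x0. norm (H x - H x0) \<le> 2 * norm (H x0) * (norm (G x - G x0) * norm (H x0))"
    proof eventually_elim
      case (elim x)
      have 1: "norm (H x - H x0) \<le> norm (H x) * (norm (G x - G x0) * norm (H x0))"
        unfolding eq[OF elim(1) x0] norm_minus_cancel
        by (rule order_trans[OF norm_blinfun_compose mult_left_mono[OF norm_blinfun_compose]]) simp
      \<comment> \<open>The factor 1/2 allows the unknown |H x| on the right to be absorbed, leaving
        a bound by 2 |H x0| that is independent of x.\<close>
      have "norm (H x) \<le> norm (H x0) + norm (H x - H x0)"
        by (metis add.commute diff_add_cancel norm_triangle_ineq)
      also have "\<dots> \<le> norm (H x0) + norm (H x) * (1/2)"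
        using 1 mult_left_mono[OF less_imp_le[OF elim(2)], of "norm (H x)"] by simp
      finally have "norm (H x) \<le> 2 * norm (H x0)" by simp
      with 1 show ?case by (meson mult_right_mono order_trans norm_ge_zero mult_nonneg_nonneg)
    qed
    from Lim_null_comparison[OF this G2] show ?thesis by (rule LIM_zero_cancel)
  qed
  \<comment> \<open>By \<open>eq\<close>, H is H x0 minus a product whose second factor vanishes at
    x0, so only continuity of the first factor H is required.\<close>
  have der: "(H has_derivative (\<lambda>v. - (H x0 o\<^sub>L (?G' x0 v o\<^sub>L H x0)))) (at x0)" if x0: "x0 \<in> S" for x0
  proof (rule has_derivative_transform_within_open[OF _ assms(1) x0])
    have w: "((\<lambda>x. (G x - G x0) o\<^sub>L H x0) has_derivative (\<lambda>v. ?G' x0 v o\<^sub>L H x0)) (at x0)"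
      using bounded_linear.has_derivative[OF bounded_bilinear.bounded_linear_left[OF bounded_bilinear_blinfun_compose]
          has_derivative_diff[OF smooth_on_has_derivative[OF assms(2) x0] has_derivative_const]]
      by simp
    show "((\<lambda>x. H x0 - (H x o\<^sub>L ((G x - G x0) o\<^sub>L H x0))) has_derivative
      (\<lambda>v. - (H x0 o\<^sub>L (?G' x0 v o\<^sub>L H x0)))) (at x0)"
      using has_derivative_diff[OF has_derivative_const has_derivative_bilinear_zero[OF bounded_bilinear_blinfun_compose lim[OF x0] w]]
      by simp
    show "H x0 - (H x o\<^sub>L ((G x - G x0) o\<^sub>L H x0)) = H x" if "x \<in> S" for x
      using eq[OF that x0] by (simp add: algebra_simps)
  qed
  have "Ck_on k S H" for k
  proof (induction k)
    case 0
    then show ?case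
      using lim by (simp add: continuous_on_eq_continuous_at[OF assms(1)] isCont_def)
  next
    case (Suc k)
    show ?case
      by (rule Ck_on_SucI[OF assms(1) der], assumption)
        (intro Ck_on_bounded_linear[OF assms(1) bounded_linear_minus[OF bounded_linear_ident]]
            Ck_on_bilinear[OF assms(1) bounded_bilinear_blinfun_compose] Suc
            smooth_onD[OF smooth_on_derivative[OF assms(2)]])
  qed
  then show ?thesis by (simp add: smooth_on_def)
qed

section \<open>Symmetry of mixed second derivatives\<close>

lemma smooth_on_DERIV_line:
  fixes F :: "'e::euclidean_space \<Rightarrow> real"
  assumes "smooth_on S F" "y + s *\<^sub>R u \<in> S"
  shows "((\<lambda>s. F (y + s *\<^sub>R u)) has_field_derivative frechet_derivative F (at (y + s *\<^sub>R u)) u) (at s)"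
proof -
  let ?F' = "frechet_derivative F (at (y + s *\<^sub>R u))"
  have F: "(F has_derivative ?F') (at (y + s *\<^sub>R u))"
    by (rule smooth_on_has_derivative[OF assms])
  have "((\<lambda>s. y + s *\<^sub>R u) has_derivative (\<lambda>r. r *\<^sub>R u)) (at s)"
    by (auto intro!: derivative_eq_intros)
  from diff_chain_at[OF this F] have "((\<lambda>s. F (y + s *\<^sub>R u)) has_derivative (\<lambda>r. ?F' (r *\<^sub>R u))) (at s)"
    by (simp add: o_def)
  then show ?thesis
    using linear_scale[OF has_derivative_linear[OF F]]
    by (simp add: has_field_derivative_def mult_commute_abs)
qed

text \<open>Two applications of the mean value theorem: along u to the difference of F across t w,
  then along w to the resulting first derivative.\<close>

lemma second_difference_mean_value:
  fixes F :: "'e::euclidean_space \<Rightarrow> real"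
  assumes S: "smooth_on S F" "open S" and t: "t > 0"
    and box: "\<And>a b. \<lbrakk>0 \<le> a; a \<le> t; 0 \<le> b; b \<le> t\<rbrakk> \<Longrightarrow> x + a *\<^sub>R u + b *\<^sub>R w \<in> S"
  obtains a b where "0 \<le> a" "a \<le> t" "0 \<le> b" "b \<le> t"
    "F (x + t *\<^sub>R u + t *\<^sub>R w) - F (x + t *\<^sub>R u) - (F (x + t *\<^sub>R w) - F x) =
      t * (t * frechet_derivative (\<lambda>y. frechet_derivative F (at y) u) (at (x + a *\<^sub>R u + b *\<^sub>R w)) w)"
proof -
  let ?Fu = "\<lambda>y. frechet_derivative F (at y) u"
  let ?\<phi> = "\<lambda>s. F (x + t *\<^sub>R w + s *\<^sub>R u) - F (x + s *\<^sub>R u)"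
  have "\<exists>a>0. a < t \<and> ?\<phi> t - ?\<phi> 0 = (t - 0) * (?Fu (x + t *\<^sub>R w + a *\<^sub>R u) - ?Fu (x + a *\<^sub>R u))"
  proof (rule MVT2[OF t])
    fix s :: real assume s: "0 \<le> s" "s \<le> t"
    show "(?\<phi> has_real_derivative ?Fu (x + t *\<^sub>R w + s *\<^sub>R u) - ?Fu (x + s *\<^sub>R u)) (at s)"
      using box[of s t] box[of s 0] s t
      by (intro DERIV_diff smooth_on_DERIV_line[OF S(1)]) (simp_all add: add_ac)
  qed
  then obtain a where a: "0 < a" "a < t"
    "?\<phi> t - ?\<phi> 0 = t * (?Fu (x + t *\<^sub>R w + a *\<^sub>R u) - ?Fu (x + a *\<^sub>R u))" by auto
  have "\<exists>b>0. b < t \<and> ?Fu (x + a *\<^sub>R u + t *\<^sub>R w) - ?Fu (x + a *\<^sub>R u + 0 *\<^sub>R w)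
     = (t - 0) * frechet_derivative ?Fu (at (x + a *\<^sub>R u + b *\<^sub>R w)) w"
    by (rule MVT2[OF t]) (use a box in \<open>auto intro!: smooth_on_DERIV_line[OF smooth_on_derivative[OF S(1)]]\<close>)
  then obtain b where "0 < b" "b < t" "?Fu (x + a *\<^sub>R u + t *\<^sub>R w) - ?Fu (x + a *\<^sub>R u)
     = t * frechet_derivative ?Fu (at (x + a *\<^sub>R u + b *\<^sub>R w)) w" by auto
  then show ?thesis using a that[of a b] by (simp add: add_ac)
qed

text \<open>The second difference over a parallelogram is symmetric in u and w. It equals t^2 times
  either mixed derivative at some point of the parallelogram, and for small t continuity brings both
  values within e, half the supposed gap, of their values at x.\<close>

lemma smooth_on_second_derivative_symmetric:
  fixes F :: "'e::euclidean_space \<Rightarrow> real"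
  assumes S: "open S" "smooth_on S F" and x: "x \<in> S"
  shows "frechet_derivative (\<lambda>y. frechet_derivative F (at y) u) (at x) w =
         frechet_derivative (\<lambda>y. frechet_derivative F (at y) w) (at x) u"
proof (rule ccontr)
  define A where "A u w y = frechet_derivative (\<lambda>y. frechet_derivative F (at y) u) (at y) w" for u w y
  assume "\<not> ?thesis"
  then have ne: "A u w x \<noteq> A w u x" by (simp add: A_def)
  define e where "e = \<bar>A u w x - A w u x\<bar> / 2"
  have e: "e > 0" using ne by (simp add: e_def)
  have cont: "isCont (A u w) x" for u w
    using smooth_on_continuous_on[OF smooth_on_derivative[OF smooth_on_derivative[OF S(2)]], of u w] x
    unfolding A_def continuous_on_eq_continuous_at[OF S(1)] by blast
  obtain d1 where d1: "d1 > 0" "\<And>y. dist y x < d1 \<Longrightarrow> dist (A u w y) (A u w x) < e"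
    using cont[of u w] e unfolding continuous_at_eps_delta by blast
  obtain d2 where d2: "d2 > 0" "\<And>y. dist y x < d2 \<Longrightarrow> dist (A w u y) (A w u x) < e"
    using cont[of w u] e unfolding continuous_at_eps_delta by blast
  obtain d3 where d3: "d3 > 0" "\<And>y. dist y x < d3 \<Longrightarrow> y \<in> S"
    using S(1) x unfolding open_dist by blast
  define d where "d = Min {d1, d2, d3}"
  have d: "d > 0" "d \<le> d1" "d \<le> d2" "d \<le> d3" using d1 d2 d3 by (auto simp: d_def)
  \<comment> \<open>Chosen so that the whole parallelogram with sides t u and t w stays within
    distance d of x; the summand 1 keeps the denominator positive and the estimate strict.\<close>
  define t where "t = d / (norm u + norm w + 1)"
  have np: "norm u + norm w + 1 > 0" by (smt (verit) norm_ge_zero)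
  have t: "t > 0" using d np by (simp add: t_def)
  have near: "dist (x + a *\<^sub>R u + b *\<^sub>R w) x < d" if "0 \<le> a" "a \<le> t" "0 \<le> b" "b \<le> t" for a b
  proof -
    have "norm (a *\<^sub>R u + b *\<^sub>R w) \<le> a * norm u + b * norm w"
      using that norm_triangle_ineq[of "a *\<^sub>R u" "b *\<^sub>R w"] by simp
    also have "\<dots> \<le> t * norm u + t * norm w" using that by (intro add_mono mult_right_mono) auto
    also have "\<dots> < t * (norm u + norm w + 1)" using t by (simp add: algebra_simps)
    also have "\<dots> = d" using np by (simp add: t_def)
    finally show ?thesis by (simp add: dist_norm add.assoc)
  qed
  obtain a b where ab: "0 \<le> a" "a \<le> t" "0 \<le> b" "b \<le> t"
    "F (x + t *\<^sub>R u + t *\<^sub>R w) - F (x + t *\<^sub>R u) - (F (x + t *\<^sub>R w) - F x) =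
      t * (t * A u w (x + a *\<^sub>R u + b *\<^sub>R w))"
    unfolding A_def
  proof (rule second_difference_mean_value[OF S(2,1) t, of x u w])
    show "x + a *\<^sub>R u + b *\<^sub>R w \<in> S" if "0 \<le> a" "a \<le> t" "0 \<le> b" "b \<le> t" for a b
      using near[of a b] that d3 d by force
  qed blast
  obtain a' b' where ab': "0 \<le> a'" "a' \<le> t" "0 \<le> b'" "b' \<le> t"
    "F (x + t *\<^sub>R w + t *\<^sub>R u) - F (x + t *\<^sub>R w) - (F (x + t *\<^sub>R u) - F x) =
      t * (t * A w u (x + a' *\<^sub>R w + b' *\<^sub>R u))"
    unfolding A_def
  proof (rule second_difference_mean_value[OF S(2,1) t, of x w u])
    show "x + a *\<^sub>R w + b *\<^sub>R u \<in> S" if "0 \<le> a" "a \<le> t" "0 \<le> b" "b \<le> t" for a b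
      using near[of b a] that d3 d by (force simp: add_ac)
  qed blast
  have "t * (t * A u w (x + a *\<^sub>R u + b *\<^sub>R w)) = t * (t * A w u (x + a' *\<^sub>R w + b' *\<^sub>R u))"
    unfolding ab(5)[symmetric] ab'(5)[symmetric] by (simp add: algebra_simps)
  then have "A u w (x + a *\<^sub>R u + b *\<^sub>R w) = A w u (x + a' *\<^sub>R w + b' *\<^sub>R u)" using t by simp
  moreover have "dist (A u w (x + a *\<^sub>R u + b *\<^sub>R w)) (A u w x) < e"
    using near[of a b] ab d by (intro d1) auto
  moreover have "dist (A w u (x + a' *\<^sub>R w + b' *\<^sub>R u)) (A w u x) < e"
    using near[of b' a'] ab' d by (intro d2) (auto simp: add_ac)
  ultimately show False unfolding e_def dist_real_def by (smt (verit) field_sum_of_halves)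
qed

(* The derivative of each flat_exp n is a combination of flat_exp (n + 1) and flat_exp (n + 2). *)
definition flat_exp :: "nat \<Rightarrow> real \<Rightarrow> real" where
  "flat_exp n t = (if t \<le> 0 then 0 else inverse t ^ n * exp (- inverse t))"

lemma DERIV_flat_exp: "(flat_exp n has_field_derivative flat_exp (n + 2) t - n * flat_exp (n + 1) t) (at t)"
proof (rule linorder_cases[of t 0])
  assume t: "t < 0"
  have "((\<lambda>_. 0) has_field_derivative 0) (at t)" by simp
  then have "(flat_exp n has_field_derivative 0) (at t)"
    by (rule has_field_derivative_transform_within_open[of _ _ _ "{..<0}"]) (use t in \<open>auto simp: flat_exp_def\<close>)
  then show ?thesis using t by (simp add: flat_exp_def)
next
  assume t: "t > 0"
  have *: "inverse t ^ m = inverse t * inverse t ^ (m - Suc 0) \<or> m = 0" for m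
    using power_minus_mult[of m "inverse t"] by (auto simp: mult.commute)
  have "((\<lambda>t. inverse t ^ n * exp (- inverse t)) has_field_derivative flat_exp (n + 2) t - n * flat_exp (n + 1) t) (at t)"
    using t *[of "n - 1"]
    by (cases n) (auto intro!: derivative_eq_intros simp: flat_exp_def power2_eq_square algebra_simps)
  then show ?thesis
    by (rule has_field_derivative_transform_within_open[of _ _ _ "{0<..}"]) (use t in \<open>auto simp: flat_exp_def\<close>)
next
  assume t: "t = 0"
  \<comment> \<open>This is the difference quotient at 0 from the right; the substitution of 1/y
    turns it into a power divided by an exponential.\<close>
  have "((\<lambda>y::real. inverse y ^ (n + 1) / exp (inverse y)) \<longlongrightarrow> 0) (at_right 0)"
    by (rule filterlim_compose[OF tendsto_power_div_exp_0 filterlim_inverse_at_top_right])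
  then have "((\<lambda>y. (flat_exp n y - flat_exp n 0) / (y - 0)) \<longlongrightarrow> 0) (at_right 0)"
    by (rule Lim_transform_eventually)
      (auto simp: eventually_at_right_less flat_exp_def exp_minus divide_inverse mult_ac
        intro!: eventually_mono[OF eventually_at_right_less])
  moreover have "((\<lambda>y. (flat_exp n y - flat_exp n 0) / (y - 0)) \<longlongrightarrow> 0) (at_left 0)"
    by (rule Lim_transform_eventually[OF tendsto_const])
      (auto simp: flat_exp_def intro!: eventually_mono[OF eventually_at_left_real[of "-1" 0]])
  ultimately have "((\<lambda>y. (flat_exp n y - flat_exp n 0) / (y - 0)) \<longlongrightarrow> 0) (at 0)"
    by (simp add: filterlim_split_at)
  then show ?thesis unfolding t has_field_derivative_iff by (simp add: flat_exp_def)
qed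

lemma smooth_on_flat_exp: "smooth_on UNIV (flat_exp n)"
proof -
  have "Ck_on k UNIV (flat_exp n)" for k
  proof (induction k arbitrary: n)
    case 0
    then show ?case
      by (auto intro!: continuous_at_imp_continuous_on DERIV_isCont[OF DERIV_flat_exp])
  next
    case (Suc k)
    show ?case
    proof (rule Ck_on_SucI[OF open_UNIV])
      show "(flat_exp n has_derivative (\<lambda>v. (flat_exp (n + 2) t - n * flat_exp (n + 1) t) * v)) (at t)" for t
        using DERIV_flat_exp by (simp add: has_field_derivative_def)
      have "Ck_on k UNIV (\<lambda>t. flat_exp (n + 2) t * v + flat_exp (n + 1) t * (- real n * v))" for v :: real
        by (intro Ck_on_add[OF open_UNIV] Ck_on_bilinear[OF open_UNIV bounded_bilinear_mult] Suc Ck_on_const open_UNIV)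
      from this[of v for v] show "Ck_on k UNIV (\<lambda>t. (flat_exp (n + 2) t - n * flat_exp (n + 1) t) * v)" for v
        by (simp add: algebra_simps)
    qed
  qed
  then show ?thesis by (simp add: smooth_on_def)
qed

text \<open>The classical exp(-1/(r^2 - |x - x0|^2)) inside a ball, zero outside. It is nonzero at
  x0 but has no plateau equal to 1, which is why powers of the bump accompany the later
  identities.\<close>

lemma exists_bump:
  fixes x0 :: "'e::euclidean_space"
  assumes "open S" "x0 \<in> S"
  obtains B :: "'e \<Rightarrow> real" and K where "smooth_on S B" "compact K" "K \<subseteq> S" "B x0 \<noteq> 0"
    "\<And>x. x \<notin> K \<Longrightarrow> B x = 0"
proof -
  obtain r where r: "r > 0" "cball x0 r \<subseteq> S" using assms open_contains_cball by blast
  let ?B = "\<lambda>x. flat_exp 0 (r\<^sup>2 + - ((x + - x0) \<bullet> (x + - x0)))"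
  show ?thesis
  proof (rule that[of ?B "cball x0 r"])
    show "smooth_on S ?B"
      by (intro smooth_on_compose[OF assms(1) open_UNIV _ smooth_on_flat_exp]
          smooth_on_add[OF assms(1)] smooth_on_const smooth_on_minus smooth_on_bilinear[OF _ bounded_bilinear_inner]
          smooth_on_linear bounded_linear_ident assms(1)) auto
    show "?B x0 \<noteq> 0" using r by (simp add: flat_exp_def)
    fix x assume "x \<notin> cball x0 r"
    then have "r < norm (x - x0)" by (simp add: dist_norm norm_minus_commute)
    then have "r\<^sup>2 \<le> (norm (x - x0))\<^sup>2" using r by (intro power_mono) auto
    then show "?B x = 0" by (simp add: flat_exp_def power2_norm_eq_inner)
  qed (use r in auto)
qed

section \<open>Functions and forms on a manifold\<close>

definition chart_ext :: "('a, 'e) chart \<Rightarrow> ('e \<Rightarrow> real) \<Rightarrow> 'a \<Rightarrow> real" where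
  "chart_ext c H p = (if p \<in> source c then H (coord c p) else 0)"

text \<open>Inductive rather than a set of finite sums, so that properties of tensorial maps and of
  the bracket on the span follow by rule induction.\<close>

inductive_set exact_span ::
  "('a, 'e::euclidean_space) manifold \<Rightarrow> ('a \<Rightarrow> real) set \<Rightarrow> ('a, 'e) form set" for M V where
  zero: "(\<lambda>p. 0) \<in> exact_span M V"
| add: "\<omega> \<in> exact_span M V \<Longrightarrow> smooth_fun M u \<Longrightarrow> v \<in> V \<Longrightarrow>
    (\<lambda>p. \<omega> p + u p *\<^sub>R differential M v p) \<in> exact_span M V"

(* The factor phi, nonzero at p, replaces a partition of unity: local generation near p becomes an
   identity of global forms. *)
definition generates :: "('a, 'e::euclidean_space) manifold \<Rightarrow> ('a \<Rightarrow> real) set \<Rightarrow> bool" where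
  "generates M V \<longleftrightarrow> (\<forall>v\<in>V. smooth_fun M v) \<and>
    (\<forall>p. \<exists>\<phi>. smooth_fun M \<phi> \<and> \<phi> p \<noteq> 0 \<and> (\<forall>\<alpha>\<in>one_forms M. (\<lambda>x. \<phi> x *\<^sub>R \<alpha> x) \<in> exact_span M V))"

locale smooth_mfd =
  fixes M :: "('a::{t2_space,second_countable_topology}, 'e::euclidean_space) manifold"
  assumes smooth: "smooth_manifold M"
begin

lemma chart:
  assumes "c \<in> atlas M"
  shows "open (source c)" "open (target c)" "p \<in> source c \<Longrightarrow> param c (coord c p) = p"
    "x \<in> target c \<Longrightarrow> coord c (param c x) = x" "x \<in> target c \<Longrightarrow> param c x \<in> source c"
    "p \<in> source c \<Longrightarrow> coord c p \<in> target c"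
    "continuous_on (source c) (coord c)" "continuous_on (target c) (param c)"
proof -
  have h: "open (source c)" "open (target c)" "homeomorphism (source c) (target c) (coord c) (param c)"
    using assms smooth unfolding smooth_manifold_def by blast+
  show "open (source c)" "open (target c)" "p \<in> source c \<Longrightarrow> param c (coord c p) = p"
    "x \<in> target c \<Longrightarrow> coord c (param c x) = x" "x \<in> target c \<Longrightarrow> param c x \<in> source c"
    "p \<in> source c \<Longrightarrow> coord c p \<in> target c"
    "continuous_on (source c) (coord c)" "continuous_on (target c) (param c)"
    using h unfolding homeomorphism_def by auto
qed

lemma chart_at: "chart_at M p \<in> atlas M" "p \<in> source (chart_at M p)"
  "coord (chart_at M p) p \<in> target (chart_at M p)" "param (chart_at M p) (coord (chart_at M p) p) = p"
  using smooth chart(3) unfolding smooth_manifold_def by blast+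

lemma open_param_vimage:
  assumes "c \<in> atlas M" "open U" shows "open (target c \<inter> param c -` U)"
  using continuous_open_preimage[OF chart(8)[OF assms(1)] chart(2)[OF assms(1)] assms(2)] .

lemma overlap_eq: "c \<in> atlas M \<Longrightarrow> coord c ` (source c \<inter> U) = target c \<inter> param c -` U"
  using chart(3,4,5) by (auto simp: image_iff)

lemma open_overlap:
  assumes "c \<in> atlas M" "c' \<in> atlas M" shows "open (coord c ` (source c \<inter> source c'))"
  unfolding overlap_eq[OF assms(1)] using open_param_vimage[OF assms(1) chart(1)[OF assms(2)]] .

lemma smooth_transition:
  assumes "c \<in> atlas M" "c' \<in> atlas M"
  shows "smooth_on (coord c ` (source c \<inter> source c')) (\<lambda>x. coord c' (param c x))"
  using smooth assms unfolding smooth_manifold_def o_def by blast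

lemma transition_has_derivative:
  assumes "c \<in> atlas M" "c' \<in> atlas M" "p \<in> source c" "p \<in> source c'"
  shows "((\<lambda>x. coord c' (param c x)) has_derivative transition_deriv c c' p) (at (coord c p))"
proof -
  have "((\<lambda>x. coord c' (param c x)) has_derivative
      frechet_derivative (\<lambda>x. coord c' (param c x)) (at (coord c p))) (at (coord c p))"
    by (rule smooth_on_has_derivative[OF smooth_transition[OF assms(1,2)]]) (use assms in auto)
  moreover from this have "blinfun_apply (transition_deriv c c' p) =
      frechet_derivative (\<lambda>x. coord c' (param c x)) (at (coord c p))"
    unfolding transition_deriv_def o_def
    by (intro bounded_linear_Blinfun_apply has_derivative_bounded_linear)
  ultimately show ?thesis by simp
qed

text \<open>The two coordinate changes compose to the identity on the overlap; as that is open, the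
  chain rule and uniqueness of derivatives apply.\<close>

lemma transition_deriv_inverse:
  assumes "c \<in> atlas M" "c' \<in> atlas M" "p \<in> source c" "p \<in> source c'"
  shows "transition_deriv c' c p (transition_deriv c c' p v) = v"
proof -
  let ?f = "\<lambda>x. coord c (param c' (coord c' (param c x)))"
  have p: "param c (coord c p) = p" using chart(3)[OF assms(1,3)] .
  have "(?f has_derivative (\<lambda>v. transition_deriv c' c p (transition_deriv c c' p v))) (at (coord c p))"
    using diff_chain_at[OF transition_has_derivative[OF assms(1,2,3,4)], of "\<lambda>y. coord c (param c' y)"]
      transition_has_derivative[OF assms(2,1,4,3)] p by (simp add: o_def)
  moreover have "(?f has_derivative (\<lambda>v. v)) (at (coord c p))"
  proof (rule has_derivative_transform_within_open[OF has_derivative_ident open_overlap[OF assms(1,2)]])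
    show "coord c p \<in> coord c ` (source c \<inter> source c')" using assms by auto
    show "x = ?f x" if "x \<in> coord c ` (source c \<inter> source c')" for x
      using that chart[OF assms(1)] chart[OF assms(2)] by auto
  qed
  ultimately show ?thesis using has_derivative_unique by metis
qed

text \<open>Makes the stored value of a tensor field at p agree with its components in
  \<open>chart_at M p\<close>.\<close>

lemma transition_deriv_self:
  assumes "c \<in> atlas M" "p \<in> source c" shows "transition_deriv c c p v = v"
proof -
  have "((\<lambda>x. coord c (param c x)) has_derivative (\<lambda>v. v)) (at (coord c p))"
    by (rule has_derivative_transform_within_open[OF has_derivative_ident chart(2)[OF assms(1)]])
      (use assms chart[OF assms(1)] in auto)
  then show ?thesis using transition_has_derivative[OF assms(1,1,2,2)] has_derivative_unique by metis
qed

lemma form_in_chart_at: "form_in M (chart_at M p) \<alpha> (coord (chart_at M p) p) = \<alpha> p"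
  by (rule blinfun_eqI) (simp add: form_in_def Let_def chart_at transition_deriv_self)

lemma vfield_in_chart_at: "vfield_in M (chart_at M p) X (coord (chart_at M p) p) = X p"
  by (simp add: vfield_in_def Let_def chart_at transition_deriv_self)

lemma form_in_linear:
  "form_in M c (\<lambda>p. \<alpha> p + \<beta> p) x = form_in M c \<alpha> x + form_in M c \<beta> x"
  "form_in M c (\<lambda>p. \<phi> p *\<^sub>R \<alpha> p) x = \<phi> (param c x) *\<^sub>R form_in M c \<alpha> x"
  "form_in M c (\<lambda>p. 0) x = 0"
  by (auto simp: form_in_def Let_def blinfun.add_left blinfun.scaleR_left intro!: blinfun_eqI)

lemma smooth_funD: "smooth_fun M \<phi> \<Longrightarrow> c \<in> atlas M \<Longrightarrow> smooth_on (target c) (\<lambda>x. \<phi> (param c x))"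
  by (simp add: smooth_fun_def o_def)

lemma one_formsD: "\<alpha> \<in> one_forms M \<Longrightarrow> c \<in> atlas M \<Longrightarrow> smooth_on (target c) (form_in M c \<alpha>)"
  by (simp add: one_forms_def)

lemma smooth_fun_const: "smooth_fun M (\<lambda>p. a)"
  by (simp add: smooth_fun_def o_def smooth_on_const chart)

lemma smooth_fun_add: "smooth_fun M \<phi> \<Longrightarrow> smooth_fun M \<psi> \<Longrightarrow> smooth_fun M (\<lambda>p. \<phi> p + \<psi> p)"
  by (simp add: smooth_fun_def o_def smooth_on_add chart)

lemma smooth_fun_mult: "smooth_fun M \<phi> \<Longrightarrow> smooth_fun M \<psi> \<Longrightarrow> smooth_fun M (\<lambda>p. \<phi> p * \<psi> p)"
  by (simp add: smooth_fun_def o_def smooth_on_mult chart)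

lemma smooth_fun_minus: "smooth_fun M \<phi> \<Longrightarrow> smooth_fun M (\<lambda>p. - \<phi> p)"
  by (simp add: smooth_fun_def o_def smooth_on_minus chart)

lemma smooth_fun_diff: "smooth_fun M \<phi> \<Longrightarrow> smooth_fun M \<psi> \<Longrightarrow> smooth_fun M (\<lambda>p. \<phi> p - \<psi> p)"
  using smooth_fun_add[OF _ smooth_fun_minus] by simp

lemma smooth_fun_inverse:
  "smooth_fun M \<phi> \<Longrightarrow> (\<And>p. \<phi> p \<noteq> 0) \<Longrightarrow> smooth_fun M (\<lambda>p. inverse (\<phi> p))"
  by (simp add: smooth_fun_def o_def smooth_on_inverse chart)

lemma smooth_fun_power: "smooth_fun M \<phi> \<Longrightarrow> smooth_fun M (\<lambda>p. \<phi> p ^ n)"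
  by (induction n) (auto intro: smooth_fun_const smooth_fun_mult)

lemma one_forms_zero: "(\<lambda>p. 0) \<in> one_forms M"
  by (simp add: one_forms_def form_in_linear[abs_def] smooth_on_const chart)

lemma one_forms_add: "\<alpha> \<in> one_forms M \<Longrightarrow> \<beta> \<in> one_forms M \<Longrightarrow> (\<lambda>p. \<alpha> p + \<beta> p) \<in> one_forms M"
  by (simp add: one_forms_def form_in_linear[abs_def] smooth_on_add chart)

lemma one_forms_scale: "smooth_fun M \<phi> \<Longrightarrow> \<alpha> \<in> one_forms M \<Longrightarrow> (\<lambda>p. \<phi> p *\<^sub>R \<alpha> p) \<in> one_forms M"
  by (simp add: one_forms_def form_in_linear[abs_def] smooth_on_scaleR smooth_funD chart)

lemma one_forms_scaleR: "\<alpha> \<in> one_forms M \<Longrightarrow> (\<lambda>p. a *\<^sub>R \<alpha> p) \<in> one_forms M"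
  using one_forms_scale[OF smooth_fun_const] .

lemma one_forms_minus: "\<alpha> \<in> one_forms M \<Longrightarrow> (\<lambda>p. - \<alpha> p) \<in> one_forms M"
  using one_forms_scaleR[of \<alpha> "-1"] by simp

lemma one_forms_diff: "\<alpha> \<in> one_forms M \<Longrightarrow> \<beta> \<in> one_forms M \<Longrightarrow> (\<lambda>p. \<alpha> p - \<beta> p) \<in> one_forms M"
  using one_forms_add[OF _ one_forms_minus] by simp

lemma one_forms_sum:
  "(\<And>i. i \<in> I \<Longrightarrow> \<alpha> i \<in> one_forms M) \<Longrightarrow> (\<lambda>p. \<Sum>i\<in>I. \<alpha> i p) \<in> one_forms M"
  by (induction I rule: infinite_finite_induct) (auto intro: one_forms_zero one_forms_add)

text \<open>Where \<phi> does not vanish, the components of \<omega> are those of the smooth form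
  \<phi> \<omega> divided by \<phi>, and smoothness is local.\<close>

lemma one_forms_local:
  assumes "\<And>p. \<exists>\<phi>. smooth_fun M \<phi> \<and> \<phi> p \<noteq> 0 \<and> (\<lambda>x. \<phi> x *\<^sub>R \<omega> x) \<in> one_forms M"
  shows "\<omega> \<in> one_forms M"
  unfolding one_forms_def
proof (intro CollectI ballI smooth_on_local)
  fix c x assume c: "c \<in> atlas M" and x: "x \<in> target c"
  obtain \<phi> where \<phi>: "smooth_fun M \<phi>" "\<phi> (param c x) \<noteq> 0" "(\<lambda>x. \<phi> x *\<^sub>R \<omega> x) \<in> one_forms M"
    using assms by blast
  let ?T = "target c \<inter> (\<lambda>y. \<phi> (param c y)) -` (- {0})"
  have T: "open ?T"
    by (rule continuous_open_preimage[OF smooth_on_continuous_on[OF smooth_funD[OF \<phi>(1) c]] chart(2)[OF c]]) auto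
  have "smooth_on ?T (\<lambda>y. inverse (\<phi> (param c y)) *\<^sub>R form_in M c (\<lambda>x. \<phi> x *\<^sub>R \<omega> x) y)"
    by (intro smooth_on_scaleR[OF T] smooth_on_inverse[OF T] smooth_on_subset[OF smooth_funD[OF \<phi>(1) c]]
        smooth_on_subset[OF one_formsD[OF \<phi>(3) c]]) auto
  then have "smooth_on ?T (form_in M c \<omega>)"
    by (rule smooth_on_cong[OF T, rotated]) (simp add: form_in_linear)
  then show "\<exists>T. open T \<and> x \<in> T \<and> smooth_on T (form_in M c \<omega>)"
    using T x \<phi>(2) by blast
qed

lemma differential_has_derivative:
  assumes "smooth_fun M \<phi>"
  shows "((\<lambda>x. \<phi> (param (chart_at M p) x)) has_derivative differential M \<phi> p) (at (coord (chart_at M p) p))"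
proof -
  have *: "((\<lambda>x. \<phi> (param (chart_at M p) x)) has_derivative
     frechet_derivative (\<lambda>x. \<phi> (param (chart_at M p) x)) (at (coord (chart_at M p) p))) (at (coord (chart_at M p) p))"
    by (rule smooth_on_has_derivative[OF smooth_funD[OF assms chart_at(1)] chart_at(3)])
  then show ?thesis
    by (simp add: differential_def Let_def o_def
        bounded_linear_Blinfun_apply[OF has_derivative_bounded_linear[OF *]])
qed

lemma differential_eqI:
  assumes "((\<lambda>x. \<phi> (param (chart_at M p) x)) has_derivative D) (at (coord (chart_at M p) p))"
  shows "differential M \<phi> p = Blinfun D"
  using frechet_derivative_eqI[OF assms] by (simp add: differential_def Let_def o_def)

lemma differential_eqI':
  assumes "((\<lambda>x. \<phi> (param (chart_at M p) x)) has_derivative blinfun_apply D) (at (coord (chart_at M p) p))"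
  shows "differential M \<phi> p = D"
  using differential_eqI[OF assms] by (simp add: blinfun_apply_inverse)

text \<open>\<open>differential\<close> is defined through a chart that changes with the point. By
  the chain rule its components in a fixed chart c are the partial derivatives there, which is what
  makes it a smooth form.\<close>

lemma form_in_differential:
  assumes "smooth_fun M \<phi>" "c \<in> atlas M" "x \<in> target c"
  shows "((\<lambda>x. \<phi> (param c x)) has_derivative form_in M c (differential M \<phi>) x) (at x)"
proof -
  let ?p = "param c x" let ?d = "chart_at M ?p"
  have p: "?p \<in> source c" "coord c ?p = x" using chart[OF assms(2)] assms(3) by auto
  have "((\<lambda>y. \<phi> (param ?d (coord ?d (param c y)))) has_derivative
     (\<lambda>v. differential M \<phi> ?p (transition_deriv c ?d ?p v))) (at x)"
    using diff_chain_at[OF transition_has_derivative[OF assms(2) chart_at(1) p(1) chart_at(2)],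
        of "\<lambda>y. \<phi> (param ?d y)"] differential_has_derivative[OF assms(1), of ?p] p(2)
    by (simp add: o_def)
  then have "((\<lambda>x. \<phi> (param c x)) has_derivative (\<lambda>v. differential M \<phi> ?p (transition_deriv c ?d ?p v))) (at x)"
  proof (rule has_derivative_transform_within_open[OF _ open_overlap[OF assms(2) chart_at(1)[of ?p]]])
    show "x \<in> coord c ` (source c \<inter> source ?d)" using p chart_at(2)[of ?p] by (metis IntI image_eqI)
    show "\<phi> (param ?d (coord ?d (param c y))) = \<phi> (param c y)" if "y \<in> coord c ` (source c \<inter> source ?d)" for y
      using that chart[OF assms(2)] chart[OF chart_at(1)[of ?p]] by auto
  qed
  moreover have "blinfun_apply (form_in M c (differential M \<phi>) x) = (\<lambda>v. differential M \<phi> ?p (transition_deriv c ?d ?p v))"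
    by (simp add: form_in_def Let_def fun_eq_iff)
  ultimately show ?thesis by simp
qed

lemma form_in_differential_eq:
  assumes "smooth_fun M \<phi>" "c \<in> atlas M" "x \<in> target c"
  shows "form_in M c (differential M \<phi>) x v = frechet_derivative (\<lambda>x. \<phi> (param c x)) (at x) v"
  by (simp add: frechet_derivative_eqI[OF form_in_differential[OF assms]])

lemma differential_in_one_forms: "smooth_fun M \<phi> \<Longrightarrow> differential M \<phi> \<in> one_forms M"
  unfolding one_forms_def
proof (intro CollectI ballI smooth_on_blinfun)
  fix c i assume \<phi>: "smooth_fun M \<phi>" and c: "c \<in> atlas M"
  show "open (target c)" using chart(2)[OF c] .
  show "smooth_on (target c) (\<lambda>x. form_in M c (differential M \<phi>) x i)"
    by (rule smooth_on_cong[OF chart(2)[OF c] _ smooth_on_derivative[OF smooth_funD[OF \<phi> c], of i]])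
      (simp add: form_in_differential_eq[OF \<phi> c])
qed

lemma differential_const: "differential M (\<lambda>p. a) p = 0"
  by (rule differential_eqI') (simp add: zero_blinfun.rep_eq)

lemma differential_add:
  assumes "smooth_fun M \<phi>" "smooth_fun M \<psi>"
  shows "differential M (\<lambda>p. \<phi> p + \<psi> p) p = differential M \<phi> p + differential M \<psi> p"
  using has_derivative_add[OF differential_has_derivative[OF assms(1)] differential_has_derivative[OF assms(2)]]
  by (intro differential_eqI') (simp add: plus_blinfun.rep_eq)

lemma differential_mult:
  assumes "smooth_fun M \<phi>" "smooth_fun M \<psi>"
  shows "differential M (\<lambda>p. \<phi> p * \<psi> p) p = \<phi> p *\<^sub>R differential M \<psi> p + \<psi> p *\<^sub>R differential M \<phi> p"
  using has_derivative_mult[OF differential_has_derivative[OF assms(1), of p] differential_has_derivative[OF assms(2), of p]]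
  by (intro differential_eqI') (simp add: plus_blinfun.rep_eq scaleR_blinfun.rep_eq chart_at(4) mult_ac)

lemma differential_scale:
  assumes "smooth_fun M \<phi>" shows "differential M (\<lambda>p. a * \<phi> p) p = a *\<^sub>R differential M \<phi> p"
  by (simp add: differential_mult[OF smooth_fun_const assms] differential_const)

lemma differential_minus:
  assumes "smooth_fun M \<phi>" shows "differential M (\<lambda>p. - \<phi> p) p = - differential M \<phi> p"
  using differential_scale[OF assms, of "-1"] by simp

section \<open>Extension by zero and generation by differentials\<close>

text \<open>The function is smooth on the chart domain and zero on the complement of the image of K.
  The two sets cover the manifold, and the second is open because a compact subset of a Hausdorff
  space is closed.\<close>

lemma smooth_chart_ext:
  assumes c: "c \<in> atlas M" and H: "smooth_on (target c) H"
    and K: "compact K" "K \<subseteq> target c" "\<And>x. x \<notin> K \<Longrightarrow> H x = 0"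
  shows "smooth_fun M (chart_ext c H)"
  unfolding smooth_fun_def o_def
proof (intro ballI smooth_on_local)
  fix c' x assume c': "c' \<in> atlas M" and x: "x \<in> target c'"
  show "\<exists>T. open T \<and> x \<in> T \<and> smooth_on T (\<lambda>x. chart_ext c H (param c' x))"
  proof (cases "param c' x \<in> source c")
    case True
    let ?T = "coord c' ` (source c' \<inter> source c)"
    have T: "open ?T" by (rule open_overlap[OF c' c])
    have "smooth_on ?T (\<lambda>x. H (coord c (param c' x)))"
      by (rule smooth_on_compose[OF T chart(2)[OF c] _ H smooth_transition[OF c' c]])
        (use chart[OF c] chart[OF c'] in auto)
    then have "smooth_on ?T (\<lambda>x. chart_ext c H (param c' x))"
      by (rule smooth_on_cong[OF T, rotated]) (use chart[OF c'] in \<open>auto simp: chart_ext_def\<close>)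
    moreover have "x \<in> ?T" unfolding overlap_eq[OF c'] using x True by simp
    ultimately show ?thesis using T by blast
  next
    case False
    let ?T = "target c' \<inter> param c' -` (- (param c ` K))"
    have "compact (param c ` K)"
      by (rule compact_continuous_image[OF continuous_on_subset[OF chart(8)[OF c] K(2)] K(1)])
    then have T: "open ?T"
      by (intro open_param_vimage[OF c']) (simp add: compact_imp_closed open_Compl)
    have z: "chart_ext c H (param c' y) = 0" if "y \<in> ?T" for y
      using that chart(3)[OF c] K(3) unfolding chart_ext_def by force
    have "smooth_on ?T (\<lambda>x. chart_ext c H (param c' x))"
      by (rule smooth_on_cong[OF T _ smooth_on_const[OF T, of 0]]) (simp add: z)
    moreover have "x \<in> ?T" using x False K(2) chart(5)[OF c] by auto
    ultimately show ?thesis using T by blast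
  qed
qed

lemma exact_span_one_forms:
  assumes "\<And>v. v \<in> V \<Longrightarrow> smooth_fun M v" "\<omega> \<in> exact_span M V" shows "\<omega> \<in> one_forms M"
  using assms(2)
proof induction
  case zero
  show ?case by (rule one_forms_zero)
next
  case (add \<omega> u v)
  then show ?case
    using one_forms_add[OF _ one_forms_scale[OF _ differential_in_one_forms[OF assms(1)]]] by blast
qed

lemma exact_span_plus:
  assumes "\<omega> \<in> exact_span M V" "\<omega>' \<in> exact_span M V" shows "(\<lambda>p. \<omega> p + \<omega>' p) \<in> exact_span M V"
  using assms(2)
proof induction
  case zero
  then show ?case using assms(1) by simp
next
  case (add \<omega>' u v)
  from exact_span.add[OF add(4,2,3)] show ?case by (simp add: add.assoc)
qed

lemma exact_span_scale:
  assumes "\<omega> \<in> exact_span M V" "smooth_fun M \<phi>" shows "(\<lambda>p. \<phi> p *\<^sub>R \<omega> p) \<in> exact_span M V"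
  using assms(1)
proof induction
  case zero
  then show ?case using exact_span.zero by simp
next
  case (add \<omega> u v)
  from exact_span.add[OF add(4) smooth_fun_mult[OF assms(2) add(2)] add(3)]
  show ?case by (simp add: scaleR_add_right)
qed

lemma exact_span_differential: "v \<in> V \<Longrightarrow> differential M v \<in> exact_span M V"
  using exact_span.add[OF exact_span.zero smooth_fun_const[of 1]] by simp

lemma exact_span_sum:
  "(\<And>i. i \<in> I \<Longrightarrow> \<omega> i \<in> exact_span M V) \<Longrightarrow> (\<lambda>p. \<Sum>i\<in>I. \<omega> i p) \<in> exact_span M V"
  by (induction I rule: infinite_finite_induct) (auto intro: exact_span.zero exact_span_plus)

(* The map pi allows values over a product of M with another manifold, as for lifted forms. *)
lemma tensorial_eq_zero:
  fixes T :: "('a, 'e) form \<Rightarrow> 'x \<Rightarrow> 'y::real_vector" and \<pi> :: "'x \<Rightarrow> 'a"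
  assumes V: "generates M V"
    and add: "\<And>\<alpha> \<beta> x. \<alpha> \<in> one_forms M \<Longrightarrow> \<beta> \<in> one_forms M \<Longrightarrow> T (\<lambda>p. \<alpha> p + \<beta> p) x = T \<alpha> x + T \<beta> x"
    and scale: "\<And>\<phi> \<alpha> x. smooth_fun M \<phi> \<Longrightarrow> \<alpha> \<in> one_forms M \<Longrightarrow> T (\<lambda>p. \<phi> p *\<^sub>R \<alpha> p) x = \<phi> (\<pi> x) *\<^sub>R T \<alpha> x"
    and zero: "\<And>v x. v \<in> V \<Longrightarrow> T (differential M v) x = 0"
    and \<alpha>: "\<alpha> \<in> one_forms M"
  shows "T \<alpha> x = 0"
proof -
  have VC: "smooth_fun M v" if "v \<in> V" for v using V that unfolding generates_def by blast
  have T0: "T \<omega> x = 0" if "\<omega> \<in> exact_span M V" for \<omega> x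
    using that
  proof induction
    case zero
    then show ?case using scale[OF smooth_fun_const[of 0] one_forms_zero] by simp
  next
    case (add \<omega> u v)
    have "differential M v \<in> one_forms M" by (rule differential_in_one_forms[OF VC[OF add(3)]])
    then show ?case
      using assms(2)[OF exact_span_one_forms[OF VC add(1)] one_forms_scale[OF add(2)]]
        scale[OF add(2)] zero[OF add(3)] add(4) by simp
  qed
  obtain \<phi> where \<phi>: "smooth_fun M \<phi>" "\<phi> (\<pi> x) \<noteq> 0" "(\<lambda>x. \<phi> x *\<^sub>R \<alpha> x) \<in> exact_span M V"
    using V \<alpha> unfolding generates_def by meson
  from T0[OF \<phi>(3), of x] scale[OF \<phi>(1) \<alpha>, of x] \<phi>(2) show ?thesis by simp
qed

end

(* psi is a bump function and y i are the coordinates multiplied by it, so that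
   frame i = psi^2 dx_i, and coef alpha i are the components of psi alpha. *)
locale chart_frame = smooth_mfd M
  for M :: "('a::{t2_space,second_countable_topology}, 'e::euclidean_space) manifold" +
  fixes c :: "('a, 'e) chart" and B :: "'e \<Rightarrow> real" and K :: "'e set"
  assumes c: "c \<in> atlas M" and B: "smooth_on (target c) B"
    and K: "compact K" "K \<subseteq> target c" "\<And>x. x \<notin> K \<Longrightarrow> B x = 0"
begin

definition "\<psi> = chart_ext c B"
definition "y i = chart_ext c (\<lambda>x. B x * (x \<bullet> i))"
definition "coef \<alpha> i = chart_ext c (\<lambda>x. B x * form_in M c \<alpha> x i)"
definition "frame i p = \<psi> p *\<^sub>R differential M (y i) p - y i p *\<^sub>R differential M \<psi> p"

lemma smooth_ext: "smooth_on (target c) H \<Longrightarrow> smooth_fun M (chart_ext c (\<lambda>x. B x * H x))"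
  by (rule smooth_chart_ext[OF c smooth_on_mult[OF chart(2)[OF c] B] K(1,2)]) (auto simp: K(3))

lemma smooth_\<psi>: "smooth_fun M \<psi>"
  unfolding \<psi>_def by (rule smooth_chart_ext[OF c B K])

lemma smooth_y: "smooth_fun M (y i)"
  unfolding y_def
  by (intro smooth_ext smooth_on_inner_left smooth_on_linear bounded_linear_ident chart(2)[OF c])

lemma smooth_coef: "\<alpha> \<in> one_forms M \<Longrightarrow> smooth_fun M (coef \<alpha> i)"
  unfolding coef_def
  by (intro smooth_ext smooth_on_blinfun_apply smooth_on_const one_formsD c chart(2)[OF c])

lemma frame_in_one_forms: "frame i \<in> one_forms M"
  unfolding frame_def[abs_def]
  by (intro one_forms_diff one_forms_scale differential_in_one_forms smooth_\<psi> smooth_y)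

text \<open>By the product rule the differential of y i contains x_i times the differential of
  \<psi>; the subtracted term of \<open>frame\<close> cancels exactly this.\<close>

lemma frame_eq:
  assumes p: "p \<in> source c"
  shows "frame i p v = (\<psi> p)\<^sup>2 * (transition_deriv (chart_at M p) c p v \<bullet> i)"
proof -
  let ?d = "chart_at M p" let ?x = "coord ?d p" and ?X = "\<lambda>x. coord c (param ?d x) \<bullet> i"
  have X: "(?X has_derivative (\<lambda>v. transition_deriv ?d c p v \<bullet> i)) (at ?x)"
    by (rule bounded_linear.has_derivative[OF bounded_linear_inner_left
          transition_has_derivative[OF chart_at(1) c chart_at(2) p]])
  have "((\<lambda>x. \<psi> (param ?d x) * ?X x) has_derivative
     (\<lambda>v. \<psi> (param ?d ?x) * (transition_deriv ?d c p v \<bullet> i) + differential M \<psi> p v * ?X ?x)) (at ?x)"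
    by (rule has_derivative_mult[OF differential_has_derivative[OF smooth_\<psi>] X])
  then have "((\<lambda>x. y i (param ?d x)) has_derivative
     (\<lambda>v. \<psi> p * (transition_deriv ?d c p v \<bullet> i) + differential M \<psi> p v * (coord c p \<bullet> i))) (at ?x)"
    unfolding chart_at(4)
    by (rule has_derivative_transform_within_open[OF _ open_overlap[OF chart_at(1)[of p] c]])
      (use p chart_at[of p] chart[OF chart_at(1)[of p]] chart[OF c]
        in \<open>auto simp: \<psi>_def y_def chart_ext_def\<close>)
  then have "blinfun_apply (differential M (y i) p) =
     (\<lambda>v. \<psi> p * (transition_deriv ?d c p v \<bullet> i) + differential M \<psi> p v * (coord c p \<bullet> i))"
    using differential_has_derivative[OF smooth_y] has_derivative_unique by blast
  moreover have "y i p = \<psi> p * (coord c p \<bullet> i)" using p by (simp add: y_def \<psi>_def chart_ext_def)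
  ultimately show ?thesis
    by (simp add: frame_def blinfun.diff_left blinfun.scaleR_left algebra_simps power2_eq_square)
qed

text \<open>One factor \<psi> comes from \<open>coef\<close> and two from \<open>frame\<close>. Off
  the chart domain both sides vanish, so the identity is global.\<close>

lemma frame_expansion: "(\<psi> p ^ 3) *\<^sub>R \<alpha> p = (\<Sum>i\<in>Basis. coef \<alpha> i p *\<^sub>R frame i p)"
proof (cases "p \<in> source c")
  case False
  then show ?thesis by (simp add: \<psi>_def coef_def chart_ext_def)
next
  case True
  let ?T = "transition_deriv (chart_at M p) c p" and ?T' = "transition_deriv c (chart_at M p) p"
  show ?thesis
  proof (rule blinfun_eqI)
    fix v
    have "\<alpha> p v = \<alpha> p (?T' (?T v))" using transition_deriv_inverse[OF chart_at(1) c chart_at(2) True] by simp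
    also have "\<dots> = form_in M c \<alpha> (coord c p) (?T v)"
      using chart[OF c] True by (simp add: form_in_def Let_def)
    also have "\<dots> = (\<Sum>i\<in>Basis. (?T v \<bullet> i) *\<^sub>R form_in M c \<alpha> (coord c p) i)"
      by (rule linear_euclidean_sum[OF bounded_linear.linear[OF blinfun.bounded_linear_right]])
    finally show "((\<psi> p ^ 3) *\<^sub>R \<alpha> p) v = (\<Sum>i\<in>Basis. coef \<alpha> i p *\<^sub>R frame i p) v"
      using True
      by (simp add: blinfun.sum_left blinfun.scaleR_left frame_eq sum_distrib_left coef_def \<psi>_def chart_ext_def
          power2_eq_square power3_eq_cube mult_ac)
  qed
qed

end

context smooth_mfd
begin

lemma exists_chart_frame:
  assumes "c \<in> atlas M" "p \<in> source c"
  obtains B K where "chart_frame M c B K" "chart_ext c B p \<noteq> 0"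
proof (rule exists_bump[OF chart(2)[OF assms(1)] chart(6)[OF assms]])
  fix B :: "'e \<Rightarrow> real" and K
  assume "smooth_on (target c) B" "compact K" "K \<subseteq> target c" "B (coord c p) \<noteq> 0"
    "\<And>x. x \<notin> K \<Longrightarrow> B x = 0"
  then show ?thesis using that[of B K] assms
    by (simp add: chart_frame_def chart_frame_axioms_def smooth_mfd_axioms chart_ext_def)
qed

text \<open>Constant multiples of the frame, with \<psi>(p)^2 divided out, attain any covector at p.
  Pointwise nondegeneracy can therefore be tested on global smooth forms.\<close>

lemma exists_form: "\<exists>\<gamma>\<in>one_forms M. \<gamma> p = \<xi>"
proof -
  let ?c = "chart_at M p"
  obtain B K where "chart_frame M ?c B K" and ne: "chart_ext ?c B p \<noteq> 0"
    using exists_chart_frame[OF chart_at(1,2)] .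
  then interpret F: chart_frame M ?c B K by simp
  let ?\<gamma> = "\<lambda>q. \<Sum>i\<in>Basis. (\<xi> i / (F.\<psi> p)\<^sup>2) *\<^sub>R F.frame i q"
  have "?\<gamma> p v = \<xi> v" for v
  proof -
    have "\<xi> v = (\<Sum>i\<in>Basis. (v \<bullet> i) *\<^sub>R \<xi> i)"
      by (rule linear_euclidean_sum[OF bounded_linear.linear[OF blinfun.bounded_linear_right]])
    then show ?thesis using ne
      by (simp add: blinfun.sum_left blinfun.scaleR_left F.frame_eq[OF chart_at(2)]
          transition_deriv_self[OF chart_at(1,2)] F.\<psi>_def mult_ac)
  qed
  then have "?\<gamma> p = \<xi>" by (rule blinfun_eqI)
  moreover have "?\<gamma> \<in> one_forms M" by (intro one_forms_sum one_forms_scaleR F.frame_in_one_forms)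
  ultimately show ?thesis by (rule bexI)
qed

text \<open>The frame is a combination of the differentials of \<psi> and y i, so
  \<open>frame_expansion\<close> puts \<psi>^3 \<alpha> into the span of exact forms.\<close>

lemma generates_all: "generates M {v. smooth_fun M v}"
  unfolding generates_def
proof (intro conjI allI ballI)
  fix p
  let ?c = "chart_at M p"
  obtain B K where "chart_frame M ?c B K" and ne: "chart_ext ?c B p \<noteq> 0"
    using exists_chart_frame[OF chart_at(1,2)] .
  then interpret F: chart_frame M ?c B K by simp
  have fr: "F.frame i \<in> exact_span M {v. smooth_fun M v}" for i
    using exact_span_plus[OF exact_span_scale[OF exact_span_differential F.smooth_\<psi>]
        exact_span_scale[OF exact_span_differential smooth_fun_minus[OF F.smooth_y[of i]]]]
      F.smooth_\<psi> F.smooth_y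
    by (simp add: F.frame_def[abs_def])
  show "\<exists>\<phi>. smooth_fun M \<phi> \<and> \<phi> p \<noteq> 0 \<and>
      (\<forall>\<alpha>\<in>one_forms M. (\<lambda>x. \<phi> x *\<^sub>R \<alpha> x) \<in> exact_span M {v. smooth_fun M v})"
  proof (intro exI[of _ "\<lambda>p. F.\<psi> p ^ 3"] conjI ballI smooth_fun_power F.smooth_\<psi>)
    show "F.\<psi> p ^ 3 \<noteq> 0" using ne by (simp add: F.\<psi>_def)
    show "(\<lambda>x. (F.\<psi> x ^ 3) *\<^sub>R \<alpha> x) \<in> exact_span M {v. smooth_fun M v}" if "\<alpha> \<in> one_forms M" for \<alpha>
      unfolding F.frame_expansion by (intro exact_span_sum exact_span_scale fr F.smooth_coef that)
  qed
qed simp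

end

section \<open>The Koszul bracket\<close>

lemma covector_sum:
  fixes \<xi> :: "'e::euclidean_space \<Rightarrow>\<^sub>L real"
  shows "\<xi> = (\<Sum>i\<in>Basis. \<xi> i *\<^sub>R blinfun_inner_left i)"
proof (rule blinfun_eqI)
  fix v
  have "\<xi> v = (\<Sum>i\<in>Basis. (v \<bullet> i) *\<^sub>R \<xi> i)"
    by (rule linear_euclidean_sum[OF bounded_linear.linear[OF blinfun.bounded_linear_right]])
  then show "\<xi> v = (\<Sum>i\<in>Basis. \<xi> i *\<^sub>R blinfun_inner_left i) v"
    by (simp add: blinfun.sum_left blinfun.scaleR_left mult.commute)
qed

lemma linear_covector_sum:
  fixes L :: "('e::euclidean_space \<Rightarrow>\<^sub>L real) \<Rightarrow> 'y::real_vector"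
  assumes "linear L"
  shows "L \<xi> = (\<Sum>i\<in>Basis. \<xi> i *\<^sub>R L (blinfun_inner_left i))"
  by (subst covector_sum) (simp add: linear_sum[OF assms] linear_scale[OF assms])

text \<open>Automatic continuity on the dual: in the expansion over coordinate covectors the
  coefficients are evaluations, which are bounded.\<close>

lemma bounded_linear_covector:
  fixes L :: "('e::euclidean_space \<Rightarrow>\<^sub>L real) \<Rightarrow> 'y::real_normed_vector"
  assumes "linear L" shows "bounded_linear L"
proof -
  have "bounded_linear (\<lambda>\<xi>::'e \<Rightarrow>\<^sub>L real. \<Sum>i\<in>Basis. \<xi> i *\<^sub>R L (blinfun_inner_left i))"
    by (intro bounded_linear_sum bounded_linear_compose[OF bounded_linear_scaleR_left]
        blinfun.bounded_linear_left)
  then show ?thesis using linear_covector_sum[OF assms] by (metis (no_types, lifting) ext)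
qed

lemma bilinear_covector_sum:
  fixes B :: "('e::euclidean_space \<Rightarrow>\<^sub>L real) \<Rightarrow> ('e \<Rightarrow>\<^sub>L real) \<Rightarrow> real"
  assumes "bilinear B"
  shows "B \<xi> \<eta> = (\<Sum>i\<in>Basis. \<Sum>j\<in>Basis. (\<xi> i * \<eta> j) * B (blinfun_inner_left i) (blinfun_inner_left j))"
proof -
  have "B \<xi> \<eta> = (\<Sum>i\<in>Basis. \<xi> i *\<^sub>R B (blinfun_inner_left i) \<eta>)"
    by (rule linear_covector_sum) (use assms in \<open>simp add: bilinear_def\<close>)
  also have "\<dots> = (\<Sum>i\<in>Basis. \<xi> i *\<^sub>R (\<Sum>j\<in>Basis. \<eta> j *\<^sub>R B (blinfun_inner_left i) (blinfun_inner_left j)))"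
    by (intro sum.cong refl arg_cong[where f="\<lambda>z. _ *\<^sub>R z"] linear_covector_sum) (use assms in \<open>simp add: bilinear_def\<close>)
  finally show ?thesis by (simp add: sum_distrib_left mult.assoc)
qed

lemma bilinear_con_tensor_in: "bilinear (B (param c x)) \<Longrightarrow> bilinear (con_tensor_in M c B x)"
  unfolding bilinear_def con_tensor_in_def Let_def linear_iff
  by (auto simp: bounded_bilinear.add_left[OF bounded_bilinear_blinfun_compose]
      bounded_bilinear.scaleR_left[OF bounded_bilinear_blinfun_compose])

lemma covectors_separate:
  fixes v w :: "'e::euclidean_space"
  assumes "\<And>\<xi> :: 'e \<Rightarrow>\<^sub>L real. \<xi> v = \<xi> w" shows "v = w"
proof (rule euclidean_eqI)
  show "v \<bullet> b = w \<bullet> b" for b using assms[of "blinfun_inner_left b"] by simp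
qed

text \<open>The definite description in \<open>sharp\<close> denotes because a functional on the
  dual of a finite-dimensional space is evaluation at a vector, here with coordinates P p (\<alpha>
  p) on the coordinate covectors.\<close>

lemma sharp_apply:
  fixes P :: "('a, 'e::euclidean_space) con_tensor" and \<xi> :: "'e \<Rightarrow>\<^sub>L real"
  assumes "bilinear (P p)" shows "\<xi> (sharp P \<alpha> p) = P p (\<alpha> p) \<xi>"
proof -
  have lin: "linear (P p (\<alpha> p))" using assms by (simp add: bilinear_def)
  have "\<forall>\<beta>. blinfun_apply \<beta> (sharp P \<alpha> p) = P p (\<alpha> p) \<beta>"
    unfolding sharp_def
  proof (rule theI)
    let ?v = "\<Sum>i\<in>Basis. P p (\<alpha> p) (blinfun_inner_left i) *\<^sub>R i"
    show v: "\<forall>\<beta>. blinfun_apply \<beta> ?v = P p (\<alpha> p) \<beta>"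
    proof
      fix \<beta>
      have "P p (\<alpha> p) \<beta> = (\<Sum>i\<in>Basis. \<beta> i *\<^sub>R P p (\<alpha> p) (blinfun_inner_left i))"
        by (rule linear_covector_sum[OF lin])
      then show "\<beta> ?v = P p (\<alpha> p) \<beta>" by (simp add: blinfun.sum_right blinfun.scaleR_right mult.commute)
    qed
    fix v assume "\<forall>\<beta>. blinfun_apply \<beta> v = P p (\<alpha> p) \<beta>"
    show "v = ?v"
    proof (rule covectors_separate)
      fix \<xi> :: "'e \<Rightarrow>\<^sub>L real"
      show "blinfun_apply \<xi> v = blinfun_apply \<xi> ?v"
        using spec[OF \<open>\<forall>\<beta>. blinfun_apply \<beta> v = P p (\<alpha> p) \<beta>\<close>, of \<xi>] spec[OF v, of \<xi>] by (rule trans[OF _ sym])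
    qed
  qed
  then show ?thesis by blast
qed

context smooth_mfd
begin

lemma con_tensor_in_apply:
  assumes "c \<in> atlas M" "x \<in> target c"
  shows "con_tensor_in M c B x (form_in M c \<alpha> x) \<eta> =
    B (param c x) (\<alpha> (param c x)) (\<eta> o\<^sub>L transition_deriv (chart_at M (param c x)) c (param c x))"
proof -
  let ?p = "param c x"
  have "form_in M c \<alpha> x o\<^sub>L transition_deriv (chart_at M ?p) c ?p = \<alpha> ?p"
    using transition_deriv_inverse[OF chart_at(1) assms(1) chart_at(2) chart(5)[OF assms]]
    by (intro blinfun_eqI) (simp add: form_in_def Let_def)
  then show ?thesis by (simp add: con_tensor_in_def Let_def)
qed

lemma con_tensor_in_forms:
  assumes "c \<in> atlas M" "x \<in> target c"
  shows "con_tensor_in M c B x (form_in M c \<alpha> x) (form_in M c \<beta> x) = tensor_apply B \<alpha> \<beta> (param c x)"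
proof -
  let ?p = "param c x"
  have "form_in M c \<beta> x o\<^sub>L transition_deriv (chart_at M ?p) c ?p = \<beta> ?p"
    using transition_deriv_inverse[OF chart_at(1) assms(1) chart_at(2) chart(5)[OF assms]]
    by (intro blinfun_eqI) (simp add: form_in_def Let_def)
  then show ?thesis unfolding con_tensor_in_apply[OF assms] by (simp add: tensor_apply_def)
qed

text \<open>Smoothness of a tensor is stated for constant covectors; expanding both arguments in
  coordinate covectors extends it to varying ones.\<close>

lemma smooth_on_con_tensor_in:
  assumes "\<And>p. bilinear (B p)" and c: "c \<in> atlas M"
    and "\<And>\<xi> \<eta>. smooth_on (target c) (\<lambda>x. con_tensor_in M c B x \<xi> \<eta>)"
    and "smooth_on (target c) a" "smooth_on (target c) b"
  shows "smooth_on (target c) (\<lambda>x. con_tensor_in M c B x (a x) (b x))"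
proof -
  note o = chart(2)[OF c]
  have "smooth_on (target c) (\<lambda>x. \<Sum>i\<in>Basis. \<Sum>j\<in>Basis. (a x i * b x j) *
      con_tensor_in M c B x (blinfun_inner_left i) (blinfun_inner_left j))"
    by (intro smooth_on_sum[OF o] smooth_on_mult[OF o] assms(3)
        smooth_on_blinfun_apply[OF o assms(4) smooth_on_const[OF o]]
        smooth_on_blinfun_apply[OF o assms(5) smooth_on_const[OF o]])
  then show ?thesis
    by (rule smooth_on_cong[OF o, rotated])
      (rule bilinear_covector_sum[OF bilinear_con_tensor_in[OF assms(1)], symmetric])
qed

lemma smooth_tensor_apply:
  assumes "\<And>p. bilinear (B p)"
    and "\<And>c \<xi> \<eta>. c \<in> atlas M \<Longrightarrow> smooth_on (target c) (\<lambda>x. con_tensor_in M c B x \<xi> \<eta>)"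
    and "\<alpha> \<in> one_forms M" "\<beta> \<in> one_forms M"
  shows "smooth_fun M (tensor_apply B \<alpha> \<beta>)"
  unfolding smooth_fun_def o_def
proof
  fix c assume c: "c \<in> atlas M"
  have "smooth_on (target c) (\<lambda>x. con_tensor_in M c B x (form_in M c \<alpha> x) (form_in M c \<beta> x))"
    by (rule smooth_on_con_tensor_in[OF assms(1) c assms(2)[OF c] one_formsD[OF assms(3) c] one_formsD[OF assms(4) c]])
  then show "smooth_on (target c) (\<lambda>x. tensor_apply B \<alpha> \<beta> (param c x))"
    by (rule smooth_on_cong[OF chart(2)[OF c], rotated]) (rule con_tensor_in_forms[OF c])
qed

section \<open>Rules for Lie derivatives\<close>

definition smooth_vfield :: "('a, 'e) vfield \<Rightarrow> bool" where
  "smooth_vfield X \<longleftrightarrow> (\<forall>c\<in>atlas M. smooth_on (target c) (vfield_in M c X))"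

lemma vfield_in_linear:
  "vfield_in M c (\<lambda>p. X p + Y p) x = vfield_in M c X x + vfield_in M c Y x"
  "vfield_in M c (\<lambda>p. \<phi> p *\<^sub>R X p) x = \<phi> (param c x) *\<^sub>R vfield_in M c X x"
  by (simp_all add: vfield_in_def Let_def blinfun.add_right blinfun.scaleR_right)

lemma form_has_derivative:
  assumes "\<beta> \<in> one_forms M"
  shows "(form_in M (chart_at M p) \<beta> has_derivative
    frechet_derivative (form_in M (chart_at M p) \<beta>) (at (coord (chart_at M p) p))) (at (coord (chart_at M p) p))"
  by (rule smooth_on_has_derivative[OF one_formsD[OF assms chart_at(1)] chart_at(3)])

lemma vfield_has_derivative:
  assumes "smooth_vfield X"
  shows "(vfield_in M (chart_at M p) X has_derivative
    frechet_derivative (vfield_in M (chart_at M p) X) (at (coord (chart_at M p) p))) (at (coord (chart_at M p) p))"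
  using assms chart_at smooth_on_has_derivative unfolding smooth_vfield_def by blast

text \<open>Accepts any derivatives of the component functions, which reduces the sum and Leibniz
  rules below to the corresponding rules for \<open>has_derivative\<close>.\<close>

lemma lie_derivative_eq:
  assumes "(form_in M (chart_at M p) \<beta> has_derivative D) (at (coord (chart_at M p) p))"
    and "(vfield_in M (chart_at M p) X has_derivative E) (at (coord (chart_at M p) p))"
  shows "lie_derivative M X \<beta> p v = D (X p) v + \<beta> p (E v)"
  using frechet_derivative_eqI[OF assms(1)] frechet_derivative_eqI[OF assms(2)]
  by (simp add: lie_derivative_def Let_def form_in_chart_at vfield_in_chart_at blinfun.add_left
      bounded_linear_Blinfun_apply[OF has_derivative_bounded_linear[OF assms(2)]])

lemma lie_derivative_add_field:
  assumes "smooth_vfield X" "smooth_vfield Y" "\<beta> \<in> one_forms M"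
  shows "lie_derivative M (\<lambda>q. X q + Y q) \<beta> p = lie_derivative M X \<beta> p + lie_derivative M Y \<beta> p"
proof (rule blinfun_eqI)
  fix v
  note b = form_has_derivative[OF assms(3), of p]
    and x = vfield_has_derivative[OF assms(1), of p] and y = vfield_has_derivative[OF assms(2), of p]
  have xy: "(vfield_in M (chart_at M p) (\<lambda>q. X q + Y q) has_derivative (\<lambda>v.
    frechet_derivative (vfield_in M (chart_at M p) X) (at (coord (chart_at M p) p)) v +
    frechet_derivative (vfield_in M (chart_at M p) Y) (at (coord (chart_at M p) p)) v)) (at (coord (chart_at M p) p))"
    unfolding vfield_in_linear[abs_def] by (rule has_derivative_add[OF x y])
  show "lie_derivative M (\<lambda>q. X q + Y q) \<beta> p v = (lie_derivative M X \<beta> p + lie_derivative M Y \<beta> p) v"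
    unfolding blinfun.add_left lie_derivative_eq[OF b x] lie_derivative_eq[OF b y] lie_derivative_eq[OF b xy]
    by (simp add: linear_add[OF has_derivative_linear[OF b]] blinfun.add_left blinfun.add_right)
qed

lemma lie_derivative_scale_field:
  assumes "smooth_vfield X" "\<beta> \<in> one_forms M" "smooth_fun M \<phi>"
  shows "lie_derivative M (\<lambda>q. \<phi> q *\<^sub>R X q) \<beta> p = \<phi> p *\<^sub>R lie_derivative M X \<beta> p + \<beta> p (X p) *\<^sub>R differential M \<phi> p"
proof (rule blinfun_eqI)
  fix v
  note b = form_has_derivative[OF assms(2), of p] and x = vfield_has_derivative[OF assms(1), of p]
    and f = differential_has_derivative[OF assms(3), of p]
  have fx: "(vfield_in M (chart_at M p) (\<lambda>q. \<phi> q *\<^sub>R X q) has_derivative (\<lambda>v.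
    \<phi> p *\<^sub>R frechet_derivative (vfield_in M (chart_at M p) X) (at (coord (chart_at M p) p)) v +
    differential M \<phi> p v *\<^sub>R X p)) (at (coord (chart_at M p) p))"
    using has_derivative_scaleR[OF f x] unfolding vfield_in_linear[abs_def]
    by (simp add: chart_at vfield_in_chart_at)
  show "lie_derivative M (\<lambda>q. \<phi> q *\<^sub>R X q) \<beta> p v =
      (\<phi> p *\<^sub>R lie_derivative M X \<beta> p + \<beta> p (X p) *\<^sub>R differential M \<phi> p) v"
    unfolding blinfun.add_left blinfun.scaleR_left lie_derivative_eq[OF b x] lie_derivative_eq[OF b fx]
    by (simp add: linear_scale[OF has_derivative_linear[OF b]] blinfun.scaleR_left blinfun.add_right
        blinfun.scaleR_right algebra_simps)
qed

lemma lie_derivative_add_form: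
  assumes "smooth_vfield X" "\<alpha> \<in> one_forms M" "\<beta> \<in> one_forms M"
  shows "lie_derivative M X (\<lambda>q. \<alpha> q + \<beta> q) p = lie_derivative M X \<alpha> p + lie_derivative M X \<beta> p"
proof (rule blinfun_eqI)
  fix v
  note a = form_has_derivative[OF assms(2), of p] and b = form_has_derivative[OF assms(3), of p]
    and x = vfield_has_derivative[OF assms(1), of p]
  have ab: "(form_in M (chart_at M p) (\<lambda>q. \<alpha> q + \<beta> q) has_derivative (\<lambda>v.
    frechet_derivative (form_in M (chart_at M p) \<alpha>) (at (coord (chart_at M p) p)) v +
    frechet_derivative (form_in M (chart_at M p) \<beta>) (at (coord (chart_at M p) p)) v)) (at (coord (chart_at M p) p))"
    unfolding form_in_linear(1)[abs_def] by (rule has_derivative_add[OF a b])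
  show "lie_derivative M X (\<lambda>q. \<alpha> q + \<beta> q) p v = (lie_derivative M X \<alpha> p + lie_derivative M X \<beta> p) v"
    unfolding blinfun.add_left lie_derivative_eq[OF a x] lie_derivative_eq[OF b x] lie_derivative_eq[OF ab x]
    by (simp add: blinfun.add_left)
qed

lemma lie_derivative_scale_form:
  assumes "smooth_vfield X" "\<beta> \<in> one_forms M" "smooth_fun M \<phi>"
  shows "lie_derivative M X (\<lambda>q. \<phi> q *\<^sub>R \<beta> q) p = \<phi> p *\<^sub>R lie_derivative M X \<beta> p + differential M \<phi> p (X p) *\<^sub>R \<beta> p"
proof (rule blinfun_eqI)
  fix v
  note b = form_has_derivative[OF assms(2), of p] and x = vfield_has_derivative[OF assms(1), of p]
    and f = differential_has_derivative[OF assms(3), of p]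
  have fb: "(form_in M (chart_at M p) (\<lambda>q. \<phi> q *\<^sub>R \<beta> q) has_derivative (\<lambda>v.
    \<phi> p *\<^sub>R frechet_derivative (form_in M (chart_at M p) \<beta>) (at (coord (chart_at M p) p)) v +
    differential M \<phi> p v *\<^sub>R \<beta> p)) (at (coord (chart_at M p) p))"
    using has_derivative_scaleR[OF f b] unfolding form_in_linear(2)[abs_def]
    by (simp add: chart_at form_in_chart_at)
  show "lie_derivative M X (\<lambda>q. \<phi> q *\<^sub>R \<beta> q) p v =
      (\<phi> p *\<^sub>R lie_derivative M X \<beta> p + differential M \<phi> p (X p) *\<^sub>R \<beta> p) v"
    unfolding blinfun.add_left blinfun.scaleR_left lie_derivative_eq[OF b x] lie_derivative_eq[OF fb x]
    by (simp add: blinfun.scaleR_left blinfun.add_left algebra_simps)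
qed

text \<open>Both sides share the term containing the derivative of X. The remaining terms are second
  derivatives of \<phi> in the directions X p and v taken in opposite orders.\<close>

lemma lie_derivative_differential:
  assumes X: "smooth_vfield X" and \<phi>: "smooth_fun M \<phi>"
  shows "lie_derivative M X (differential M \<phi>) p = differential M (\<lambda>q. differential M \<phi> q (X q)) p"
proof (rule blinfun_eqI)
  fix v
  let ?c = "chart_at M p" let ?x = "coord ?c p"
  let ?b = "form_in M ?c (differential M \<phi>)" and ?X = "vfield_in M ?c X"
  let ?D = "frechet_derivative ?b (at ?x)" and ?E = "frechet_derivative ?X (at ?x)"
  let ?F = "\<lambda>x. \<phi> (param ?c x)"
  note b = form_has_derivative[OF differential_in_one_forms[OF \<phi>], of p] and x = vfield_has_derivative[OF X, of p]
  have "((\<lambda>y. ?b y (?X y)) has_derivative (\<lambda>v. ?b ?x (?E v) + ?D v (?X ?x))) (at ?x)"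
    by (rule bounded_bilinear.FDERIV[OF bounded_bilinear_blinfun_apply b x])
  then have "((\<lambda>y. differential M \<phi> (param ?c y) (X (param ?c y))) has_derivative
      (\<lambda>v. ?b ?x (?E v) + ?D v (?X ?x))) (at ?x)"
  proof (rule has_derivative_transform_within_open[OF _ chart(2)[OF chart_at(1)] chart_at(3)])
    fix y assume y: "y \<in> target ?c"
    show "?b y (?X y) = differential M \<phi> (param ?c y) (X (param ?c y))"
      using transition_deriv_inverse[OF chart_at(1) chart_at(1) chart_at(2) chart(5)[OF chart_at(1) y]]
      by (simp add: form_in_def vfield_in_def Let_def)
  qed
  then have d: "differential M (\<lambda>q. differential M \<phi> q (X q)) p v = differential M \<phi> p (?E v) + ?D v (X p)"
    by (subst differential_eqI)
      (auto simp: form_in_chart_at vfield_in_chart_at bounded_linear_Blinfun_apply[OF has_derivative_bounded_linear])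
  \<comment> \<open>The derivative of the components of the differential is identified with the
    iterated directional derivative for which symmetry was proved.\<close>
  have Dsym: "?D v w = frechet_derivative (\<lambda>y. frechet_derivative ?F (at y) w) (at ?x) v" for v w
  proof -
    have "((\<lambda>y. ?b y w) has_derivative (\<lambda>v. ?D v w)) (at ?x)"
      by (rule bounded_linear.has_derivative[OF blinfun.bounded_linear_left b])
    then have "((\<lambda>y. frechet_derivative ?F (at y) w) has_derivative (\<lambda>v. ?D v w)) (at ?x)"
      by (rule has_derivative_transform_within_open[OF _ chart(2)[OF chart_at(1)] chart_at(3)])
        (rule form_in_differential_eq[OF \<phi> chart_at(1)])
    then show ?thesis by (metis frechet_derivative_eqI)
  qed
  have "?D (X p) v = ?D v (X p)"
    unfolding Dsym
    by (rule smooth_on_second_derivative_symmetric[OF chart(2)[OF chart_at(1)] smooth_funD[OF \<phi> chart_at(1)] chart_at(3)])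
  then show "lie_derivative M X (differential M \<phi>) p v = differential M (\<lambda>q. differential M \<phi> q (X q)) p v"
    unfolding lie_derivative_eq[OF b x] d by simp
qed

end

section \<open>The anchor action and the bracket of forms\<close>

locale bivector_mfd = smooth_mfd M
  for M :: "('a::{t2_space,second_countable_topology}, 'e::euclidean_space) manifold" +
  fixes P :: "('a, 'e) con_tensor"
  assumes bivector: "bivector_field M P"
begin

text \<open>The derivative of \<phi> along #\<alpha> (see \<open>vfield_apply_sharp\<close>),
  written through P so that bilinearity, antisymmetry and smoothness of P apply directly.\<close>

definition act :: "('a, 'e) form \<Rightarrow> ('a \<Rightarrow> real) \<Rightarrow> 'a \<Rightarrow> real" where
  "act \<alpha> \<phi> = tensor_apply P \<alpha> (differential M \<phi>)"

abbreviation bracket where "bracket \<equiv> koszul_bracket M P"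

lemma bilinear_P: "bilinear (P p)" and antisym_P: "P p \<xi> \<eta> = - P p \<eta> \<xi>"
  using bivector unfolding bivector_field_def by blast+

lemmas P_simps = bilinear_ladd[OF bilinear_P] bilinear_radd[OF bilinear_P]
  bilinear_lmul[OF bilinear_P] bilinear_rmul[OF bilinear_P]
  bilinear_lzero[OF bilinear_P] bilinear_rzero[OF bilinear_P]
  bilinear_lneg[OF bilinear_P] bilinear_rneg[OF bilinear_P]
  bilinear_lsub[OF bilinear_P] bilinear_rsub[OF bilinear_P]

lemma smooth_con_tensor_P: "c \<in> atlas M \<Longrightarrow> smooth_on (target c) (\<lambda>x. con_tensor_in M c P x \<xi> \<eta>)"
  using bivector unfolding bivector_field_def by blast

lemma smooth_P: "\<alpha> \<in> one_forms M \<Longrightarrow> \<beta> \<in> one_forms M \<Longrightarrow> smooth_fun M (tensor_apply P \<alpha> \<beta>)"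
  by (rule smooth_tensor_apply[OF bilinear_P smooth_con_tensor_P])

lemma smooth_act: "\<alpha> \<in> one_forms M \<Longrightarrow> smooth_fun M \<phi> \<Longrightarrow> smooth_fun M (act \<alpha> \<phi>)"
  unfolding act_def by (intro smooth_P differential_in_one_forms)

lemma vfield_apply_sharp: "vfield_apply M (sharp P \<alpha>) \<phi> = act \<alpha> \<phi>"
  by (auto simp: vfield_apply_def act_def tensor_apply_def sharp_apply[OF bilinear_P])

text \<open>The coordinates of #\<alpha> in a chart are the values of P, read in that chart, on
  \<alpha> and the coordinate covectors.\<close>

lemma smooth_sharp: "\<alpha> \<in> one_forms M \<Longrightarrow> smooth_vfield (sharp P \<alpha>)"
  unfolding smooth_vfield_def
proof
  fix c assume \<alpha>: "\<alpha> \<in> one_forms M" and c: "c \<in> atlas M"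
  show "smooth_on (target c) (vfield_in M c (sharp P \<alpha>))"
  proof (rule smooth_on_cong[OF chart(2)[OF c]])
    show "smooth_on (target c) (\<lambda>x. \<Sum>i\<in>Basis. con_tensor_in M c P x (form_in M c \<alpha> x) (blinfun_inner_left i) *\<^sub>R i)"
      by (intro smooth_on_sum[OF chart(2)[OF c]] smooth_on_scaleR[OF chart(2)[OF c] _ smooth_on_const[OF chart(2)[OF c]]]
          smooth_on_con_tensor_in[OF bilinear_P c smooth_con_tensor_P[OF c] one_formsD[OF \<alpha> c] smooth_on_const[OF chart(2)[OF c]]])
    fix x assume x: "x \<in> target c"
    show "(\<Sum>i\<in>Basis. con_tensor_in M c P x (form_in M c \<alpha> x) (blinfun_inner_left i) *\<^sub>R i) = vfield_in M c (sharp P \<alpha>) x"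
    proof (rule euclidean_eqI)
      fix b :: 'e assume "b \<in> Basis"
      then show "(\<Sum>i\<in>Basis. con_tensor_in M c P x (form_in M c \<alpha> x) (blinfun_inner_left i) *\<^sub>R i) \<bullet> b =
          vfield_in M c (sharp P \<alpha>) x \<bullet> b"
        using sharp_apply[OF bilinear_P, of "blinfun_inner_left b o\<^sub>L transition_deriv (chart_at M (param c x)) c (param c x)" _ \<alpha>]
        by (simp add: con_tensor_in_apply[OF c x] vfield_in_def Let_def)
    qed
  qed
qed

lemma sharp_linear:
  "sharp P (\<lambda>q. \<alpha> q + \<beta> q) = (\<lambda>q. sharp P \<alpha> q + sharp P \<beta> q)"
  "sharp P (\<lambda>q. \<phi> q *\<^sub>R \<alpha> q) = (\<lambda>q. \<phi> q *\<^sub>R sharp P \<alpha> q)"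
  by (rule ext, rule covectors_separate, simp add: sharp_apply[OF bilinear_P] P_simps blinfun.add_right blinfun.scaleR_right)+

lemma act_add_form: "act (\<lambda>q. \<alpha> q + \<beta> q) \<phi> p = act \<alpha> \<phi> p + act \<beta> \<phi> p"
  and act_scale_form: "act (\<lambda>q. \<psi> q *\<^sub>R \<alpha> q) \<phi> p = \<psi> p * act \<alpha> \<phi> p"
  and act_diff_form: "act (\<lambda>q. \<alpha> q - \<beta> q) \<phi> p = act \<alpha> \<phi> p - act \<beta> \<phi> p"
  by (simp_all add: act_def tensor_apply_def P_simps)

lemma act_add: "smooth_fun M \<phi> \<Longrightarrow> smooth_fun M \<psi> \<Longrightarrow> act \<alpha> (\<lambda>q. \<phi> q + \<psi> q) p = act \<alpha> \<phi> p + act \<alpha> \<psi> p"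
  and act_mult: "smooth_fun M \<phi> \<Longrightarrow> smooth_fun M \<psi> \<Longrightarrow> act \<alpha> (\<lambda>q. \<phi> q * \<psi> q) p = \<phi> p * act \<alpha> \<psi> p + \<psi> p * act \<alpha> \<phi> p"
  and act_const: "act \<alpha> (\<lambda>q. a) p = 0"
  by (simp_all add: act_def tensor_apply_def differential_add differential_mult differential_const P_simps)

lemma act_scaleR: "smooth_fun M \<phi> \<Longrightarrow> act \<alpha> (\<lambda>q. a * \<phi> q) p = a * act \<alpha> \<phi> p"
  by (simp add: act_mult smooth_fun_const act_const)

lemma bracket_antisym:
  assumes "\<alpha> \<in> one_forms M" "\<beta> \<in> one_forms M" shows "bracket \<beta> \<alpha> p = - bracket \<alpha> \<beta> p"
proof -
  have "tensor_apply P \<beta> \<alpha> = (\<lambda>p. - tensor_apply P \<alpha> \<beta> p)"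
    by (rule ext) (simp add: tensor_apply_def antisym_P[symmetric])
  then show ?thesis
    by (simp add: koszul_bracket_def differential_minus[OF smooth_P[OF assms]])
qed

lemma bracket_add_left:
  assumes "\<alpha> \<in> one_forms M" "\<alpha>' \<in> one_forms M" "\<beta> \<in> one_forms M"
  shows "bracket (\<lambda>q. \<alpha> q + \<alpha>' q) \<beta> p = bracket \<alpha> \<beta> p + bracket \<alpha>' \<beta> p"
proof -
  have "tensor_apply P (\<lambda>q. \<alpha> q + \<alpha>' q) \<beta> = (\<lambda>p. tensor_apply P \<alpha> \<beta> p + tensor_apply P \<alpha>' \<beta> p)"
    by (rule ext) (simp add: tensor_apply_def P_simps)
  then show ?thesis
    using assms
    by (simp add: koszul_bracket_def sharp_linear lie_derivative_add_field lie_derivative_add_form smooth_sharp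
        differential_add smooth_P)
qed

text \<open>The Lie derivative along \<phi> #\<alpha> produces P(\<alpha>, \<beta>) times the
  differential of \<phi>, which cancels against the same term from the differential of \<phi>
  P(\<alpha>, \<beta>). Only the derivative of \<phi> along #\<beta> survives.\<close>

lemma bracket_scale_left:
  assumes "\<alpha> \<in> one_forms M" "\<beta> \<in> one_forms M" "smooth_fun M \<phi>"
  shows "bracket (\<lambda>q. \<phi> q *\<^sub>R \<alpha> q) \<beta> p = \<phi> p *\<^sub>R bracket \<alpha> \<beta> p - act \<beta> \<phi> p *\<^sub>R \<alpha> p"
proof -
  have "tensor_apply P (\<lambda>q. \<phi> q *\<^sub>R \<alpha> q) \<beta> = (\<lambda>p. \<phi> p * tensor_apply P \<alpha> \<beta> p)"
    by (rule ext) (simp add: tensor_apply_def P_simps)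
  then show ?thesis
    using assms
    by (simp add: koszul_bracket_def sharp_linear lie_derivative_scale_field lie_derivative_scale_form smooth_sharp
        differential_mult smooth_P sharp_apply[OF bilinear_P] act_def algebra_simps)
      (simp add: tensor_apply_def)
qed

lemma bracket_add_right:
  assumes "\<alpha> \<in> one_forms M" "\<beta> \<in> one_forms M" "\<beta>' \<in> one_forms M"
  shows "bracket \<alpha> (\<lambda>q. \<beta> q + \<beta>' q) p = bracket \<alpha> \<beta> p + bracket \<alpha> \<beta>' p"
  using assms bracket_antisym[of "\<lambda>q. \<beta> q + \<beta>' q" \<alpha> p] bracket_antisym[of \<beta> \<alpha> p] bracket_antisym[of \<beta>' \<alpha> p]
  by (simp add: bracket_add_left one_forms_add)

lemma bracket_scale_right:
  assumes "\<alpha> \<in> one_forms M" "\<beta> \<in> one_forms M" "smooth_fun M \<phi>"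
  shows "bracket \<alpha> (\<lambda>q. \<phi> q *\<^sub>R \<beta> q) p = \<phi> p *\<^sub>R bracket \<alpha> \<beta> p + act \<alpha> \<phi> p *\<^sub>R \<beta> p"
  using assms bracket_antisym[of "\<lambda>q. \<phi> q *\<^sub>R \<beta> q" \<alpha> p] bracket_antisym[of \<beta> \<alpha> p]
  by (simp add: bracket_scale_left one_forms_scale)

text \<open>With \<open>lie_derivative_differential\<close>, each Lie derivative term of the bracket
  contributes the differential of \<open>act (differential M \<phi>) \<psi>\<close> once, and the
  last term of the bracket removes one of the two copies.\<close>

lemma bracket_differential:
  assumes "smooth_fun M \<phi>" "smooth_fun M \<psi>"
  shows "bracket (differential M \<phi>) (differential M \<psi>) p = differential M (act (differential M \<phi>) \<psi>) p"
proof -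
  have 1: "(\<lambda>q. differential M b q (sharp P (differential M a) q)) = act (differential M a) b" for a b
    by (rule ext) (simp add: sharp_apply[OF bilinear_P] act_def tensor_apply_def)
  have 2: "act (differential M \<psi>) \<phi> = (\<lambda>p. - act (differential M \<phi>) \<psi> p)"
    by (rule ext) (simp add: act_def tensor_apply_def antisym_P[symmetric])
  show ?thesis using assms
    by (simp add: koszul_bracket_def lie_derivative_differential smooth_sharp differential_in_one_forms 1 2
      differential_minus smooth_act) (simp add: act_def)
qed

text \<open>The definition evaluates Lie derivatives in a chart that depends on the point, so
  smoothness is obtained differently: the bracket of exact forms is exact, and the Leibniz rule
  carries smoothness to all forms.\<close>

lemma bracket_in_one_forms:
  assumes "\<alpha> \<in> one_forms M" "\<beta> \<in> one_forms M" shows "bracket \<alpha> \<beta> \<in> one_forms M"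
proof -
  let ?V = "{v. smooth_fun M v}"
  have V: "\<omega> \<in> one_forms M" if "\<omega> \<in> exact_span M ?V" for \<omega> using exact_span_one_forms[OF _ that] by simp
  have gen: "\<exists>\<phi>. smooth_fun M \<phi> \<and> \<phi> p \<noteq> 0 \<and> (\<forall>\<alpha>\<in>one_forms M. (\<lambda>x. \<phi> x *\<^sub>R \<alpha> x) \<in> exact_span M ?V)" for p
    using generates_all unfolding generates_def by blast
  have extend: "bracket \<alpha> \<beta> \<in> one_forms M"
    if \<alpha>: "\<alpha> \<in> one_forms M" and ex: "\<And>v. smooth_fun M v \<Longrightarrow> bracket \<alpha> (differential M v) \<in> one_forms M"
      and \<beta>: "\<beta> \<in> one_forms M" for \<alpha> \<beta>
  proof (rule one_forms_local)
    have sp: "bracket \<alpha> \<omega> \<in> one_forms M" if "\<omega> \<in> exact_span M ?V" for \<omega>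
      using that
    proof induction
      case zero
      have "bracket \<alpha> (\<lambda>p. 0) = (\<lambda>p. 0)"
        using bracket_scale_right[OF \<alpha> one_forms_zero smooth_fun_const[of 0]] by (auto simp: act_const)
      then show ?case by (simp add: one_forms_zero)
    next
      case (add \<omega> u v)
      have v: "smooth_fun M v" "differential M v \<in> one_forms M" using add(3) by (auto intro: differential_in_one_forms)
      have "bracket \<alpha> (\<lambda>p. \<omega> p + u p *\<^sub>R differential M v p) = (\<lambda>p. bracket \<alpha> \<omega> p +
          (u p *\<^sub>R bracket \<alpha> (differential M v) p + act \<alpha> u p *\<^sub>R differential M v p))"
        using bracket_add_right[OF \<alpha> V[OF add(1)] one_forms_scale[OF add(2) v(2)]]
          bracket_scale_right[OF \<alpha> v(2) add(2)] by auto
      then show ?case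
        using v by (auto intro!: one_forms_add one_forms_scale add smooth_act \<alpha> ex)
    qed
    fix p
    obtain \<phi> where \<phi>: "smooth_fun M \<phi>" "\<phi> p \<noteq> 0" "(\<lambda>x. \<phi> x *\<^sub>R \<beta> x) \<in> exact_span M ?V"
      using gen \<beta> by blast
    have "(\<lambda>p. bracket \<alpha> (\<lambda>x. \<phi> x *\<^sub>R \<beta> x) p - act \<alpha> \<phi> p *\<^sub>R \<beta> p) \<in> one_forms M"
      by (intro one_forms_diff one_forms_scale smooth_act sp \<phi> \<alpha> \<beta>)
    then have "(\<lambda>p. \<phi> p *\<^sub>R bracket \<alpha> \<beta> p) \<in> one_forms M"
      by (simp add: bracket_scale_right[OF \<alpha> \<beta> \<phi>(1)])
    with \<phi> show "\<exists>\<phi>. smooth_fun M \<phi> \<and> \<phi> p \<noteq> 0 \<and> (\<lambda>p. \<phi> p *\<^sub>R bracket \<alpha> \<beta> p) \<in> one_forms M" by blast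
  qed
  have neg: "bracket \<beta> \<alpha> \<in> one_forms M" if "bracket \<alpha> \<beta> \<in> one_forms M" "\<alpha> \<in> one_forms M" "\<beta> \<in> one_forms M" for \<alpha> \<beta>
    using one_forms_minus[OF that(1)] by (simp add: bracket_antisym[OF that(2,3), abs_def])
  \<comment> \<open>From exact forms in both slots to an arbitrary second slot, then a swap by
    antisymmetry, then the second slot again.\<close>
  have "bracket (differential M a) (differential M b) \<in> one_forms M" if "smooth_fun M a" "smooth_fun M b" for a b
    using that by (simp add: ext[OF bracket_differential] differential_in_one_forms smooth_act)
  then have "bracket (differential M a) \<beta> \<in> one_forms M" if "smooth_fun M a" "\<beta> \<in> one_forms M" for a \<beta>
    using extend that differential_in_one_forms by blast
  then have "bracket \<beta> (differential M a) \<in> one_forms M" if "smooth_fun M a" "\<beta> \<in> one_forms M" for a \<beta>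
    using neg that differential_in_one_forms by blast
  then show ?thesis using extend assms by blast
qed

end

section \<open>The Levi-Civita contravariant connection\<close>

lemma bilinear_cov_tensor_in: "bilinear (G (param c x)) \<Longrightarrow> bilinear (cov_tensor_in M c G x)"
  unfolding bilinear_def cov_tensor_in_def Let_def linear_iff
  by (auto simp: blinfun.add_right blinfun.scaleR_right)

locale metric_mfd = bivector_mfd M P
  for M :: "('a::{t2_space,second_countable_topology}, 'e::euclidean_space) manifold" and P +
  fixes gt :: "('a, 'e) cov_tensor"
  assumes metric: "pseudo_riemannian_metric M gt"
begin

abbreviation g where "g \<equiv> cometric gt"

lemma bilinear_gt: "bilinear (gt p)" and sym_gt: "gt p v w = gt p w v"
  and nondegenerate_gt: "(\<And>w. gt p v w = 0) \<Longrightarrow> v = 0"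
  and smooth_gt: "c \<in> atlas M \<Longrightarrow> smooth_on (target c) (\<lambda>x. cov_tensor_in M c gt x v w)"
  using metric unfolding pseudo_riemannian_metric_def by blast+

lemma gt_inject: "(\<And>w. gt p v w = gt p v' w) \<Longrightarrow> v = v'"
  using nondegenerate_gt[of p "v - v'"] by (simp add: bilinear_lsub[OF bilinear_gt])

text \<open>L v represents gt p v through the inner product. Nondegeneracy makes this endomorphism
  injective, hence surjective in finite dimension, so the definite description in
  \<open>metric_sharp\<close> denotes.\<close>

lemma gt_metric_sharp:
  fixes \<xi> :: "'e \<Rightarrow>\<^sub>L real"
  shows "gt p (metric_sharp gt p \<xi>) w = \<xi> w"
proof -
  define L where "L v = (\<Sum>i\<in>Basis. gt p v i *\<^sub>R i)" for v
  have L: "L v \<bullet> w = gt p v w" for v w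
  proof -
    have "gt p v w = (\<Sum>i\<in>Basis. (w \<bullet> i) *\<^sub>R gt p v i)"
      by (rule linear_euclidean_sum) (use bilinear_gt in \<open>simp add: bilinear_def\<close>)
    then show ?thesis by (simp add: L_def inner_sum_left inner_commute[of w] mult.commute)
  qed
  have linL: "linear L"
    by (rule linearI) (simp_all add: L_def bilinear_ladd[OF bilinear_gt] bilinear_lmul[OF bilinear_gt]
        scaleR_add_left sum.distrib scaleR_sum_right)
  have "inj L" unfolding linear_injective_0[OF linL] using nondegenerate_gt L by (metis inner_zero_left)
  then have "surj L" using linear_injective_imp_surjective[OF linL] by blast
  then obtain v where v: "L v = (\<Sum>i\<in>Basis. \<xi> i *\<^sub>R i)" by (metis surjD)
  have "gt p v w = \<xi> w" for w
  proof -
    have "\<xi> w = (\<Sum>i\<in>Basis. (w \<bullet> i) *\<^sub>R \<xi> i)"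
      by (rule linear_euclidean_sum[OF bounded_linear.linear[OF blinfun.bounded_linear_right]])
    then show ?thesis by (simp add: L[symmetric] v inner_sum_left inner_commute[of w] mult.commute)
  qed
  then have "\<exists>!v. \<forall>w. gt p v w = \<xi> w" using gt_inject by metis
  from theI'[OF this] show ?thesis unfolding metric_sharp_def by blast
qed

lemma metric_sharp_eqI:
  fixes \<xi> :: "'e \<Rightarrow>\<^sub>L real"
  shows "(\<And>w. gt p v w = \<xi> w) \<Longrightarrow> metric_sharp gt p \<xi> = v"
  by (rule gt_inject[of p]) (simp add: gt_metric_sharp)

lemma g_eq:
  fixes \<xi> \<eta> :: "'e \<Rightarrow>\<^sub>L real"
  shows "g p \<xi> \<eta> = \<eta> (metric_sharp gt p \<xi>)"
  unfolding cometric_def sym_gt[of p "metric_sharp gt p \<xi>"] by (rule gt_metric_sharp)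

lemma g_sym: "g p \<xi> \<eta> = g p \<eta> \<xi>"
  unfolding cometric_def by (rule sym_gt)

lemma bilinear_g: "bilinear (g p)"
  by (rule bilinear_cometric[OF metric])

lemmas g_simps = bilinear_ladd[OF bilinear_g] bilinear_radd[OF bilinear_g]
  bilinear_lmul[OF bilinear_g] bilinear_rmul[OF bilinear_g]
  bilinear_lzero[OF bilinear_g] bilinear_rzero[OF bilinear_g]
  bilinear_lneg[OF bilinear_g] bilinear_rneg[OF bilinear_g]
  bilinear_lsub[OF bilinear_g] bilinear_rsub[OF bilinear_g]

text \<open>Every covector is the value of a form, so the vector dual to \<xi> is killed by all
  covectors and is zero; \<xi> is recovered from that vector through the metric.\<close>

lemma nondegenerate_g:
  assumes "\<And>\<gamma>. \<gamma> \<in> one_forms M \<Longrightarrow> g p \<xi> (\<gamma> p) = 0" shows "\<xi> = 0"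
proof (rule blinfun_eqI)
  fix v
  have z: "\<eta> (metric_sharp gt p \<xi>) = 0" for \<eta> :: "'e \<Rightarrow>\<^sub>L real"
    using assms exists_form[of p \<eta>] by (auto simp: g_eq)
  have "metric_sharp gt p \<xi> = 0" by (rule covectors_separate) (simp add: z)
  then show "\<xi> v = blinfun_apply 0 v"
    using gt_metric_sharp[of p \<xi> v] by (simp add: bilinear_lzero[OF bilinear_gt])
qed

lemma g_inject:
  assumes "\<And>\<gamma>. \<gamma> \<in> one_forms M \<Longrightarrow> g p \<xi> (\<gamma> p) = g p \<eta> (\<gamma> p)" shows "\<xi> = \<eta>"
  using nondegenerate_g[of p "\<xi> - \<eta>"] assms by (simp add: g_simps)

text \<open>The principle behind the identities for the connection, which is accessible only through
  its pairings with other forms.\<close>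

lemma forms_eqI:
  assumes "\<And>p \<gamma>. \<gamma> \<in> one_forms M \<Longrightarrow> g p (\<alpha> p) (\<gamma> p) = g p (\<beta> p) (\<gamma> p)" shows "\<alpha> = \<beta>"
  by (rule ext, rule g_inject, rule assms)

lemma linear_metric_sharp: "linear (metric_sharp gt p)"
  by (rule linearI)
    (auto intro!: metric_sharp_eqI simp: bilinear_ladd[OF bilinear_gt] bilinear_lmul[OF bilinear_gt]
      gt_metric_sharp blinfun.add_left blinfun.scaleR_left)

section \<open>Smoothness of the cometric\<close>

text \<open>In a chart, G is the metric as an operator into the dual space and H its pointwise
  inverse; the cometric is \<xi>, \<eta> -> \<eta>(H \<xi>). Smoothness of H is that of operator
  inversion.\<close>

lemma smooth_con_tensor_g:
  assumes c: "c \<in> atlas M"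
  shows "smooth_on (target c) (\<lambda>x. con_tensor_in M c g x \<xi> \<eta>)"
proof -
  note o = chart(2)[OF c]
  define T where "T p = transition_deriv (chart_at M p) c p" for p
  define T' where "T' p = transition_deriv c (chart_at M p) p" for p
  have TT: "T (param c x) (T' (param c x) v) = v" "T' (param c x) (T (param c x) v) = v" if "x \<in> target c" for x v
    unfolding T_def T'_def
    using transition_deriv_inverse[OF chart_at(1) c chart_at(2) chart(5)[OF c that]]
      transition_deriv_inverse[OF c chart_at(1) chart(5)[OF c that] chart_at(2)] by blast+
  define G where "G x = Blinfun (\<lambda>v. Blinfun (cov_tensor_in M c gt x v))" for x
  define H where "H x = Blinfun (\<lambda>\<xi>. T (param c x) (metric_sharp gt (param c x) (\<xi> o\<^sub>L T (param c x))))" for x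
  have b: "bilinear (cov_tensor_in M c gt x)" for x by (rule bilinear_cov_tensor_in[OF bilinear_gt])
  have bl: "blinfun_apply (Blinfun (cov_tensor_in M c gt x v)) w = cov_tensor_in M c gt x v w" for x v w
    by (subst bounded_linear_Blinfun_apply) (use b[of x] in \<open>auto simp: bilinear_def intro: linear_conv_bounded_linear[THEN iffD1]\<close>)
  have G: "G x v w = cov_tensor_in M c gt x v w" for x v w
  proof -
    have "linear (\<lambda>v. Blinfun (cov_tensor_in M c gt x v))"
      by (rule linearI) (auto intro!: blinfun_eqI simp: bl bilinear_ladd[OF b] bilinear_lmul[OF b]
        blinfun.add_left blinfun.scaleR_left)
    then show ?thesis unfolding G_def
      by (simp add: bounded_linear_Blinfun_apply linear_conv_bounded_linear[THEN iffD1] bl)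
  qed
  have H: "H x \<xi> = T (param c x) (metric_sharp gt (param c x) (\<xi> o\<^sub>L T (param c x)))" for x \<xi>
    unfolding H_def
  proof (subst bounded_linear_Blinfun_apply[OF bounded_linear_covector])
    show "linear (\<lambda>\<xi>. T (param c x) (metric_sharp gt (param c x) (\<xi> o\<^sub>L T (param c x))))"
      by (rule linearI)
        (simp_all add: bounded_bilinear.add_left[OF bounded_bilinear_blinfun_compose]
          bounded_bilinear.scaleR_left[OF bounded_bilinear_blinfun_compose]
          linear_add[OF linear_metric_sharp] linear_scale[OF linear_metric_sharp] blinfun.add_right blinfun.scaleR_right)
  qed simp
  have smG: "smooth_on (target c) G"
    by (rule smooth_on_blinfun[OF o], rule smooth_on_blinfun[OF o]) (simp add: G smooth_gt c)
  have GH: "G x (H x \<xi>) = \<xi>" if x: "x \<in> target c" for x \<xi>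
    by (rule blinfun_eqI)
      (simp add: G H cov_tensor_in_def Let_def T'_def[symmetric] TT[OF x] gt_metric_sharp)
  have HG: "H x (G x v) = v" if x: "x \<in> target c" for x v
  proof -
    have "metric_sharp gt (param c x) (G x v o\<^sub>L T (param c x)) = T' (param c x) v"
      by (rule metric_sharp_eqI) (simp add: G cov_tensor_in_def Let_def T'_def[symmetric] TT[OF x])
    then show ?thesis by (simp add: H TT[OF x])
  qed
  have "smooth_on (target c) H" by (rule smooth_on_blinfun_inverse[OF o smG HG GH])
  then have "smooth_on (target c) (\<lambda>x. \<eta> (H x \<xi>))"
    by (intro smooth_on_bounded_linear[OF o blinfun.bounded_linear_right]
        smooth_on_bounded_linear[OF o blinfun.bounded_linear_left])
  then show ?thesis
    by (simp add: con_tensor_in_def Let_def g_eq H T_def)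
qed

lemma smooth_g: "\<alpha> \<in> one_forms M \<Longrightarrow> \<beta> \<in> one_forms M \<Longrightarrow> smooth_fun M (tensor_apply g \<alpha> \<beta>)"
  by (rule smooth_tensor_apply[OF bilinear_g smooth_con_tensor_g])

lemma tensor_g_simps:
  "tensor_apply g (\<lambda>q. \<alpha> q + \<beta> q) \<gamma> = (\<lambda>p. tensor_apply g \<alpha> \<gamma> p + tensor_apply g \<beta> \<gamma> p)"
  "tensor_apply g \<gamma> (\<lambda>q. \<alpha> q + \<beta> q) = (\<lambda>p. tensor_apply g \<gamma> \<alpha> p + tensor_apply g \<gamma> \<beta> p)"
  "tensor_apply g (\<lambda>q. \<phi> q *\<^sub>R \<alpha> q) \<gamma> = (\<lambda>p. \<phi> p * tensor_apply g \<alpha> \<gamma> p)"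
  "tensor_apply g \<gamma> (\<lambda>q. \<phi> q *\<^sub>R \<alpha> q) = (\<lambda>p. \<phi> p * tensor_apply g \<gamma> \<alpha> p)"
  by (auto simp: tensor_apply_def g_simps)

lemma tensor_g_sym: "tensor_apply g \<alpha> \<beta> = tensor_apply g \<beta> \<alpha>"
  by (auto simp: tensor_apply_def g_sym)

section \<open>Tensorial functionals are represented by smooth forms\<close>

text \<open>Musical isomorphism with bumps: if \<theta> i is metrically dual to the i-th coordinate
  vector, the form representing L is the sum of L(dx_i) \<theta> i. Using the globally defined frame
  instead of dx_i costs powers of \<psi>.\<close>

lemma represent_near:
  fixes L :: "('a, 'e) form \<Rightarrow> 'a \<Rightarrow> real"
  assumes smooth_L: "\<And>\<gamma>. \<gamma> \<in> one_forms M \<Longrightarrow> smooth_fun M (L \<gamma>)"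
    and add: "\<And>\<gamma> \<delta> p. \<gamma> \<in> one_forms M \<Longrightarrow> \<delta> \<in> one_forms M \<Longrightarrow> L (\<lambda>q. \<gamma> q + \<delta> q) p = L \<gamma> p + L \<delta> p"
    and scale: "\<And>\<phi> \<gamma> p. smooth_fun M \<phi> \<Longrightarrow> \<gamma> \<in> one_forms M \<Longrightarrow> L (\<lambda>q. \<phi> q *\<^sub>R \<gamma> q) p = \<phi> p * L \<gamma> p"
  shows "\<exists>\<phi> \<Theta>. smooth_fun M \<phi> \<and> \<phi> p \<noteq> 0 \<and> \<Theta> \<in> one_forms M \<and>
    (\<forall>\<gamma>\<in>one_forms M. \<forall>q. tensor_apply g \<Theta> \<gamma> q = \<phi> q * L \<gamma> q)"
proof -
  define c where "c = chart_at M p"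
  have c: "c \<in> atlas M" by (simp add: c_def chart_at)
  obtain B K where F: "chart_frame M c B K" and ne: "chart_ext c B p \<noteq> 0"
    using exists_chart_frame[OF chart_at(1,2)] unfolding c_def by blast
  then interpret F: chart_frame M c B K by simp
  define G where "G i j = chart_ext c (\<lambda>x. B x * cov_tensor_in M c gt x i j)" for i j
  \<comment> \<open>\<theta> i is \<psi>^3 times the covector metrically dual to the i-th coordinate
    vector: one \<psi> from G, two from the frame.\<close>
  define \<theta> where "\<theta> i = (\<lambda>q. \<Sum>j\<in>Basis. G i j q *\<^sub>R F.frame j q)" for i
  have \<theta>: "\<theta> i \<in> one_forms M" for i
    unfolding \<theta>_def G_def
    by (intro one_forms_sum one_forms_scale F.frame_in_one_forms F.smooth_ext smooth_gt c)
  have L_sum: "L (\<lambda>q. \<Sum>i\<in>I. a i q *\<^sub>R \<omega> i q) q = (\<Sum>i\<in>I. a i q * L (\<omega> i) q)"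
    if "finite I" "\<And>i. smooth_fun M (a i)" "\<And>i. \<omega> i \<in> one_forms M" for I :: "'e set" and a \<omega> q
    using that(1)
  proof induction
    case empty
    then show ?case using scale[OF smooth_fun_const[of 0] one_forms_zero] by simp
  next
    case (insert i I)
    then show ?case
      using add[OF one_forms_scale[OF that(2)[of i] that(3)[of i]] one_forms_sum[where I=I and \<alpha>="\<lambda>i q. a i q *\<^sub>R \<omega> i q", OF one_forms_scale[OF that(2) that(3)]]]
        scale[OF that(2)[of i] that(3)[of i]] by simp
  qed
  have g\<theta>: "g q (\<theta> i q) (\<gamma> q) = (F.\<psi> q)\<^sup>2 * F.coef \<gamma> i q" for i q \<gamma>
  proof (cases "q \<in> source c")
    case False
    then show ?thesis by (simp add: \<theta>_def G_def F.\<psi>_def chart_ext_def g_simps)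
  next
    case True
    define T where "T = transition_deriv (chart_at M q) c q"
    define T' where "T' = transition_deriv c (chart_at M q) q"
    have "\<theta> i q w = F.\<psi> q ^ 3 * gt q (T' i) w" for w
    proof -
      have q: "param c (coord c q) = q" using chart(3)[OF c True] .
      have lin: "linear (\<lambda>v. gt q (T' i) (T' v))"
        by (rule linearI) (simp_all add: blinfun.add_right blinfun.scaleR_right bilinear_radd[OF bilinear_gt] bilinear_rmul[OF bilinear_gt])
      have "gt q (T' i) w = gt q (T' i) (T' (T w))"
        using transition_deriv_inverse[OF chart_at(1) c chart_at(2) True] by (simp add: T_def T'_def)
      also have "\<dots> = (\<Sum>j\<in>Basis. (T w \<bullet> j) *\<^sub>R gt q (T' i) (T' j))"
        by (rule linear_euclidean_sum[OF lin])
      finally show ?thesis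
        using True q
        by (simp add: \<theta>_def blinfun.sum_left blinfun.scaleR_left F.frame_eq[OF True] G_def chart_ext_def
            cov_tensor_in_def Let_def T_def T'_def F.\<psi>_def sum_distrib_left power2_eq_square power3_eq_cube mult_ac)
    qed
    then have "metric_sharp gt q (\<theta> i q) = F.\<psi> q ^ 3 *\<^sub>R T' i"
      by (intro metric_sharp_eqI) (simp add: bilinear_lmul[OF bilinear_gt])
    then show ?thesis
      using True chart(3)[OF c True]
      by (simp add: g_eq blinfun.scaleR_right F.coef_def chart_ext_def form_in_def Let_def T'_def F.\<psi>_def
          power2_eq_square power3_eq_cube)
  qed
  define \<Theta> where "\<Theta> = (\<lambda>q. \<Sum>i\<in>Basis. L (F.frame i) q *\<^sub>R \<theta> i q)"
  show ?thesis
  \<comment> \<open>The exponent 5 is 2 + 3: two factors from pairing with \<theta> i, three from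
    the frame expansion of \<gamma>.\<close>
  proof (intro exI[of _ "\<lambda>q. F.\<psi> q ^ 5"] exI[of _ \<Theta>] conjI ballI allI smooth_fun_power F.smooth_\<psi>)
    show "F.\<psi> p ^ 5 \<noteq> 0" using ne by (simp add: F.\<psi>_def)
    show "\<Theta> \<in> one_forms M"
      unfolding \<Theta>_def by (intro one_forms_sum one_forms_scale \<theta> smooth_L F.frame_in_one_forms)
    fix \<gamma> q assume \<gamma>: "\<gamma> \<in> one_forms M"
    have "tensor_apply g \<Theta> \<gamma> q = (\<Sum>i\<in>Basis. L (F.frame i) q * g q (\<theta> i q) (\<gamma> q))"
      unfolding tensor_apply_def \<Theta>_def
      by (simp add: linear_sum[of "\<lambda>\<xi>. g q \<xi> (\<gamma> q)"] bilinear_g[unfolded bilinear_def] g_simps)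
    also have "\<dots> = (F.\<psi> q)\<^sup>2 * (\<Sum>i\<in>Basis. F.coef \<gamma> i q * L (F.frame i) q)"
      by (simp add: g\<theta> sum_distrib_left mult_ac)
    also have "(\<Sum>i\<in>Basis. F.coef \<gamma> i q * L (F.frame i) q) = L (\<lambda>q. F.\<psi> q ^ 3 *\<^sub>R \<gamma> q) q"
      unfolding F.frame_expansion
      by (rule L_sum[symmetric]) (auto intro: F.smooth_coef \<gamma> F.frame_in_one_forms)
    also have "\<dots> = F.\<psi> q ^ 3 * L \<gamma> q" by (rule scale[OF smooth_fun_power[OF F.smooth_\<psi>] \<gamma>])
    finally show "tensor_apply g \<Theta> \<gamma> q = F.\<psi> q ^ 5 * L \<gamma> q"
      by (simp add: power_add[symmetric] mult.assoc[symmetric])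
  qed
qed

text \<open>Dividing by \<phi> gives a representing covector at each point. Nondegeneracy forces
  \<phi> \<omega> = \<Theta> everywhere for the local representatives \<Theta>, so
  \<open>one_forms_local\<close> gives smoothness.\<close>

lemma represent:
  fixes L :: "('a, 'e) form \<Rightarrow> 'a \<Rightarrow> real"
  assumes smooth_L: "\<And>\<gamma>. \<gamma> \<in> one_forms M \<Longrightarrow> smooth_fun M (L \<gamma>)"
    and add: "\<And>\<gamma> \<delta> p. \<gamma> \<in> one_forms M \<Longrightarrow> \<delta> \<in> one_forms M \<Longrightarrow> L (\<lambda>q. \<gamma> q + \<delta> q) p = L \<gamma> p + L \<delta> p"
    and scale: "\<And>\<phi> \<gamma> p. smooth_fun M \<phi> \<Longrightarrow> \<gamma> \<in> one_forms M \<Longrightarrow> L (\<lambda>q. \<phi> q *\<^sub>R \<gamma> q) p = \<phi> p * L \<gamma> p"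
  shows "\<exists>\<omega>\<in>one_forms M. \<forall>\<gamma>\<in>one_forms M. \<forall>p. g p (\<omega> p) (\<gamma> p) = L \<gamma> p"
proof -
  have ex: "\<exists>\<phi> \<Theta>. smooth_fun M \<phi> \<and> \<phi> p \<noteq> 0 \<and> \<Theta> \<in> one_forms M \<and>
    (\<forall>\<gamma>\<in>one_forms M. \<forall>q. tensor_apply g \<Theta> \<gamma> q = \<phi> q * L \<gamma> q)" for p
    by (rule represent_near[where L=L, OF assms])
  have "\<exists>\<xi>. \<forall>\<gamma>\<in>one_forms M. g p \<xi> (\<gamma> p) = L \<gamma> p" for p
  proof -
    obtain \<phi> \<Theta> where "\<phi> p \<noteq> 0" "\<forall>\<gamma>\<in>one_forms M. \<forall>q. tensor_apply g \<Theta> \<gamma> q = \<phi> q * L \<gamma> q"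
      using ex[of p] by blast
    then show ?thesis
      by (intro exI[of _ "inverse (\<phi> p) *\<^sub>R \<Theta> p"]) (simp add: g_simps tensor_apply_def)
  qed
  then obtain \<omega> where \<omega>: "\<And>p \<gamma>. \<gamma> \<in> one_forms M \<Longrightarrow> g p (\<omega> p) (\<gamma> p) = L \<gamma> p" by metis
  have "\<omega> \<in> one_forms M"
  proof (rule one_forms_local)
    fix p
    obtain \<phi> \<Theta> where \<phi>: "smooth_fun M \<phi>" "\<phi> p \<noteq> 0" "\<Theta> \<in> one_forms M"
      "\<And>\<gamma> q. \<gamma> \<in> one_forms M \<Longrightarrow> tensor_apply g \<Theta> \<gamma> q = \<phi> q * L \<gamma> q"
      using ex[of p] by blast
    have "\<phi> q *\<^sub>R \<omega> q = \<Theta> q" for q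
      by (rule g_inject[of q]) (use \<phi>(4)[of _ q] in \<open>simp add: g_simps \<omega> tensor_apply_def\<close>)
    then show "\<exists>\<phi>. smooth_fun M \<phi> \<and> \<phi> p \<noteq> 0 \<and> (\<lambda>x. \<phi> x *\<^sub>R \<omega> x) \<in> one_forms M"
      using \<phi> by auto
  qed
  with \<omega> show ?thesis by blast
qed

section \<open>The Koszul formula, existence and uniqueness of the connection\<close>

text \<open>The Koszul formula for g(D \<alpha> \<beta>, \<gamma>), with derivatives along the
  anchor in place of derivatives along vector fields.\<close>

definition koszul :: "('a, 'e) form \<Rightarrow> ('a, 'e) form \<Rightarrow> ('a, 'e) form \<Rightarrow> 'a \<Rightarrow> real" where
  "koszul \<alpha> \<beta> \<gamma> p = (act \<alpha> (tensor_apply g \<beta> \<gamma>) p + act \<beta> (tensor_apply g \<alpha> \<gamma>) p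
     - act \<gamma> (tensor_apply g \<alpha> \<beta>) p + g p (bracket \<alpha> \<beta> p) (\<gamma> p)
     + g p (bracket \<gamma> \<alpha> p) (\<beta> p) + g p (bracket \<gamma> \<beta> p) (\<alpha> p)) / 2"

lemma smooth_koszul:
  assumes "\<alpha> \<in> one_forms M" "\<beta> \<in> one_forms M" "\<gamma> \<in> one_forms M"
  shows "smooth_fun M (koszul \<alpha> \<beta> \<gamma>)"
  unfolding koszul_def[abs_def] divide_inverse tensor_apply_def[of g, symmetric]
  by (intro smooth_fun_mult smooth_fun_add smooth_fun_diff smooth_fun_const smooth_act smooth_g
      bracket_in_one_forms assms)

lemmas koszul_simps = tensor_g_simps act_add act_mult act_add_form act_scale_form smooth_g
  bracket_add_left bracket_add_right bracket_scale_left bracket_scale_right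

lemma koszul_add:
  assumes "\<alpha> \<in> one_forms M" "\<beta> \<in> one_forms M" "\<gamma> \<in> one_forms M" "\<delta> \<in> one_forms M"
  shows "koszul (\<lambda>q. \<alpha> q + \<delta> q) \<beta> \<gamma> p = koszul \<alpha> \<beta> \<gamma> p + koszul \<delta> \<beta> \<gamma> p"
    "koszul \<alpha> (\<lambda>q. \<beta> q + \<delta> q) \<gamma> p = koszul \<alpha> \<beta> \<gamma> p + koszul \<alpha> \<delta> \<gamma> p"
    "koszul \<alpha> \<beta> (\<lambda>q. \<gamma> q + \<delta> q) p = koszul \<alpha> \<beta> \<gamma> p + koszul \<alpha> \<beta> \<delta> p"
  unfolding koszul_def using assms
  by (simp_all add: koszul_simps g_simps field_simps)

text \<open>In the first and third slots all derivatives of \<phi> cancel. In the second, those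
  along #\<gamma> cancel, while those along #\<alpha> come once from the metric and once from the
  bracket, which the factor 1/2 turns into one Leibniz term.\<close>

lemma koszul_scale:
  assumes "\<alpha> \<in> one_forms M" "\<beta> \<in> one_forms M" "\<gamma> \<in> one_forms M" "smooth_fun M \<phi>"
  shows "koszul (\<lambda>q. \<phi> q *\<^sub>R \<alpha> q) \<beta> \<gamma> p = \<phi> p * koszul \<alpha> \<beta> \<gamma> p"
    "koszul \<alpha> (\<lambda>q. \<phi> q *\<^sub>R \<beta> q) \<gamma> p = \<phi> p * koszul \<alpha> \<beta> \<gamma> p + act \<alpha> \<phi> p * g p (\<beta> p) (\<gamma> p)"
    "koszul \<alpha> \<beta> (\<lambda>q. \<phi> q *\<^sub>R \<gamma> q) p = \<phi> p * koszul \<alpha> \<beta> \<gamma> p"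
  unfolding koszul_def using assms
  by (simp_all add: koszul_simps g_simps field_simps g_sym[of p "\<gamma> p"] g_sym[of p "\<beta> p" "\<alpha> p"])
    (simp_all add: tensor_apply_def g_sym[of p "\<gamma> p"] g_sym[of p "\<beta> p" "\<alpha> p"] algebra_simps)

text \<open>All terms except the derivative along #\<alpha> change sign when \<beta> and \<gamma>
  are exchanged.\<close>

lemma koszul_metric:
  assumes "\<alpha> \<in> one_forms M" "\<beta> \<in> one_forms M" "\<gamma> \<in> one_forms M"
  shows "koszul \<alpha> \<beta> \<gamma> p + koszul \<alpha> \<gamma> \<beta> p = act \<alpha> (tensor_apply g \<beta> \<gamma>) p"
  unfolding koszul_def tensor_g_sym[of \<gamma> \<beta>] tensor_g_sym[of \<gamma> \<alpha>] tensor_g_sym[of \<beta> \<alpha>]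
  using bracket_antisym[OF assms(1,2)] bracket_antisym[OF assms(1,3)] bracket_antisym[OF assms(2,3)]
  by (simp add: g_simps field_simps)

text \<open>All terms except the pairing of the bracket of \<alpha>, \<beta> with \<gamma> are
  unchanged when \<alpha> and \<beta> are exchanged.\<close>

lemma koszul_torsion:
  assumes "\<alpha> \<in> one_forms M" "\<beta> \<in> one_forms M" "\<gamma> \<in> one_forms M"
  shows "koszul \<alpha> \<beta> \<gamma> p - koszul \<beta> \<alpha> \<gamma> p = g p (bracket \<alpha> \<beta> p) (\<gamma> p)"
  unfolding koszul_def tensor_g_sym[of \<beta> \<alpha>]
  using bracket_antisym[OF assms(1,2)]
  by (simp add: g_simps field_simps)

text \<open>Uniqueness: after metric compatibility and vanishing torsion are substituted into the
  formula, two copies of g(D \<alpha> \<beta>, \<gamma>) remain.\<close>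

lemma levi_civita_koszul:
  assumes D: "is_levi_civita M g P D" and f: "\<alpha> \<in> one_forms M" "\<beta> \<in> one_forms M" "\<gamma> \<in> one_forms M"
  shows "g p (D \<alpha> \<beta> p) (\<gamma> p) = koszul \<alpha> \<beta> \<gamma> p"
proof -
  have m: "act \<alpha> (tensor_apply g \<beta> \<gamma>) p = g p (D \<alpha> \<beta> p) (\<gamma> p) + g p (\<beta> p) (D \<alpha> \<gamma> p)"
    if "\<alpha> \<in> one_forms M" "\<beta> \<in> one_forms M" "\<gamma> \<in> one_forms M" for \<alpha> \<beta> \<gamma>
    using D[unfolded is_levi_civita_def vfield_apply_sharp, THEN conjunct2, THEN conjunct1, rule_format, OF that]
    by (simp add: tensor_apply_def)
  have t: "bracket \<alpha> \<beta> p = D \<alpha> \<beta> p - D \<beta> \<alpha> p"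
    if "\<alpha> \<in> one_forms M" "\<beta> \<in> one_forms M" for \<alpha> \<beta>
    using D[unfolded is_levi_civita_def, THEN conjunct2, THEN conjunct2, rule_format, OF that] by (simp add: fun_eq_iff)
  show ?thesis
    unfolding koszul_def m[OF f] m[OF f(2,1,3)] m[OF f(3,1,2)] tensor_apply_def
      t[OF f(1,2)] t[OF f(3,1)] t[OF f(3,2)] g_simps
    by (simp add: g_sym[of p "\<alpha> p"] g_sym[of p "\<beta> p"])
qed

text \<open>Secures that the \<open>SOME\<close> in \<open>levi_civita\<close> picks an actual
  connection; the Koszul expression is tensorial and smooth in \<gamma>, so \<open>represent\<close>
  supplies D \<alpha> \<beta>.\<close>

lemma exists_levi_civita: "\<exists>D. is_levi_civita M g P D"
proof -
  have "\<exists>\<omega>\<in>one_forms M. \<forall>\<gamma>\<in>one_forms M. \<forall>p. g p (\<omega> p) (\<gamma> p) = koszul \<alpha> \<beta> \<gamma> p"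
    if "\<alpha> \<in> one_forms M" "\<beta> \<in> one_forms M" for \<alpha> \<beta>
    by (rule represent) (use that in \<open>auto intro: smooth_koszul koszul_add koszul_scale\<close>)
  then obtain D where D: "\<And>\<alpha> \<beta>. \<alpha> \<in> one_forms M \<Longrightarrow> \<beta> \<in> one_forms M \<Longrightarrow> D \<alpha> \<beta> \<in> one_forms M"
    "\<And>\<alpha> \<beta> \<gamma> p. \<alpha> \<in> one_forms M \<Longrightarrow> \<beta> \<in> one_forms M \<Longrightarrow> \<gamma> \<in> one_forms M \<Longrightarrow>
      g p (D \<alpha> \<beta> p) (\<gamma> p) = koszul \<alpha> \<beta> \<gamma> p" by metis
  note closed = one_forms_add one_forms_scale one_forms_scaleR
  have "contravariant_connection M P D"
    unfolding contravariant_connection_def vfield_apply_sharp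
  proof (intro conjI ballI allI impI)
    fix \<alpha> \<alpha>' \<beta> and a b :: real assume f: "\<alpha> \<in> one_forms M" "\<alpha>' \<in> one_forms M" "\<beta> \<in> one_forms M"
    show "D (\<lambda>p. a *\<^sub>R \<alpha> p + b *\<^sub>R \<alpha>' p) \<beta> = (\<lambda>p. a *\<^sub>R D \<alpha> \<beta> p + b *\<^sub>R D \<alpha>' \<beta> p)"
      by (rule forms_eqI)
        (simp add: f D closed g_simps koszul_add koszul_scale(1)[OF _ _ _ smooth_fun_const])
    show "D \<beta> (\<lambda>p. a *\<^sub>R \<alpha> p + b *\<^sub>R \<alpha>' p) = (\<lambda>p. a *\<^sub>R D \<beta> \<alpha> p + b *\<^sub>R D \<beta> \<alpha>' p)"
      by (rule forms_eqI)
        (simp add: f D closed g_simps koszul_add koszul_scale(2)[OF _ _ _ smooth_fun_const] act_const)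
  next
    fix \<phi> \<alpha> \<beta> assume f: "smooth_fun M \<phi>" "\<alpha> \<in> one_forms M" "\<beta> \<in> one_forms M"
    show "D (\<lambda>p. \<phi> p *\<^sub>R \<alpha> p) \<beta> = (\<lambda>p. \<phi> p *\<^sub>R D \<alpha> \<beta> p)"
      by (rule forms_eqI) (simp add: f D closed g_simps koszul_scale)
    show "D \<alpha> (\<lambda>p. \<phi> p *\<^sub>R \<beta> p) = (\<lambda>p. \<phi> p *\<^sub>R D \<alpha> \<beta> p + act \<alpha> \<phi> p *\<^sub>R \<beta> p)"
      by (rule forms_eqI) (simp add: f D closed g_simps koszul_scale)
  qed (rule D)
  moreover have "act \<alpha> (tensor_apply g \<beta> \<gamma>) p = tensor_apply g (D \<alpha> \<beta>) \<gamma> p + tensor_apply g \<beta> (D \<alpha> \<gamma>) p"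
    if "\<alpha> \<in> one_forms M" "\<beta> \<in> one_forms M" "\<gamma> \<in> one_forms M" for \<alpha> \<beta> \<gamma> p
    using koszul_metric[OF that] by (simp add: tensor_apply_def that D g_sym[of p "\<beta> p"])
  moreover have "(\<lambda>p. D \<alpha> \<beta> p - D \<beta> \<alpha> p) = bracket \<alpha> \<beta>"
    if "\<alpha> \<in> one_forms M" "\<beta> \<in> one_forms M" for \<alpha> \<beta>
    by (rule forms_eqI) (simp add: that D g_simps koszul_torsion)
  ultimately have "is_levi_civita M g P D" unfolding is_levi_civita_def vfield_apply_sharp by blast
  then show ?thesis by blast
qed

abbreviation D where "D \<equiv> levi_civita M g P"

lemma levi_civita: "is_levi_civita M g P D"
  unfolding levi_civita_def using exists_levi_civita by (rule someI_ex)

lemma D_in_one_forms: "\<alpha> \<in> one_forms M \<Longrightarrow> \<beta> \<in> one_forms M \<Longrightarrow> D \<alpha> \<beta> \<in> one_forms M"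
  by (rule levi_civita[unfolded is_levi_civita_def contravariant_connection_def, THEN conjunct1, THEN conjunct1, rule_format])

lemma D_koszul:
  "\<alpha> \<in> one_forms M \<Longrightarrow> \<beta> \<in> one_forms M \<Longrightarrow> \<gamma> \<in> one_forms M \<Longrightarrow> g p (D \<alpha> \<beta> p) (\<gamma> p) = koszul \<alpha> \<beta> \<gamma> p"
  by (rule levi_civita_koszul[OF levi_civita])

lemma D_add_left:
  assumes "\<alpha> \<in> one_forms M" "\<alpha>' \<in> one_forms M" "\<beta> \<in> one_forms M"
  shows "D (\<lambda>p. \<alpha> p + \<alpha>' p) \<beta> = (\<lambda>p. D \<alpha> \<beta> p + D \<alpha>' \<beta> p)"
  by (rule forms_eqI) (simp add: assms D_koszul one_forms_add g_simps koszul_add)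

lemma D_add_right:
  assumes "\<alpha> \<in> one_forms M" "\<beta>' \<in> one_forms M" "\<beta> \<in> one_forms M"
  shows "D \<alpha> (\<lambda>p. \<beta> p + \<beta>' p) = (\<lambda>p. D \<alpha> \<beta> p + D \<alpha> \<beta>' p)"
  by (rule forms_eqI) (simp add: assms D_koszul one_forms_add g_simps koszul_add)

lemma D_scale_left:
  assumes "smooth_fun M \<phi>" "\<alpha> \<in> one_forms M" "\<beta> \<in> one_forms M"
  shows "D (\<lambda>p. \<phi> p *\<^sub>R \<alpha> p) \<beta> = (\<lambda>p. \<phi> p *\<^sub>R D \<alpha> \<beta> p)"
  by (rule forms_eqI) (simp add: assms D_koszul one_forms_scale g_simps koszul_scale)

lemma D_scale_right:
  assumes "smooth_fun M \<phi>" "\<alpha> \<in> one_forms M" "\<beta> \<in> one_forms M"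
  shows "D \<alpha> (\<lambda>p. \<phi> p *\<^sub>R \<beta> p) = (\<lambda>p. \<phi> p *\<^sub>R D \<alpha> \<beta> p + act \<alpha> \<phi> p *\<^sub>R \<beta> p)"
  by (rule forms_eqI) (simp add: assms D_koszul one_forms_scale g_simps koszul_scale)

lemma D_torsion:
  assumes "\<alpha> \<in> one_forms M" "\<beta> \<in> one_forms M" shows "bracket \<alpha> \<beta> = (\<lambda>p. D \<alpha> \<beta> p - D \<beta> \<alpha> p)"
  by (rule forms_eqI) (simp add: assms D_koszul g_simps koszul_torsion[symmetric])

end

section \<open>Products\<close>

lemma has_derivative_map_prod:
  assumes "(F has_derivative F') (at (fst z))" "(G has_derivative G') (at (snd z))"
  shows "((\<lambda>z. (F (fst z), G (snd z))) has_derivative (\<lambda>v. (F' (fst v), G' (snd v)))) (at z)"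
proof -
  have "((\<lambda>z. F (fst z)) has_derivative (\<lambda>v. F' (fst v))) (at z)"
    using diff_chain_at[OF bounded_linear_imp_has_derivative[OF bounded_linear_fst] assms(1)] by (simp add: o_def)
  moreover have "((\<lambda>z. G (snd z)) has_derivative (\<lambda>v. G' (snd v))) (at z)"
    using diff_chain_at[OF bounded_linear_imp_has_derivative[OF bounded_linear_snd] assms(2)] by (simp add: o_def)
  ultimately show ?thesis by (rule has_derivative_Pair)
qed

lemma product_chart_sel [simp]:
  "source (product_chart c d) = source c \<times> source d"
  "coord (product_chart c d) = map_prod (coord c) (coord d)"
  "param (product_chart c d) = map_prod (param c) (param d)"
  by (simp_all add: product_chart_def)

lemma target_product_chart: "target (product_chart c d) = target c \<times> target d"
  by (simp add: map_prod_surj_on)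

lemma atlas_product: "atlas (product_manifold M N) = {product_chart c d |c d. c \<in> atlas M \<and> d \<in> atlas N}"
  by (auto simp: product_manifold_def)

lemma chart_at_product: "chart_at (product_manifold M N) x = product_chart (chart_at M (fst x)) (chart_at N (snd x))"
  by (simp add: product_manifold_def split: prod.split)

lemma warped_bivector_eq:
  "warped_bivector \<mu> P1 P2 x \<xi> \<eta> = P1 (fst x) (\<xi> o\<^sub>L inl_blinfun) (\<eta> o\<^sub>L inl_blinfun) +
     \<mu> (fst x) * P2 (snd x) (\<xi> o\<^sub>L inr_blinfun) (\<eta> o\<^sub>L inr_blinfun)"
  and warped_cometric_eq:
  "warped_cometric f g1 g2 x \<xi> \<eta> = g1 (fst x) (\<xi> o\<^sub>L inl_blinfun) (\<eta> o\<^sub>L inl_blinfun) +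
     f (fst x) * g2 (snd x) (\<xi> o\<^sub>L inr_blinfun) (\<eta> o\<^sub>L inr_blinfun)"
  by (cases x; simp add: warped_bivector_def warped_cometric_def)+

locale mfd_pair = M1: smooth_mfd M1 + M2: smooth_mfd M2
  for M1 :: "('a::{t2_space,second_countable_topology}, 'e::euclidean_space) manifold"
    and M2 :: "('b::{t2_space,second_countable_topology}, 'd::euclidean_space) manifold"
begin

abbreviation "M \<equiv> product_manifold M1 M2"
abbreviation "hl \<equiv> hlift M1 M2"
abbreviation "vl \<equiv> vlift M1 M2"

lemma smooth_product: "smooth_manifold M"
  unfolding smooth_manifold_def
proof (intro conjI ballI allI)
  fix C assume "C \<in> atlas M"
  then obtain c d where C: "C = product_chart c d" and c: "c \<in> atlas M1" and d: "d \<in> atlas M2"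
    by (auto simp: atlas_product)
  show "open (source C)" using M1.chart(1)[OF c] M2.chart(1)[OF d] by (simp add: C open_Times)
  show "open (target C)" unfolding C target_product_chart by (rule open_Times[OF M1.chart(2)[OF c] M2.chart(2)[OF d]])
  have "continuous_on (source c \<times> source d) (map_prod (coord c) (coord d))"
    "continuous_on (target c \<times> target d) (map_prod (param c) (param d))"
    unfolding map_prod_def split_beta
    by (intro continuous_on_Pair continuous_on_compose2[OF M1.chart(7)[OF c]] continuous_on_compose2[OF M2.chart(7)[OF d]]
        continuous_on_compose2[OF M1.chart(8)[OF c]] continuous_on_compose2[OF M2.chart(8)[OF d]]
        continuous_on_fst continuous_on_snd continuous_on_id; force)+
  then show "homeomorphism (source C) (target C) (coord C) (param C)"
    using M1.chart(3,4,5,6)[OF c] M2.chart(3,4,5,6)[OF d]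
    unfolding C target_product_chart unfolding product_chart_sel homeomorphism_def
    by (auto simp: map_prod_def image_iff)
  fix C' assume "C' \<in> atlas M"
  then obtain c' d' where C': "C' = product_chart c' d'" and c': "c' \<in> atlas M1" and d': "d' \<in> atlas M2"
    by (auto simp: atlas_product)
  have S: "coord C ` (source C \<inter> source C') = coord c ` (source c \<inter> source c') \<times> coord d ` (source d \<inter> source d')"
    by (simp add: C C' Times_Int_Times map_prod_surj_on)
  have "smooth_on (coord c ` (source c \<inter> source c') \<times> coord d ` (source d \<inter> source d'))
      (\<lambda>z. (coord c' (param c (fst z)), coord d' (param d (snd z))))"
    using M1.open_overlap[OF c c'] M2.open_overlap[OF d d']
    by (intro smooth_on_Pair smooth_on_fst[OF _ _ M1.smooth_transition[OF c c']]
        smooth_on_snd[OF _ _ M2.smooth_transition[OF d d']] open_Times)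
  then show "smooth_on (coord C ` (source C \<inter> source C')) (coord C' \<circ> param C)"
    unfolding S by (simp add: C C' o_def map_prod_def split_beta)
next
  fix x :: "'a \<times> 'b"
  show "chart_at M x \<in> atlas M" "x \<in> source (chart_at M x)"
    using M1.chart_at[of "fst x"] M2.chart_at[of "snd x"]
    by (auto simp: chart_at_product atlas_product mem_Times_iff)
qed

sublocale smooth_mfd M
  by unfold_locales (rule smooth_product)

lemma atlas_productE:
  assumes "C \<in> atlas M"
  obtains c d where "C = product_chart c d" "c \<in> atlas M1" "d \<in> atlas M2"
  using assms by (auto simp: atlas_product)

text \<open>Block-diagonal transitions are what allow tensors on the product to be handled factor by
  factor.\<close>

lemma transition_deriv_product:
  assumes "c \<in> atlas M1" "c' \<in> atlas M1" "d \<in> atlas M2" "d' \<in> atlas M2"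
    and "fst x \<in> source c" "fst x \<in> source c'" "snd x \<in> source d" "snd x \<in> source d'"
  shows "transition_deriv (product_chart c d) (product_chart c' d') x v =
    (transition_deriv c c' (fst x) (fst v), transition_deriv d d' (snd x) (snd v))"
proof -
  have 1: "((\<lambda>z. (coord c' (param c (fst z)), coord d' (param d (snd z)))) has_derivative
     (\<lambda>v. (transition_deriv c c' (fst x) (fst v), transition_deriv d d' (snd x) (snd v))))
     (at (coord (product_chart c d) x))"
    by (rule has_derivative_map_prod)
      (use assms M1.transition_has_derivative M2.transition_has_derivative in auto)
  have 2: "((\<lambda>z. (coord c' (param c (fst z)), coord d' (param d (snd z)))) has_derivative
      transition_deriv (product_chart c d) (product_chart c' d') x) (at (coord (product_chart c d) x))"
  proof -
    have "product_chart c d \<in> atlas M" "product_chart c' d' \<in> atlas M"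
      using assms(1-4) by (auto simp: atlas_product)
    moreover have "x \<in> source (product_chart c d)" "x \<in> source (product_chart c' d')"
      using assms(5-8) by (simp_all add: mem_Times_iff)
    ultimately show ?thesis
      using transition_has_derivative[of "product_chart c d" "product_chart c' d'" x]
      by (simp add: map_prod_def split_beta)
  qed
  show ?thesis using fun_cong[OF has_derivative_unique[OF 2 1]] .
qed

lemma hl: "hl \<alpha> x = \<alpha> (fst x) o\<^sub>L fst_blinfun" and vl: "vl \<beta> x = \<beta> (snd x) o\<^sub>L snd_blinfun"
  using hlift_eq[OF M1.smooth M2.smooth, of \<alpha> "fst x" "snd x"] vlift_eq[OF M1.smooth M2.smooth, of \<beta> "fst x" "snd x"]
  by simp_all

lemma hl_apply: "blinfun_apply (hl \<alpha> x) = (\<lambda>v. \<alpha> (fst x) (fst v))"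
  and vl_apply: "blinfun_apply (vl \<beta> x) = (\<lambda>v. \<beta> (snd x) (snd v))"
  by (auto simp: hl vl)

lemma hl_linear: "hl (\<lambda>p. \<alpha> p + \<beta> p) = (\<lambda>x. hl \<alpha> x + hl \<beta> x)" "hl (\<lambda>p. \<alpha> p - \<beta> p) = (\<lambda>x. hl \<alpha> x - hl \<beta> x)"
  "hl (\<lambda>p. \<phi> p *\<^sub>R \<alpha> p) = (\<lambda>x. \<phi> (fst x) *\<^sub>R hl \<alpha> x)"
  by (auto simp: fun_eq_iff hl intro!: blinfun_eqI simp: blinfun.add_left blinfun.diff_left blinfun.scaleR_left)

lemma vl_linear: "vl (\<lambda>p. \<gamma> p + \<delta> p) = (\<lambda>x. vl \<gamma> x + vl \<delta> x)" "vl (\<lambda>p. \<gamma> p - \<delta> p) = (\<lambda>x. vl \<gamma> x - vl \<delta> x)"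
  "vl (\<lambda>p. \<phi> p *\<^sub>R \<gamma> p) = (\<lambda>x. \<phi> (snd x) *\<^sub>R vl \<gamma> x)"
  by (auto simp: fun_eq_iff vl intro!: blinfun_eqI simp: blinfun.add_left blinfun.diff_left blinfun.scaleR_left)

text \<open>A covector is recovered from its lift by restriction to its own factor; this is how
  curvature identities descend.\<close>

lemma hl_eq_zero: "hl \<alpha> x = 0 \<Longrightarrow> \<alpha> (fst x) = 0" and vl_eq_zero: "vl \<gamma> x = 0 \<Longrightarrow> \<gamma> (snd x) = 0"
proof -
  have "\<alpha> (fst x) = hl \<alpha> x o\<^sub>L inl_blinfun" "\<gamma> (snd x) = vl \<gamma> x o\<^sub>L inr_blinfun" by (simp_all add: hl vl)
  then show "hl \<alpha> x = 0 \<Longrightarrow> \<alpha> (fst x) = 0" "vl \<gamma> x = 0 \<Longrightarrow> \<gamma> (snd x) = 0"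
    by (simp_all add: bounded_bilinear.zero_left[OF bounded_bilinear_blinfun_compose])
qed

lemma smooth_fun_fst: "smooth_fun M1 \<phi> \<Longrightarrow> smooth_fun M (\<lambda>x. \<phi> (fst x))"
  unfolding smooth_fun_def
proof
  fix C assume \<phi>: "\<forall>c\<in>atlas M1. smooth_on (target c) (\<phi> \<circ> param c)" and "C \<in> atlas M"
  then obtain c d where C: "C = product_chart c d" and c: "c \<in> atlas M1" and d: "d \<in> atlas M2"
    by (metis atlas_productE)
  have "smooth_on (target c \<times> target d) (\<lambda>z. (\<phi> \<circ> param c) (fst z))"
    by (rule smooth_on_fst[OF M1.chart(2)[OF c] M2.chart(2)[OF d]]) (use \<phi> c in blast)
  then show "smooth_on (target C) ((\<lambda>x. \<phi> (fst x)) \<circ> param C)"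
    unfolding C target_product_chart by (simp add: o_def)
qed

lemma smooth_fun_snd: "smooth_fun M2 \<phi> \<Longrightarrow> smooth_fun M (\<lambda>x. \<phi> (snd x))"
  unfolding smooth_fun_def
proof
  fix C assume \<phi>: "\<forall>c\<in>atlas M2. smooth_on (target c) (\<phi> \<circ> param c)" and "C \<in> atlas M"
  then obtain c d where C: "C = product_chart c d" and c: "c \<in> atlas M1" and d: "d \<in> atlas M2"
    by (metis atlas_productE)
  have "smooth_on (target c \<times> target d) (\<lambda>z. (\<phi> \<circ> param d) (snd z))"
    by (rule smooth_on_snd[OF M1.chart(2)[OF c] M2.chart(2)[OF d]]) (use \<phi> d in blast)
  then show "smooth_on (target C) ((\<lambda>x. \<phi> (snd x)) \<circ> param C)"
    unfolding C target_product_chart by (simp add: o_def)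
qed

lemma transition_deriv_chart_at_product:
  assumes "c \<in> atlas M1" "d \<in> atlas M2" "fst x \<in> source c" "snd x \<in> source d"
  shows "transition_deriv (product_chart c d) (chart_at M x) x v =
      (transition_deriv c (chart_at M1 (fst x)) (fst x) (fst v), transition_deriv d (chart_at M2 (snd x)) (snd x) (snd v))"
    "transition_deriv (chart_at M x) (product_chart c d) x v =
      (transition_deriv (chart_at M1 (fst x)) c (fst x) (fst v), transition_deriv (chart_at M2 (snd x)) d (snd x) (snd v))"
  unfolding chart_at_product
  by (simp_all add: transition_deriv_product assms M1.chart_at M2.chart_at)

lemma form_in_lift:
  assumes c: "c \<in> atlas M1" "d \<in> atlas M2" and x: "x \<in> target c \<times> target d"
  shows "form_in M (product_chart c d) (hl \<alpha>) x v = form_in M1 c \<alpha> (fst x) (fst v)"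
    "form_in M (product_chart c d) (vl \<beta>) x v = form_in M2 d \<beta> (snd x) (snd v)"
proof -
  have "fst x \<in> target c" "snd x \<in> target d" using x by auto
  note p = M1.chart(5)[OF c(1) this(1)] M2.chart(5)[OF c(2) this(2)]
  show "form_in M (product_chart c d) (hl \<alpha>) x v = form_in M1 c \<alpha> (fst x) (fst v)"
    "form_in M (product_chart c d) (vl \<beta>) x v = form_in M2 d \<beta> (snd x) (snd v)"
    using transition_deriv_chart_at_product(1)[of c d "map_prod (param c) (param d) x", OF c] p
    by (simp_all add: form_in_def Let_def hl vl)
qed

lemma hl_in_one_forms: assumes "\<alpha> \<in> one_forms M1" shows "hl \<alpha> \<in> one_forms M"
  unfolding one_forms_def
proof (intro CollectI ballI)
  fix C assume "C \<in> atlas M"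
  then obtain c d where C: "C = product_chart c d" and c: "c \<in> atlas M1" and d: "d \<in> atlas M2"
    by (metis atlas_productE)
  note o = open_Times[OF M1.chart(2)[OF c] M2.chart(2)[OF d]]
  show "smooth_on (target C) (form_in M C (hl \<alpha>))"
    unfolding C target_product_chart
  proof (rule smooth_on_blinfun[OF o], rule smooth_on_cong[OF o])
    fix i :: "'e \<times> 'd"
    show "smooth_on (target c \<times> target d) (\<lambda>x. form_in M1 c \<alpha> (fst x) (fst i))"
      by (rule smooth_on_fst[OF M1.chart(2)[OF c] M2.chart(2)[OF d], of "\<lambda>x. form_in M1 c \<alpha> x (fst i)"])
        (rule smooth_on_bounded_linear[OF M1.chart(2)[OF c] blinfun.bounded_linear_left M1.one_formsD[OF assms c]])
  qed (simp add: form_in_lift[OF c d])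
qed

lemma vl_in_one_forms: assumes "\<alpha> \<in> one_forms M2" shows "vl \<alpha> \<in> one_forms M"
  unfolding one_forms_def
proof (intro CollectI ballI)
  fix C assume "C \<in> atlas M"
  then obtain c d where C: "C = product_chart c d" and c: "c \<in> atlas M1" and d: "d \<in> atlas M2"
    by (metis atlas_productE)
  note o = open_Times[OF M1.chart(2)[OF c] M2.chart(2)[OF d]]
  show "smooth_on (target C) (form_in M C (vl \<alpha>))"
    unfolding C target_product_chart
  proof (rule smooth_on_blinfun[OF o], rule smooth_on_cong[OF o])
    fix i :: "'e \<times> 'd"
    show "smooth_on (target c \<times> target d) (\<lambda>x. form_in M2 d \<alpha> (snd x) (snd i))"
      by (rule smooth_on_snd[OF M1.chart(2)[OF c] M2.chart(2)[OF d], of "\<lambda>x. form_in M2 d \<alpha> x (snd i)"])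
        (rule smooth_on_bounded_linear[OF M2.chart(2)[OF d] blinfun.bounded_linear_left M2.one_formsD[OF assms d]])
  qed (simp add: form_in_lift[OF c d])
qed

lemma differential_fst:
  assumes "smooth_fun M1 \<phi>" shows "differential M (\<lambda>x. \<phi> (fst x)) = hl (differential M1 \<phi>)"
proof (rule ext, rule differential_eqI')
  fix x
  show "((\<lambda>z. \<phi> (fst (param (chart_at M x) z))) has_derivative hl (differential M1 \<phi>) x) (at (coord (chart_at M x) x))"
    using diff_chain_at[OF bounded_linear_imp_has_derivative[OF bounded_linear_fst, of "at (coord (chart_at M x) x)"],
        of "\<lambda>y. \<phi> (param (chart_at M1 (fst x)) y)"] M1.differential_has_derivative[OF assms, of "fst x"]
    by (simp add: chart_at_product o_def hl_apply)
qed

lemma differential_snd: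
  assumes "smooth_fun M2 \<phi>" shows "differential M (\<lambda>x. \<phi> (snd x)) = vl (differential M2 \<phi>)"
proof (rule ext, rule differential_eqI')
  fix x
  show "((\<lambda>z. \<phi> (snd (param (chart_at M x) z))) has_derivative vl (differential M2 \<phi>) x) (at (coord (chart_at M x) x))"
    using diff_chain_at[OF bounded_linear_imp_has_derivative[OF bounded_linear_snd, of "at (coord (chart_at M x) x)"],
        of "\<lambda>y. \<phi> (param (chart_at M2 (snd x)) y)"] M2.differential_has_derivative[OF assms, of "snd x"]
    by (simp add: chart_at_product o_def vl_apply)
qed

section \<open>Lifted functions generate the forms on the product\<close>

definition lifts :: "('a \<times> 'b \<Rightarrow> real) set" where
  "lifts = {\<lambda>x. \<phi> (fst x) |\<phi>. smooth_fun M1 \<phi>} \<union> {\<lambda>x. \<psi> (snd x) |\<psi>. smooth_fun M2 \<psi>}"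

text \<open>The bumps on the product are products of lifts rather than lifts; the Leibniz rule keeps
  their differentials in the span.\<close>

lemma exact_span_lift_product:
  assumes a: "smooth_fun M1 a" and b: "smooth_fun M2 b"
  shows "differential M (\<lambda>x. a (fst x) * b (snd x)) \<in> exact_span M lifts"
proof -
  have "differential M (\<lambda>x. a (fst x) * b (snd x)) =
      (\<lambda>x. a (fst x) *\<^sub>R differential M (\<lambda>x. b (snd x)) x + b (snd x) *\<^sub>R differential M (\<lambda>x. a (fst x)) x)"
    by (rule ext) (rule differential_mult[OF smooth_fun_fst[OF a] smooth_fun_snd[OF b]])
  also have "\<dots> \<in> exact_span M lifts"
    by (intro exact_span_plus exact_span_scale exact_span_differential smooth_fun_fst smooth_fun_snd a b)
      (use a b in \<open>auto simp: lifts_def\<close>)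
  finally show ?thesis .
qed

text \<open>With the product of two bumps as bump, \<psi> and every y i factor into a function on M1
  times a function on M2, so the whole frame lies in the span of differentials of lifts.\<close>

lemma generates_lifts: "generates M lifts"
  unfolding generates_def
proof (intro conjI allI ballI)
  show "smooth_fun M v" if "v \<in> lifts" for v
    using that smooth_fun_fst smooth_fun_snd by (auto simp: lifts_def)
  fix x :: "'a \<times> 'b"
  let ?c = "chart_at M1 (fst x)" and ?d = "chart_at M2 (snd x)"
  obtain B1 K1 where "chart_frame M1 ?c B1 K1" and ne1: "chart_ext ?c B1 (fst x) \<noteq> 0"
    using M1.exists_chart_frame[OF M1.chart_at(1,2)] .
  then interpret F1: chart_frame M1 ?c B1 K1 by simp
  obtain B2 K2 where "chart_frame M2 ?d B2 K2" and ne2: "chart_ext ?d B2 (snd x) \<noteq> 0"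
    using M2.exists_chart_frame[OF M2.chart_at(1,2)] .
  then interpret F2: chart_frame M2 ?d B2 K2 by simp
  let ?C = "product_chart ?c ?d" and ?B = "\<lambda>z. B1 (fst z) * B2 (snd z)"
  interpret F: chart_frame M ?C ?B "K1 \<times> K2"
  proof
    show "?C \<in> atlas M" using F1.c F2.c by (auto simp: atlas_product)
    show "smooth_on (target ?C) ?B"
      unfolding target_product_chart using M1.chart(2)[OF F1.c] M2.chart(2)[OF F2.c]
      by (intro smooth_on_mult open_Times smooth_on_fst[OF _ _ F1.B] smooth_on_snd[OF _ _ F2.B])
    show "compact (K1 \<times> K2)" using F1.K(1) F2.K(1) by (rule compact_Times)
    show "K1 \<times> K2 \<subseteq> target ?C" unfolding target_product_chart using F1.K(2) F2.K(2) by (rule Sigma_mono)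
    show "?B z = 0" if "z \<notin> K1 \<times> K2" for z
      using that F1.K(3)[of "fst z"] F2.K(3)[of "snd z"] by (auto simp: mem_Times_iff)
  qed
  have \<psi>: "F.\<psi> = (\<lambda>x. F1.\<psi> (fst x) * F2.\<psi> (snd x))"
    by (auto simp: F.\<psi>_def F1.\<psi>_def F2.\<psi>_def chart_ext_def)
  have y1: "F.y (i, 0) = (\<lambda>x. F1.y i (fst x) * F2.\<psi> (snd x))" for i
    by (auto simp: F.y_def F1.y_def F2.\<psi>_def chart_ext_def)
  have y2: "F.y (0, i) = (\<lambda>x. F1.\<psi> (fst x) * F2.y i (snd x))" for i
    by (auto simp: F.y_def F2.y_def F1.\<psi>_def chart_ext_def)
  have dy: "differential M (F.y i) \<in> exact_span M lifts" if "i \<in> Basis" for i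
  proof -
    \<comment> \<open>A basis vector of the product model space lies in one factor: that factor
      contributes its coordinate function y, the other its bump.\<close>
    have "(\<exists>j. i = (j, 0)) \<or> (\<exists>j. i = (0, j))" using that by (auto simp: Basis_prod_def)
    then show ?thesis
      using exact_span_lift_product[OF F1.smooth_y F2.smooth_\<psi>] exact_span_lift_product[OF F1.smooth_\<psi> F2.smooth_y]
      by (auto simp: y1 y2)
  qed
  have d\<psi>: "differential M F.\<psi> \<in> exact_span M lifts"
    unfolding \<psi> by (rule exact_span_lift_product[OF F1.smooth_\<psi> F2.smooth_\<psi>])
  have fr: "F.frame i \<in> exact_span M lifts" if "i \<in> Basis" for i
    using exact_span_plus[OF exact_span_scale[OF dy[OF that] F.smooth_\<psi>]
        exact_span_scale[OF d\<psi> smooth_fun_minus[OF F.smooth_y[of i]]]]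
    by (simp add: F.frame_def[abs_def])
  show "\<exists>\<phi>. smooth_fun M \<phi> \<and> \<phi> x \<noteq> 0 \<and>
      (\<forall>\<alpha>\<in>one_forms M. (\<lambda>x. \<phi> x *\<^sub>R \<alpha> x) \<in> exact_span M lifts)"
  proof (intro exI[of _ "\<lambda>p. F.\<psi> p ^ 3"] conjI ballI smooth_fun_power F.smooth_\<psi>)
    show "F.\<psi> x ^ 3 \<noteq> 0" using ne1 ne2 by (simp add: \<psi> F1.\<psi>_def F2.\<psi>_def)
    show "(\<lambda>x. (F.\<psi> x ^ 3) *\<^sub>R \<alpha> x) \<in> exact_span M lifts" if "\<alpha> \<in> one_forms M" for \<alpha>
      unfolding F.frame_expansion by (intro exact_span_sum exact_span_scale fr F.smooth_coef that)
  qed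
qed

end

section \<open>The warped product as an instance of the general theory\<close>

locale warped_pair = M1: metric_mfd M1 P1 gt1 + M2: metric_mfd M2 P2 gt2
  for M1 :: "('a::{t2_space,second_countable_topology}, 'e::euclidean_space) manifold"
    and P1 gt1
    and M2 :: "('b::{t2_space,second_countable_topology}, 'd::euclidean_space) manifold"
    and P2 gt2 +
  fixes f \<mu> :: "'a \<Rightarrow> real"
  assumes f: "smooth_fun M1 f" "\<And>p. f p > 0" and \<mu>: "smooth_fun M1 \<mu>"
begin

sublocale mfd_pair M1 M2 ..

text \<open>The metric behind g^f: passing to the dual inverts the scaling, hence the inverse of f.
  Exhibiting it makes the product an instance of \<open>metric_mfd\<close>, with its existence
  theorem for the connection.\<close>

definition warped_metric :: "('a \<times> 'b, 'e \<times> 'd) cov_tensor" where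
  "warped_metric x v w = gt1 (fst x) (fst v) (fst w) + inverse (f (fst x)) * gt2 (snd x) (snd v) (snd w)"

abbreviation "W \<equiv> warped_bivector \<mu> P1 P2"

lemma bivector_W: "bivector_field M W"
  unfolding bivector_field_def
proof (intro conjI allI ballI)
  fix x \<xi> \<eta>
  show "bilinear (W x)"
    unfolding bilinear_def linear_iff warped_bivector_eq
    by (auto simp: bounded_bilinear.add_left[OF bounded_bilinear_blinfun_compose]
        bounded_bilinear.scaleR_left[OF bounded_bilinear_blinfun_compose] M1.P_simps M2.P_simps algebra_simps)
  show "W x \<xi> \<eta> = - W x \<eta> \<xi>"
    using M1.antisym_P[of "fst x" "\<xi> o\<^sub>L inl_blinfun"] M2.antisym_P[of "snd x" "\<xi> o\<^sub>L inr_blinfun"]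
    unfolding warped_bivector_eq by simp
next
  fix C \<xi> \<eta> assume "C \<in> atlas M"
  then obtain c d where C: "C = product_chart c d" and c: "c \<in> atlas M1" and d: "d \<in> atlas M2"
    by (metis atlas_productE)
  note oc = M1.chart(2)[OF c] and od = M2.chart(2)[OF d]
  have "smooth_on (target c \<times> target d) (\<lambda>x. con_tensor_in M1 c P1 (fst x) (\<xi> o\<^sub>L inl_blinfun) (\<eta> o\<^sub>L inl_blinfun) +
      \<mu> (param c (fst x)) * con_tensor_in M2 d P2 (snd x) (\<xi> o\<^sub>L inr_blinfun) (\<eta> o\<^sub>L inr_blinfun))"
    by (intro smooth_on_add smooth_on_mult open_Times oc od smooth_on_fst[OF oc od M1.smooth_con_tensor_P[OF c]]
        smooth_on_snd[OF oc od M2.smooth_con_tensor_P[OF d]] smooth_on_fst[OF oc od M1.smooth_funD[OF \<mu> c]])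
  then show "smooth_on (target C) (\<lambda>x. con_tensor_in M C W x \<xi> \<eta>)"
    unfolding C target_product_chart
  proof (rule smooth_on_cong[OF open_Times[OF oc od], rotated])
    fix x assume "x \<in> target c \<times> target d"
    then have x: "fst x \<in> target c" "snd x \<in> target d" by auto
    let ?x = "map_prod (param c) (param d) x"
    have T: "(\<zeta> o\<^sub>L transition_deriv (chart_at M ?x) (product_chart c d) ?x) o\<^sub>L inl_blinfun =
        (\<zeta> o\<^sub>L inl_blinfun) o\<^sub>L transition_deriv (chart_at M1 (param c (fst x))) c (param c (fst x))"
      "(\<zeta> o\<^sub>L transition_deriv (chart_at M ?x) (product_chart c d) ?x) o\<^sub>L inr_blinfun =
        (\<zeta> o\<^sub>L inr_blinfun) o\<^sub>L transition_deriv (chart_at M2 (param d (snd x))) d (param d (snd x))" for \<zeta>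
      by (rule blinfun_eqI, use transition_deriv_chart_at_product(2)[of c d ?x, OF c d] x M1.chart(5)[OF c] M2.chart(5)[OF d]
          in \<open>simp add: inl_blinfun.rep_eq inr_blinfun.rep_eq\<close>)+
    show "con_tensor_in M1 c P1 (fst x) (\<xi> o\<^sub>L inl_blinfun) (\<eta> o\<^sub>L inl_blinfun) +
      \<mu> (param c (fst x)) * con_tensor_in M2 d P2 (snd x) (\<xi> o\<^sub>L inr_blinfun) (\<eta> o\<^sub>L inr_blinfun) =
      con_tensor_in M (product_chart c d) W x \<xi> \<eta>"
      unfolding con_tensor_in_def Let_def product_chart_sel warped_bivector_eq T by simp
  qed
qed

lemma metric_warped: "pseudo_riemannian_metric M warped_metric"
  unfolding pseudo_riemannian_metric_def
proof (intro conjI allI ballI impI)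
  fix x v w
  show "bilinear (warped_metric x)"
    unfolding bilinear_def linear_iff warped_metric_def
    by (auto simp: algebra_simps bilinear_ladd[OF M1.bilinear_gt] bilinear_radd[OF M1.bilinear_gt]
      bilinear_lmul[OF M1.bilinear_gt] bilinear_rmul[OF M1.bilinear_gt]
      bilinear_ladd[OF M2.bilinear_gt] bilinear_radd[OF M2.bilinear_gt]
      bilinear_lmul[OF M2.bilinear_gt] bilinear_rmul[OF M2.bilinear_gt])
  show "warped_metric x v w = warped_metric x w v"
    unfolding warped_metric_def M1.sym_gt[of _ "fst v"] M2.sym_gt[of _ "snd v"] by simp
  assume z: "\<forall>w. warped_metric x v w = 0"
  have "gt1 (fst x) (fst v) u = 0" for u
    using spec[OF z, of "(u, 0)"] by (simp add: warped_metric_def bilinear_rzero[OF M2.bilinear_gt])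
  moreover have "gt2 (snd x) (snd v) u = 0" for u
    using spec[OF z, of "(0, u)"] f(2)[of "fst x"] by (simp add: warped_metric_def bilinear_rzero[OF M1.bilinear_gt])
  ultimately have "fst v = 0" "snd v = 0" using M1.nondegenerate_gt M2.nondegenerate_gt by blast+
  then show "v = 0" by (simp add: prod_eq_iff)
next
  fix C v w assume "C \<in> atlas M"
  then obtain c d where C: "C = product_chart c d" and c: "c \<in> atlas M1" and d: "d \<in> atlas M2"
    by (metis atlas_productE)
  note oc = M1.chart(2)[OF c] and od = M2.chart(2)[OF d]
  have f0: "f p \<noteq> 0" for p using f(2)[of p] by simp
  have "smooth_on (target c \<times> target d) (\<lambda>x. cov_tensor_in M1 c gt1 (fst x) (fst v) (fst w) +
      inverse (f (param c (fst x))) * cov_tensor_in M2 d gt2 (snd x) (snd v) (snd w))"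
    by (intro smooth_on_add smooth_on_mult open_Times oc od smooth_on_fst[OF oc od M1.smooth_gt[OF c]]
        smooth_on_snd[OF oc od M2.smooth_gt[OF d]] smooth_on_fst[OF oc od M1.smooth_funD[OF M1.smooth_fun_inverse[OF f(1) f0] c]])
  then show "smooth_on (target C) (\<lambda>x. cov_tensor_in M C warped_metric x v w)"
    unfolding C target_product_chart
  proof (rule smooth_on_cong[OF open_Times[OF oc od], rotated])
    fix x assume "x \<in> target c \<times> target d"
    then have x: "fst x \<in> target c" "snd x \<in> target d" by auto
    show "cov_tensor_in M1 c gt1 (fst x) (fst v) (fst w) +
      inverse (f (param c (fst x))) * cov_tensor_in M2 d gt2 (snd x) (snd v) (snd w) =
      cov_tensor_in M (product_chart c d) warped_metric x v w"
      using transition_deriv_chart_at_product(1)[of c d "map_prod (param c) (param d) x", OF c d] x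
        M1.chart(5)[OF c] M2.chart(5)[OF d]
      by (simp add: cov_tensor_in_def Let_def warped_metric_def)
  qed
qed

sublocale metric_mfd M W warped_metric
  by unfold_locales (rule bivector_W metric_warped)+

text \<open>Raising an index with the warped metric multiplies the vertical part by f, undoing the
  inverse of f in the metric.\<close>

lemma g_warped: "g x \<xi> \<eta> = M1.g (fst x) (\<xi> o\<^sub>L inl_blinfun) (\<eta> o\<^sub>L inl_blinfun) +
     f (fst x) * M2.g (snd x) (\<xi> o\<^sub>L inr_blinfun) (\<eta> o\<^sub>L inr_blinfun)"
proof -
  let ?v1 = "metric_sharp gt1 (fst x) (\<xi> o\<^sub>L inl_blinfun)" and ?v2 = "metric_sharp gt2 (snd x) (\<xi> o\<^sub>L inr_blinfun)"
  have s: "\<zeta> w = \<zeta> (fst w, 0) + \<zeta> (0, snd w)" for \<zeta> :: "('e \<times> 'd) \<Rightarrow>\<^sub>L real" and w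
    by (simp add: blinfun.add_right[symmetric])
  have "metric_sharp warped_metric x \<xi> = (?v1, f (fst x) *\<^sub>R ?v2)"
  proof (rule metric_sharp_eqI)
    fix w
    show "warped_metric x (?v1, f (fst x) *\<^sub>R ?v2) w = \<xi> w"
      using f(2)[of "fst x"] s[of \<xi> w]
      by (simp add: warped_metric_def bilinear_lmul[OF M2.bilinear_gt] M1.gt_metric_sharp M2.gt_metric_sharp
          inl_blinfun.rep_eq inr_blinfun.rep_eq)
  qed
  moreover have "\<eta> (0, f (fst x) *\<^sub>R ?v2) = f (fst x) * \<eta> (0, ?v2)"
    using blinfun.scaleR_right[of \<eta> "f (fst x)" "(0, ?v2)"] by simp
  ultimately show ?thesis
    using s[of \<eta> "(?v1, f (fst x) *\<^sub>R ?v2)"]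
    by (simp add: g_eq M1.g_eq M2.g_eq inl_blinfun.rep_eq inr_blinfun.rep_eq)
qed

lemma warped_cometric: "warped_cometric f M1.g M2.g = g"
  by (intro ext) (simp add: g_warped warped_cometric_eq)

end

section \<open>Curvature and the anchor\<close>

context metric_mfd
begin

abbreviation R where "R \<equiv> curvature M P D"

(* P is only a bivector field; the defect vanishes iff P is a Poisson tensor. *)
definition anchor_defect :: "('a, 'e) form \<Rightarrow> ('a, 'e) form \<Rightarrow> ('a \<Rightarrow> real) \<Rightarrow> 'a \<Rightarrow> real" where
  "anchor_defect \<alpha> \<beta> \<phi> p = act \<alpha> (act \<beta> \<phi>) p - act \<beta> (act \<alpha> \<phi>) p - act (bracket \<alpha> \<beta>) \<phi> p"

lemma D_zero: "\<alpha> \<in> one_forms M \<Longrightarrow> D \<alpha> (\<lambda>p. 0) = (\<lambda>p. 0)" "\<alpha> \<in> one_forms M \<Longrightarrow> D (\<lambda>p. 0) \<alpha> = (\<lambda>p. 0)"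
  using D_scale_right[OF smooth_fun_const[of 0] _ one_forms_zero] D_scale_left[OF smooth_fun_const[of 0] one_forms_zero]
  by (auto simp: act_const)

lemma D_diff_left:
  assumes "\<alpha> \<in> one_forms M" "\<alpha>' \<in> one_forms M" "\<beta> \<in> one_forms M"
  shows "D (\<lambda>p. \<alpha> p - \<alpha>' p) \<beta> = (\<lambda>p. D \<alpha> \<beta> p - D \<alpha>' \<beta> p)"
  using D_add_left[OF assms(1) one_forms_scaleR[OF assms(2), of "-1"] assms(3)]
    D_scale_left[OF smooth_fun_const[of "-1"] assms(2,3)] by simp

lemma bracket_antisym_fun:
  assumes "\<alpha> \<in> one_forms M" "\<beta> \<in> one_forms M" shows "bracket \<beta> \<alpha> = (\<lambda>p. - bracket \<alpha> \<beta> p)"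
  by (rule ext, rule bracket_antisym[OF assms])

lemma bracket_funs:
  assumes "\<alpha> \<in> one_forms M" "\<beta> \<in> one_forms M"
  shows "\<alpha>' \<in> one_forms M \<Longrightarrow> bracket (\<lambda>q. \<alpha> q + \<alpha>' q) \<beta> = (\<lambda>p. bracket \<alpha> \<beta> p + bracket \<alpha>' \<beta> p)"
    and "smooth_fun M \<phi> \<Longrightarrow> bracket (\<lambda>q. \<phi> q *\<^sub>R \<alpha> q) \<beta> = (\<lambda>p. \<phi> p *\<^sub>R bracket \<alpha> \<beta> p - act \<beta> \<phi> p *\<^sub>R \<alpha> p)"
  by (auto simp: assms bracket_add_left bracket_scale_left)

lemma act_funs:
  shows "act (\<lambda>q. \<alpha> q + \<beta> q) \<phi> = (\<lambda>p. act \<alpha> \<phi> p + act \<beta> \<phi> p)"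
    and "act (\<lambda>q. \<psi> q *\<^sub>R \<alpha> q) \<phi> = (\<lambda>p. \<psi> p * act \<alpha> \<phi> p)"
  by (auto simp: act_add_form act_scale_form)

lemma curvature_antisym:
  assumes "\<alpha> \<in> one_forms M" "\<beta> \<in> one_forms M" "\<gamma> \<in> one_forms M"
  shows "R \<beta> \<alpha> \<gamma> p = - R \<alpha> \<beta> \<gamma> p"
  using D_scale_left[OF smooth_fun_const[of "-1"] bracket_in_one_forms[OF assms(1,2)] assms(3)]
  by (simp add: curvature_def bracket_antisym_fun[OF assms(1,2)])

lemma curvature_add:
  assumes "\<alpha> \<in> one_forms M" "\<alpha>' \<in> one_forms M" "\<beta> \<in> one_forms M" "\<gamma> \<in> one_forms M"
  shows "R (\<lambda>q. \<alpha> q + \<alpha>' q) \<beta> \<gamma> p = R \<alpha> \<beta> \<gamma> p + R \<alpha>' \<beta> \<gamma> p"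
    "R \<beta> \<gamma> (\<lambda>q. \<alpha> q + \<alpha>' q) p = R \<beta> \<gamma> \<alpha> p + R \<beta> \<gamma> \<alpha>' p"
  using assms
  by (simp_all add: curvature_def D_add_left D_add_right D_in_one_forms bracket_in_one_forms bracket_funs)

text \<open>The derivative of \<phi> along #\<beta> appears twice with opposite signs: from
  differentiating \<phi> D \<alpha> \<gamma> and from the bracket of \<phi> \<alpha> with
  \<beta>.\<close>

lemma curvature_scale_left:
  assumes "\<alpha> \<in> one_forms M" "\<beta> \<in> one_forms M" "\<gamma> \<in> one_forms M" "smooth_fun M \<phi>"
  shows "R (\<lambda>q. \<phi> q *\<^sub>R \<alpha> q) \<beta> \<gamma> p = \<phi> p *\<^sub>R R \<alpha> \<beta> \<gamma> p"
  using assms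
  by (simp add: curvature_def bracket_funs D_diff_left D_scale_left D_scale_right D_in_one_forms bracket_in_one_forms
      one_forms_scale smooth_act algebra_simps)

text \<open>Terms with one derivative of \<phi> cancel in pairs; the second-order ones, together
  with the derivative along the bracket, form the defect.\<close>

lemma curvature_scale_right:
  assumes "\<alpha> \<in> one_forms M" "\<beta> \<in> one_forms M" "\<gamma> \<in> one_forms M" "smooth_fun M \<phi>"
  shows "R \<alpha> \<beta> (\<lambda>q. \<phi> q *\<^sub>R \<gamma> q) p = \<phi> p *\<^sub>R R \<alpha> \<beta> \<gamma> p + anchor_defect \<alpha> \<beta> \<phi> p *\<^sub>R \<gamma> p"
  using assms
  by (simp add: curvature_def anchor_defect_def D_add_right D_scale_right D_in_one_forms bracket_in_one_forms
      one_forms_scale smooth_act algebra_simps)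

lemma anchor_defect_antisym:
  assumes "\<alpha> \<in> one_forms M" "\<beta> \<in> one_forms M"
  shows "anchor_defect \<beta> \<alpha> \<phi> p = - anchor_defect \<alpha> \<beta> \<phi> p"
  using act_scale_form[of "\<lambda>_. -1" "bracket \<alpha> \<beta>" \<phi> p]
  by (simp add: anchor_defect_def bracket_antisym_fun[OF assms])

lemma anchor_defect_add:
  assumes "\<alpha> \<in> one_forms M" "\<alpha>' \<in> one_forms M" "\<beta> \<in> one_forms M" "smooth_fun M \<phi>"
  shows "anchor_defect (\<lambda>q. \<alpha> q + \<alpha>' q) \<beta> \<phi> p = anchor_defect \<alpha> \<beta> \<phi> p + anchor_defect \<alpha>' \<beta> \<phi> p"
  using assms by (simp add: anchor_defect_def act_funs act_add bracket_funs smooth_act)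

text \<open>The derivative of \<psi> along #\<beta> cancels between the second term and the bracket
  term.\<close>

lemma anchor_defect_scale:
  assumes "\<alpha> \<in> one_forms M" "\<beta> \<in> one_forms M" "smooth_fun M \<phi>" "smooth_fun M \<psi>"
  shows "anchor_defect (\<lambda>q. \<psi> q *\<^sub>R \<alpha> q) \<beta> \<phi> p = \<psi> p * anchor_defect \<alpha> \<beta> \<phi> p"
  using assms
  by (simp add: anchor_defect_def act_funs act_mult bracket_funs smooth_act act_diff_form act_scale_form algebra_simps)

(* On exact forms the defect is the Jacobiator of the bracket of functions. *)
lemma anchor_defect_cyclic:
  assumes "smooth_fun M a" "smooth_fun M b" "smooth_fun M c"
  shows "anchor_defect (differential M a) (differential M b) c p = anchor_defect (differential M b) (differential M c) a p"
proof -
  let ?B = "\<lambda>a b. act (differential M a) b"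
  have anti: "?B b a = (\<lambda>p. - ?B a b p)" for a b
    by (rule ext) (simp add: act_def tensor_apply_def antisym_P[symmetric])
  have neg: "act \<alpha> (\<lambda>p. - \<phi> p) p = - act \<alpha> \<phi> p" if "smooth_fun M \<phi>" for \<alpha> \<phi> p
    using act_scaleR[OF that, of \<alpha> "-1"] by simp
  have br: "bracket (differential M a) (differential M b) = differential M (?B a b)"
    if "smooth_fun M a" "smooth_fun M b" for a b
    by (rule ext) (rule bracket_differential[OF that])
  have sm: "smooth_fun M (?B a b)" if "smooth_fun M a" "smooth_fun M b" for a b
    using that by (intro smooth_act differential_in_one_forms)
  have "?B (?B b c) a p = - ?B a (?B b c) p" "?B (?B a b) c p = - ?B c (?B a b) p"
    by (subst anti, simp)+
  moreover have "?B b (?B c a) p = - ?B b (?B a c) p" "?B c (?B b a) p = - ?B c (?B a b) p"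
    using neg[OF sm] assms by (simp_all add: anti[of a c] anti[of a b])
  ultimately show ?thesis using assms by (simp add: anchor_defect_def br)
qed

text \<open>The defect is tensorial in its two forms, but its last argument is a function. Cyclicity
  moves that function into a form slot, where vanishing on generators suffices.\<close>

lemma anchor_defect_eq_zero:
  assumes V: "generates M V"
    and zero: "\<And>a b c p. a \<in> V \<Longrightarrow> b \<in> V \<Longrightarrow> c \<in> V \<Longrightarrow> anchor_defect (differential M a) (differential M b) c p = 0"
    and \<alpha>: "\<alpha> \<in> one_forms M" and \<beta>: "\<beta> \<in> one_forms M" and \<phi>: "smooth_fun M \<phi>"
  shows "anchor_defect \<alpha> \<beta> \<phi> p = 0"
proof -
  have sm: "smooth_fun M v" if "v \<in> V" for v using V that unfolding generates_def by blast
  note d = differential_in_one_forms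
  \<comment> \<open>Tensoriality was proved for the first slot only, so the defect is swapped by
    antisymmetry before the extension from generators.\<close>
  have right: "anchor_defect \<alpha> \<beta> \<phi> p = 0"
    if z: "\<And>v p. v \<in> V \<Longrightarrow> anchor_defect \<alpha> (differential M v) \<phi> p = 0"
      and f: "\<alpha> \<in> one_forms M" "\<beta> \<in> one_forms M" "smooth_fun M \<phi>" for \<alpha> \<beta> \<phi> p
  proof (rule tensorial_eq_zero[OF V, where T="\<lambda>\<beta> p. anchor_defect \<beta> \<alpha> \<phi> p" and \<pi>="\<lambda>p. p", THEN iffD1[rotated]])
    show "anchor_defect \<beta> \<alpha> \<phi> p = 0 \<longleftrightarrow> anchor_defect \<alpha> \<beta> \<phi> p = 0"
      using anchor_defect_antisym[OF f(1,2)] by simp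
  qed (use f z anchor_defect_antisym[OF f(1) d[OF sm]] in \<open>simp_all add: anchor_defect_add anchor_defect_scale\<close>)
  \<comment> \<open>By cyclicity the defect of da, db on \<phi> is that of db, d\<phi> on a; it
    extends from generators in the slot of d\<phi>.\<close>
  have 1: "anchor_defect (differential M a) (differential M b) \<phi> p = 0" if "a \<in> V" "b \<in> V" for a b p
    unfolding anchor_defect_cyclic[OF sm[OF that(1)] sm[OF that(2)] \<phi>]
    by (rule right) (use that zero anchor_defect_cyclic[OF sm[OF that(1)] sm[OF that(2)] sm] in \<open>auto intro: d \<phi> sm\<close>)
  have 2: "anchor_defect (differential M a) \<beta> \<phi> p = 0" if "a \<in> V" for a p
    by (rule right) (use that 1 in \<open>auto intro: d \<phi> \<beta> sm\<close>)
  show ?thesis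
    by (rule tensorial_eq_zero[OF V, where T="\<lambda>\<alpha> p. anchor_defect \<alpha> \<beta> \<phi> p" and \<pi>="\<lambda>p. p"])
      (use \<alpha> \<beta> \<phi> 2 in \<open>simp_all add: anchor_defect_add anchor_defect_scale\<close>)
qed

lemma flat_curvature: "flat M g P \<Longrightarrow> \<alpha> \<in> one_forms M \<Longrightarrow> \<beta> \<in> one_forms M \<Longrightarrow> \<gamma> \<in> one_forms M \<Longrightarrow> R \<alpha> \<beta> \<gamma> p = 0"
  by (simp add: flat_def)

text \<open>Applying the curvature to \<phi> \<gamma> leaves the defect times \<gamma>. A form
  nonzero at p exists because the model space has a nonempty basis.\<close>

lemma flat_anchor_defect:
  assumes "flat M g P" and f: "\<alpha> \<in> one_forms M" "\<beta> \<in> one_forms M" "smooth_fun M \<phi>"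
  shows "anchor_defect \<alpha> \<beta> \<phi> p = 0"
proof -
  obtain b :: 'e where b: "b \<in> Basis" using nonempty_Basis by blast
  obtain \<gamma> where \<gamma>: "\<gamma> \<in> one_forms M" "\<gamma> p = blinfun_inner_left b" using exists_form by blast
  have "\<gamma> p \<noteq> 0"
  proof
    assume "\<gamma> p = 0"
    then have "\<gamma> p b = blinfun_apply 0 b" by simp
    then show False using b by (simp add: \<gamma>(2) zero_blinfun.rep_eq)
  qed
  moreover have "anchor_defect \<alpha> \<beta> \<phi> p *\<^sub>R \<gamma> p = 0"
    using curvature_scale_right[OF f(1,2) \<gamma>(1) f(3), of p] flat_curvature[OF assms(1) f(1,2)] \<gamma>(1) f(3)
    by (simp add: one_forms_scale)
  ultimately show ?thesis by simp
qed

text \<open>The vanishing defect makes the curvature tensorial in its last slot, which is extended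
  first; then the first slot, an exchange by antisymmetry, and the first slot again.\<close>

lemma flat_if_generators:
  assumes V: "generates M V"
    and defect: "\<And>a b c p. a \<in> V \<Longrightarrow> b \<in> V \<Longrightarrow> c \<in> V \<Longrightarrow> anchor_defect (differential M a) (differential M b) c p = 0"
    and curv: "\<And>a b c p. a \<in> V \<Longrightarrow> b \<in> V \<Longrightarrow> c \<in> V \<Longrightarrow> R (differential M a) (differential M b) (differential M c) p = 0"
  shows "flat M g P"
proof -
  have sm: "smooth_fun M v" if "v \<in> V" for v using V that unfolding generates_def by blast
  note d = differential_in_one_forms[OF sm]
  have 1: "R (differential M a) (differential M b) \<gamma> p = 0" if "a \<in> V" "b \<in> V" "\<gamma> \<in> one_forms M" for a b \<gamma> p
    by (rule tensorial_eq_zero[OF V, where T="\<lambda>\<gamma> p. R (differential M a) (differential M b) \<gamma> p" and \<pi>="\<lambda>p. p"])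
      (use that curv d in \<open>simp_all add: curvature_add curvature_scale_right anchor_defect_eq_zero[OF V defect]\<close>)
  have left: "R \<alpha> \<beta> \<gamma> p = 0"
    if "\<And>v p. v \<in> V \<Longrightarrow> R (differential M v) \<beta> \<gamma> p = 0" "\<alpha> \<in> one_forms M" "\<beta> \<in> one_forms M" "\<gamma> \<in> one_forms M"
    for \<alpha> \<beta> \<gamma> p
    by (rule tensorial_eq_zero[OF V, where T="\<lambda>\<alpha> p. R \<alpha> \<beta> \<gamma> p" and \<pi>="\<lambda>p. p"])
      (use that in \<open>simp_all add: curvature_add curvature_scale_left\<close>)
  have 2: "R \<beta> (differential M a) \<gamma> p = 0" if "a \<in> V" "\<beta> \<in> one_forms M" "\<gamma> \<in> one_forms M" for a \<beta> \<gamma> p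
    by (rule left) (use that 1 d in auto)
  have 3: "R (differential M a) \<beta> \<gamma> p = 0" if "a \<in> V" "\<beta> \<in> one_forms M" "\<gamma> \<in> one_forms M" for a \<beta> \<gamma> p
    using curvature_antisym[OF that(2) d[OF that(1)] that(3)] 2[OF that] by simp
  have "R \<alpha> \<beta> \<gamma> p = 0" if "\<alpha> \<in> one_forms M" "\<beta> \<in> one_forms M" "\<gamma> \<in> one_forms M" for \<alpha> \<beta> \<gamma> p
    by (rule left) (use that 3 in auto)
  then show ?thesis by (simp add: flat_def fun_eq_iff)
qed

end

text \<open>A coordinate ball around p has a connected image, so \<mu> is constant near p.\<close>

lemma (in smooth_mfd) differential_essentially_constant:
  assumes "essentially_constant \<mu>" shows "differential M \<mu> p = 0"
proof (rule differential_eqI')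
  let ?c = "chart_at M p" let ?x = "coord ?c p"
  obtain e where e: "e > 0" "ball ?x e \<subseteq> target ?c"
    using chart(2)[OF chart_at(1)] chart_at(3) open_contains_ball by blast
  have "((\<lambda>x. \<mu> p) has_derivative blinfun_apply 0) (at ?x)" by (simp add: zero_blinfun.rep_eq)
  then show "((\<lambda>x. \<mu> (param ?c x)) has_derivative blinfun_apply 0) (at ?x)"
  proof (rule has_derivative_transform_within_open[OF _ open_ball])
    show "?x \<in> ball ?x e" using e by simp
    fix y assume y: "y \<in> ball ?x e"
    have "connected (param ?c ` ball ?x e)"
      by (rule connected_continuous_image[OF continuous_on_subset[OF chart(8)[OF chart_at(1)] e(2)] connected_ball])
    moreover have "p \<in> param ?c ` ball ?x e"
      using e(1) by (intro image_eqI[of _ _ ?x]) (simp_all add: chart_at)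
    ultimately have "connected_component UNIV p (param ?c y)"
      using y unfolding connected_component_def by blast
    then show "\<mu> p = \<mu> (param ?c y)" using assms unfolding essentially_constant_def by blast
  qed
qed

section \<open>The connection of the warped product on lifts\<close>

locale casimir_warped_pair = warped_pair M1 P1 gt1 M2 P2 gt2 f \<mu>
  for M1 :: "('a::{t2_space,second_countable_topology}, 'e::euclidean_space) manifold"
    and P1 gt1
    and M2 :: "('b::{t2_space,second_countable_topology}, 'd::euclidean_space) manifold"
    and P2 gt2 f \<mu> +
  assumes casimir_f: "casimir M1 P1 f" and constant_\<mu>: "essentially_constant \<mu>"
begin

text \<open>The Casimir condition kills P with df in the first slot; antisymmetry moves df to the
  second.\<close>

lemma act_f: "M1.act \<alpha> f p = 0"
proof -
  have "P1 p (differential M1 f p) (\<alpha> p) = 0"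
    using sharp_apply[where P=P1 and p=p, OF M1.bilinear_P, of "\<alpha> p" "differential M1 f"] casimir_f
    by (simp add: casimir_def)
  then show ?thesis by (simp add: M1.act_def tensor_apply_def M1.antisym_P[of _ "\<alpha> p"])
qed

lemma act_\<mu>: "M1.act \<alpha> \<mu> p = 0"
  by (simp add: M1.act_def tensor_apply_def M1.differential_essentially_constant[OF constant_\<mu>] M1.P_simps)

lemma act_lift:
  "smooth_fun M1 \<phi> \<Longrightarrow> act (hl \<alpha>) (\<lambda>x. \<phi> (fst x)) = (\<lambda>x. M1.act \<alpha> \<phi> (fst x))"
  "smooth_fun M2 \<psi> \<Longrightarrow> act (hl \<alpha>) (\<lambda>x. \<psi> (snd x)) = (\<lambda>x. 0)"
  "smooth_fun M1 \<phi> \<Longrightarrow> act (vl \<gamma>) (\<lambda>x. \<phi> (fst x)) = (\<lambda>x. 0)"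
  "smooth_fun M2 \<psi> \<Longrightarrow> act (vl \<gamma>) (\<lambda>x. \<psi> (snd x)) = (\<lambda>x. \<mu> (fst x) * M2.act \<gamma> \<psi> (snd x))"
  by (auto simp: act_def tensor_apply_def warped_bivector_eq differential_fst differential_snd hl vl
      M1.act_def M2.act_def M1.P_simps M2.P_simps)

text \<open>A function annihilated by the anchor passes through every derivative; this is applied
  both to f and to \<mu>.\<close>

lemma act_lift_warped:
  assumes "smooth_fun M2 \<psi>" "smooth_fun M1 \<phi>" "\<And>\<alpha> p. M1.act \<alpha> \<phi> p = 0"
  shows "act (hl \<alpha>) (\<lambda>x. \<phi> (fst x) * \<psi> (snd x)) = (\<lambda>x. 0)"
    "act (vl \<gamma>) (\<lambda>x. \<phi> (fst x) * \<psi> (snd x)) = (\<lambda>x. \<mu> (fst x) * (\<phi> (fst x) * M2.act \<gamma> \<psi> (snd x)))"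
  by (auto simp: act_mult smooth_fun_fst smooth_fun_snd act_lift assms)

lemmas act_lift_f = act_lift_warped[OF _ f(1) act_f]
  and act_lift_\<mu> = act_lift_warped[OF _ \<mu> act_\<mu>]

lemma g_lift:
  "g x (hl \<alpha> x) (hl \<beta> x) = M1.g (fst x) (\<alpha> (fst x)) (\<beta> (fst x))"
  "g x (hl \<alpha> x) (vl \<gamma> x) = 0" "g x (vl \<gamma> x) (hl \<alpha> x) = 0"
  "g x (vl \<gamma> x) (vl \<delta> x) = f (fst x) * M2.g (snd x) (\<gamma> (snd x)) (\<delta> (snd x))"
  by (simp_all add: g_warped hl vl M1.g_simps M2.g_simps)

lemma tensor_g_lift:
  "tensor_apply g (hl \<alpha>) (hl \<beta>) = (\<lambda>x. tensor_apply M1.g \<alpha> \<beta> (fst x))"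
  "tensor_apply g (hl \<alpha>) (vl \<gamma>) = (\<lambda>x. 0)" "tensor_apply g (vl \<gamma>) (hl \<alpha>) = (\<lambda>x. 0)"
  "tensor_apply g (vl \<gamma>) (vl \<delta>) = (\<lambda>x. f (fst x) * tensor_apply M2.g \<gamma> \<delta> (snd x))"
  by (auto simp: tensor_apply_def g_lift)

lemma differential_warped:
  assumes "smooth_fun M2 \<psi>" shows "differential M (\<lambda>x. \<mu> (fst x) * \<psi> (snd x)) x = \<mu> (fst x) *\<^sub>R vl (differential M2 \<psi>) x"
  by (simp add: differential_mult smooth_fun_fst smooth_fun_snd \<mu> assms differential_fst differential_snd hl
      M1.differential_essentially_constant[OF constant_\<mu>] bounded_bilinear.zero_left[OF bounded_bilinear_blinfun_compose])

text \<open>Lifted exact forms are again exact, so every bracket is the differential of a bracket of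
  functions. For vertical forms the latter carries the factor \<mu>, which comes out because its
  differential is zero.\<close>

lemma bracket_lift:
  assumes "smooth_fun M1 a" "smooth_fun M1 b" "smooth_fun M2 c" "smooth_fun M2 d"
  shows "bracket (hl (differential M1 a)) (hl (differential M1 b)) x = hl (M1.bracket (differential M1 a) (differential M1 b)) x"
    "bracket (hl (differential M1 a)) (vl (differential M2 c)) x = 0"
    "bracket (vl (differential M2 c)) (hl (differential M1 a)) x = 0"
    "bracket (vl (differential M2 c)) (vl (differential M2 d)) x =
       \<mu> (fst x) *\<^sub>R vl (M2.bracket (differential M2 c) (differential M2 d)) x"
proof -
  note s = smooth_fun_fst[OF assms(1)] smooth_fun_fst[OF assms(2)] smooth_fun_snd[OF assms(3)] smooth_fun_snd[OF assms(4)]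
  note e = differential_fst[OF assms(1)] differential_fst[OF assms(2)] differential_snd[OF assms(3)] differential_snd[OF assms(4)]
  have b: "M1.bracket (differential M1 a) (differential M1 b) = differential M1 (M1.act (differential M1 a) b)"
    "M2.bracket (differential M2 c) (differential M2 d) = differential M2 (M2.act (differential M2 c) d)"
    by (rule ext, rule M1.bracket_differential[OF assms(1,2)]) (rule ext, rule M2.bracket_differential[OF assms(3,4)])
  have m: "smooth_fun M1 (M1.act (differential M1 a) b)" "smooth_fun M2 (M2.act (differential M2 c) d)"
    by (intro M1.smooth_act M1.differential_in_one_forms M2.smooth_act M2.differential_in_one_forms assms)+
  show "bracket (hl (differential M1 a)) (hl (differential M1 b)) x = hl (M1.bracket (differential M1 a) (differential M1 b)) x"
    using bracket_differential[OF s(1,2), of x] by (simp add: e act_lift assms b differential_fst[OF m(1)])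
  show "bracket (hl (differential M1 a)) (vl (differential M2 c)) x = 0"
    using bracket_differential[OF s(1,3), of x] by (simp add: e act_lift assms differential_const)
  show "bracket (vl (differential M2 c)) (hl (differential M1 a)) x = 0"
    using bracket_differential[OF s(3,1), of x] by (simp add: e act_lift assms differential_const)
  show "bracket (vl (differential M2 c)) (vl (differential M2 d)) x =
       \<mu> (fst x) *\<^sub>R vl (M2.bracket (differential M2 c) (differential M2 d)) x"
    using bracket_differential[OF s(3,4), of x] by (simp add: e act_lift assms b differential_warped[OF m(2)])
qed

lemmas bracket_exact_lift =
  bracket_lift(1)[OF _ _ M2.smooth_fun_const M2.smooth_fun_const]
  bracket_lift(2)[OF _ M1.smooth_fun_const _ M2.smooth_fun_const]
  bracket_lift(3)[OF _ M1.smooth_fun_const _ M2.smooth_fun_const]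
  bracket_lift(4)[OF M1.smooth_fun_const M1.smooth_fun_const]

lemma hl_zero: "\<alpha> (fst x) = 0 \<Longrightarrow> hl \<alpha> x = 0" and vl_zero: "\<gamma> (snd x) = 0 \<Longrightarrow> vl \<gamma> x = 0"
  by (simp_all add: hl vl bounded_bilinear.zero_left[OF bounded_bilinear_blinfun_compose])

text \<open>Pairing with the difference of the two forms is tensorial, and the lifts generate; so
  the nondegeneracy test needs only exact lifts.\<close>

lemma eq_on_liftsI:
  assumes 1: "\<And>c x. smooth_fun M1 c \<Longrightarrow> g x (\<alpha> x) (hl (differential M1 c) x) = g x (\<beta> x) (hl (differential M1 c) x)"
    and 2: "\<And>c x. smooth_fun M2 c \<Longrightarrow> g x (\<alpha> x) (vl (differential M2 c) x) = g x (\<beta> x) (vl (differential M2 c) x)"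
  shows "\<alpha> = \<beta>"
proof (rule forms_eqI)
  fix x \<gamma> assume \<gamma>: "\<gamma> \<in> one_forms M"
  have "g x (\<alpha> x - \<beta> x) (\<gamma> x) = 0"
  proof (rule tensorial_eq_zero[OF generates_lifts, where T="\<lambda>\<gamma> x. g x (\<alpha> x - \<beta> x) (\<gamma> x)" and \<pi>="\<lambda>x. x"])
    show "g x (\<alpha> x - \<beta> x) (differential M v x) = 0" if "v \<in> lifts" for v x
      using that unfolding lifts_def by safe (simp_all add: differential_fst differential_snd g_simps 1 2)
  qed (simp_all add: g_simps \<gamma>)
  then show "g x (\<alpha> x) (\<gamma> x) = g x (\<beta> x) (\<gamma> x)" by (simp add: g_simps)
qed

text \<open>The Koszul formula evaluated on exact lifts. Horizontal derivatives of f times a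
  vertical pairing vanish by the Casimir property, which kills the mixed components; on vertical
  forms f is a common factor of both sides, and \<mu> comes from the anchor and the bracket.\<close>

lemma D_exact_lift:
  assumes "smooth_fun M1 a" "smooth_fun M1 b" "smooth_fun M2 c" "smooth_fun M2 d"
  shows "D (hl (differential M1 a)) (hl (differential M1 b)) = hl (M1.D (differential M1 a) (differential M1 b))"
    "D (hl (differential M1 a)) (vl (differential M2 c)) = (\<lambda>x. 0)"
    "D (vl (differential M2 c)) (hl (differential M1 a)) = (\<lambda>x. 0)"
    "D (vl (differential M2 c)) (vl (differential M2 d)) = (\<lambda>x. \<mu> (fst x) *\<^sub>R vl (M2.D (differential M2 c) (differential M2 d)) x)"
proof -
  note d1 = M1.differential_in_one_forms and d2 = M2.differential_in_one_forms
  have H: "hl (differential M1 u) \<in> one_forms M" if "smooth_fun M1 u" for u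
    by (rule hl_in_one_forms[OF d1[OF that]])
  have Vt: "vl (differential M2 u) \<in> one_forms M" if "smooth_fun M2 u" for u
    by (rule vl_in_one_forms[OF d2[OF that]])
  have s1: "smooth_fun M1 (tensor_apply M1.g (differential M1 u) (differential M1 v))"
    if "smooth_fun M1 u" "smooth_fun M1 v" for u v using that by (intro M1.smooth_g d1)
  have s2: "smooth_fun M2 (tensor_apply M2.g (differential M2 u) (differential M2 v))"
    if "smooth_fun M2 u" "smooth_fun M2 v" for u v using that by (intro M2.smooth_g d2)
  note K = koszul_def tensor_g_lift act_lift act_lift_f act_const bracket_exact_lift g_lift g_simps s1 s2 H Vt
    D_koszul M1.D_koszul M2.D_koszul M1.koszul_def M2.koszul_def d1 d2
  show "D (hl (differential M1 a)) (hl (differential M1 b)) = hl (M1.D (differential M1 a) (differential M1 b))"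
    by (rule eq_on_liftsI) (simp_all add: K assms)
  show "D (hl (differential M1 a)) (vl (differential M2 c)) = (\<lambda>x. 0)"
    by (rule eq_on_liftsI) (simp_all add: K assms)
  show "D (vl (differential M2 c)) (hl (differential M1 a)) = (\<lambda>x. 0)"
    by (rule eq_on_liftsI) (simp_all add: K assms)
  show "D (vl (differential M2 c)) (vl (differential M2 d)) = (\<lambda>x. \<mu> (fst x) *\<^sub>R vl (M2.D (differential M2 c) (differential M2 d)) x)"
    by (rule eq_on_liftsI) (simp_all add: K assms algebra_simps)
qed

text \<open>Both sides have the same Leibniz term in \<beta>, so their difference is tensorial in
  each slot and vanishes once it does on exact forms.\<close>

lemma D_lift_hh:
  assumes "\<alpha> \<in> one_forms M1" "\<beta> \<in> one_forms M1" shows "D (hl \<alpha>) (hl \<beta>) = hl (M1.D \<alpha> \<beta>)"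
proof -
  note s = M1.generates_all hl_in_one_forms M1.differential_in_one_forms smooth_fun_fst
  have 1: "D (hl (differential M1 a)) (hl \<beta>) x - hl (M1.D (differential M1 a) \<beta>) x = 0" if a: "smooth_fun M1 a" for a x
    by (rule M1.tensorial_eq_zero[OF M1.generates_all, where \<pi>=fst and
          T="\<lambda>\<beta> x. D (hl (differential M1 a)) (hl \<beta>) x - hl (M1.D (differential M1 a) \<beta>) x"])
      (use a assms in \<open>simp_all add: s hl_linear D_add_right M1.D_add_right D_scale_right M1.D_scale_right
        act_lift D_exact_lift(1)[OF _ _ M2.smooth_fun_const M2.smooth_fun_const] algebra_simps\<close>)
  have "D (hl \<alpha>) (hl \<beta>) x - hl (M1.D \<alpha> \<beta>) x = 0" for x
    by (rule M1.tensorial_eq_zero[OF M1.generates_all, where \<pi>=fst and T="\<lambda>\<alpha> x. D (hl \<alpha>) (hl \<beta>) x - hl (M1.D \<alpha> \<beta>) x"])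
      (use 1 assms in \<open>simp_all add: s hl_linear D_add_left M1.D_add_left D_scale_left M1.D_scale_left algebra_simps\<close>)
  then show ?thesis by (auto simp: fun_eq_iff)
qed

text \<open>Tensorial in \<beta> because the horizontal anchor does not differentiate functions of
  the second factor.\<close>

lemma D_lift_hv:
  assumes "\<alpha> \<in> one_forms M1" "\<beta> \<in> one_forms M2" shows "D (hl \<alpha>) (vl \<beta>) = (\<lambda>x. 0)"
proof -
  note s = hl_in_one_forms vl_in_one_forms M1.differential_in_one_forms M2.differential_in_one_forms smooth_fun_fst smooth_fun_snd
  have 1: "D (hl (differential M1 a)) (vl \<beta>) x = 0" if a: "smooth_fun M1 a" for a x
    by (rule M2.tensorial_eq_zero[OF M2.generates_all, where \<pi>=snd and T="\<lambda>\<beta> x. D (hl (differential M1 a)) (vl \<beta>) x"])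
      (use a assms in \<open>simp_all add: s vl_linear D_add_right D_scale_right act_lift
          D_exact_lift(2)[OF _ M1.smooth_fun_const _ M2.smooth_fun_const]\<close>)
  have "D (hl \<alpha>) (vl \<beta>) x = 0" for x
    by (rule M1.tensorial_eq_zero[OF M1.generates_all, where \<pi>=fst and T="\<lambda>\<alpha> x. D (hl \<alpha>) (vl \<beta>) x"])
      (use 1 assms in \<open>simp_all add: s hl_linear D_add_left D_scale_left\<close>)
  then show ?thesis by (auto simp: fun_eq_iff)
qed

text \<open>Tensorial in \<alpha> because the vertical anchor does not differentiate functions of
  the first factor.\<close>

lemma D_lift_vh:
  assumes "\<alpha> \<in> one_forms M1" "\<beta> \<in> one_forms M2" shows "D (vl \<beta>) (hl \<alpha>) = (\<lambda>x. 0)"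
proof -
  note s = hl_in_one_forms vl_in_one_forms M1.differential_in_one_forms M2.differential_in_one_forms smooth_fun_fst smooth_fun_snd
  have 1: "D (vl \<beta>) (hl (differential M1 a)) x = 0" if a: "smooth_fun M1 a" for a x
    by (rule M2.tensorial_eq_zero[OF M2.generates_all, where \<pi>=snd and T="\<lambda>\<beta> x. D (vl \<beta>) (hl (differential M1 a)) x"])
      (use a assms in \<open>simp_all add: s vl_linear D_add_left D_scale_left
          D_exact_lift(3)[OF _ M1.smooth_fun_const _ M2.smooth_fun_const]\<close>)
  have "D (vl \<beta>) (hl \<alpha>) x = 0" for x
    by (rule M1.tensorial_eq_zero[OF M1.generates_all, where \<pi>=fst and T="\<lambda>\<alpha> x. D (vl \<beta>) (hl \<alpha>) x"])
      (use 1 assms in \<open>simp_all add: s hl_linear D_add_right D_scale_right act_lift\<close>)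
  then show ?thesis by (auto simp: fun_eq_iff)
qed

text \<open>The vertical anchor carries the factor \<mu>, so the Leibniz terms on both sides agree
  and the difference is again tensorial.\<close>

lemma D_lift_vv:
  assumes "\<alpha> \<in> one_forms M2" "\<beta> \<in> one_forms M2"
  shows "D (vl \<alpha>) (vl \<beta>) = (\<lambda>x. \<mu> (fst x) *\<^sub>R vl (M2.D \<alpha> \<beta>) x)"
proof -
  note s = M2.generates_all vl_in_one_forms M2.differential_in_one_forms smooth_fun_snd
  have 1: "D (vl (differential M2 a)) (vl \<beta>) x - \<mu> (fst x) *\<^sub>R vl (M2.D (differential M2 a) \<beta>) x = 0" if a: "smooth_fun M2 a" for a x
    by (rule M2.tensorial_eq_zero[OF M2.generates_all, where \<pi>=snd and
          T="\<lambda>\<beta> x. D (vl (differential M2 a)) (vl \<beta>) x - \<mu> (fst x) *\<^sub>R vl (M2.D (differential M2 a) \<beta>) x"])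
      (use a assms in \<open>simp_all add: s vl_linear D_add_right M2.D_add_right D_scale_right M2.D_scale_right
        act_lift D_exact_lift(4)[OF M1.smooth_fun_const M1.smooth_fun_const] algebra_simps\<close>)
  have "D (vl \<alpha>) (vl \<beta>) x - \<mu> (fst x) *\<^sub>R vl (M2.D \<alpha> \<beta>) x = 0" for x
    by (rule M2.tensorial_eq_zero[OF M2.generates_all, where \<pi>=snd and T="\<lambda>\<alpha> x. D (vl \<alpha>) (vl \<beta>) x - \<mu> (fst x) *\<^sub>R vl (M2.D \<alpha> \<beta>) x"])
      (use 1 assms in \<open>simp_all add: s vl_linear D_add_left M2.D_add_left D_scale_left M2.D_scale_left algebra_simps\<close>)
  then show ?thesis by (auto simp: fun_eq_iff)
qed

lemmas D_lift = D_lift_hh D_lift_hv D_lift_vh D_lift_vv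

text \<open>Read off from torsion-freeness on the product and on the factors, without computing Lie
  derivatives of lifts.\<close>

lemma bracket_lift_forms:
  assumes "\<alpha> \<in> one_forms M1" "\<beta> \<in> one_forms M1" "\<gamma> \<in> one_forms M2" "\<delta> \<in> one_forms M2"
  shows "bracket (hl \<alpha>) (hl \<beta>) = hl (M1.bracket \<alpha> \<beta>)" "bracket (hl \<alpha>) (vl \<gamma>) = (\<lambda>x. 0)"
    "bracket (vl \<gamma>) (hl \<alpha>) = (\<lambda>x. 0)" "bracket (vl \<gamma>) (vl \<delta>) = (\<lambda>x. \<mu> (fst x) *\<^sub>R vl (M2.bracket \<gamma> \<delta>) x)"
  using assms
  by (simp_all add: D_torsion M1.D_torsion M2.D_torsion hl_in_one_forms vl_in_one_forms D_lift hl_linear vl_linear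
      scaleR_diff_right)

lemmas lift_closed = hl_in_one_forms vl_in_one_forms M1.D_in_one_forms M2.D_in_one_forms
  M1.bracket_in_one_forms M2.bracket_in_one_forms smooth_fun_fst smooth_fun_snd \<mu>
  M1.smooth_act M2.smooth_act one_forms_scale one_forms_zero

text \<open>Since the anchor annihilates \<mu>, the factor passes through the connection without a
  Leibniz term.\<close>

lemma D_\<mu>_lift:
  assumes "\<alpha> \<in> one_forms M1" "\<gamma> \<in> one_forms M2" "\<delta> \<in> one_forms M2"
  shows "D (hl \<alpha>) (\<lambda>x. \<mu> (fst x) *\<^sub>R vl \<delta> x) = (\<lambda>x. 0)"
    "D (vl \<gamma>) (\<lambda>x. \<mu> (fst x) *\<^sub>R vl \<delta> x) = (\<lambda>x. (\<mu> (fst x))\<^sup>2 *\<^sub>R vl (M2.D \<gamma> \<delta>) x)"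
  using assms by (simp_all add: D_scale_right lift_closed D_lift act_lift act_\<mu> power2_eq_square)

section \<open>Curvature and anchor defect on lifts, and the equivalence\<close>

text \<open>The square of \<mu> arises in each vertical term: twice from iterated derivatives, and
  once from the bracket and once from the connection in the last term.\<close>

lemma curvature_lift:
  assumes "\<alpha> \<in> one_forms M1" "\<beta> \<in> one_forms M1" "\<gamma> \<in> one_forms M1"
    and "\<alpha>' \<in> one_forms M2" "\<beta>' \<in> one_forms M2" "\<gamma>' \<in> one_forms M2"
  shows "R (hl \<alpha>) (hl \<beta>) (hl \<gamma>) x = hl (M1.R \<alpha> \<beta> \<gamma>) x" "R (hl \<alpha>) (hl \<beta>) (vl \<gamma>') x = 0"
    "R (hl \<alpha>) (vl \<beta>') (hl \<gamma>) x = 0" "R (hl \<alpha>) (vl \<beta>') (vl \<gamma>') x = 0"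
    "R (vl \<alpha>') (vl \<beta>') (hl \<gamma>) x = 0" "R (vl \<alpha>') (vl \<beta>') (vl \<gamma>') x = (\<mu> (fst x))\<^sup>2 *\<^sub>R vl (M2.R \<alpha>' \<beta>' \<gamma>') x"
    "R (vl \<alpha>') (hl \<beta>) (hl \<gamma>) x = 0" "R (vl \<alpha>') (hl \<beta>) (vl \<gamma>') x = 0"
  using assms
  by (simp_all add: curvature_def D_lift bracket_lift_forms D_zero D_\<mu>_lift D_scale_left lift_closed hl_linear vl_linear
      power2_eq_square algebra_simps)

lemma anchor_defect_lift:
  assumes "\<alpha> \<in> one_forms M1" "\<beta> \<in> one_forms M1" "smooth_fun M1 a"
    and "\<alpha>' \<in> one_forms M2" "\<beta>' \<in> one_forms M2" "smooth_fun M2 b"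
  shows "anchor_defect (hl \<alpha>) (hl \<beta>) (\<lambda>x. a (fst x)) x = M1.anchor_defect \<alpha> \<beta> a (fst x)"
    "anchor_defect (hl \<alpha>) (hl \<beta>) (\<lambda>x. b (snd x)) x = 0"
    "anchor_defect (hl \<alpha>) (vl \<beta>') (\<lambda>x. a (fst x)) x = 0" "anchor_defect (hl \<alpha>) (vl \<beta>') (\<lambda>x. b (snd x)) x = 0"
    "anchor_defect (vl \<alpha>') (hl \<beta>) (\<lambda>x. a (fst x)) x = 0" "anchor_defect (vl \<alpha>') (hl \<beta>) (\<lambda>x. b (snd x)) x = 0"
    "anchor_defect (vl \<alpha>') (vl \<beta>') (\<lambda>x. a (fst x)) x = 0"
    "anchor_defect (vl \<alpha>') (vl \<beta>') (\<lambda>x. b (snd x)) x = (\<mu> (fst x))\<^sup>2 * M2.anchor_defect \<alpha>' \<beta>' b (snd x)"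
proof -
  have z: "act (\<lambda>x. 0) \<phi> x = 0" for \<phi> by (simp add: act_def tensor_apply_def P_simps)
  show "anchor_defect (hl \<alpha>) (hl \<beta>) (\<lambda>x. a (fst x)) x = M1.anchor_defect \<alpha> \<beta> a (fst x)"
    "anchor_defect (hl \<alpha>) (hl \<beta>) (\<lambda>x. b (snd x)) x = 0"
    "anchor_defect (hl \<alpha>) (vl \<beta>') (\<lambda>x. a (fst x)) x = 0" "anchor_defect (hl \<alpha>) (vl \<beta>') (\<lambda>x. b (snd x)) x = 0"
    "anchor_defect (vl \<alpha>') (hl \<beta>) (\<lambda>x. a (fst x)) x = 0" "anchor_defect (vl \<alpha>') (hl \<beta>) (\<lambda>x. b (snd x)) x = 0"
    "anchor_defect (vl \<alpha>') (vl \<beta>') (\<lambda>x. a (fst x)) x = 0"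
    "anchor_defect (vl \<alpha>') (vl \<beta>') (\<lambda>x. b (snd x)) x = (\<mu> (fst x))\<^sup>2 * M2.anchor_defect \<alpha>' \<beta>' b (snd x)"
    using assms
    by (simp_all add: anchor_defect_def M1.anchor_defect_def M2.anchor_defect_def act_lift act_lift_\<mu> act_const
      bracket_lift_forms lift_closed z act_scale_form power2_eq_square algebra_simps)
qed

text \<open>Downwards, curvature on lifts is evaluated at suitable points; upwards, generators
  reduce everything to the curvature and defect of the factors.\<close>

lemma flat_warped_iff:
  assumes "\<mu> p0 \<noteq> 0"
  shows "flat M g W \<longleftrightarrow> flat M1 M1.g P1 \<and> flat M2 M2.g P2"
proof (intro iffI conjI)
  assume F: "flat M g W"
  have "M1.R \<alpha> \<beta> \<gamma> p = 0" if "\<alpha> \<in> one_forms M1" "\<beta> \<in> one_forms M1" "\<gamma> \<in> one_forms M1" for \<alpha> \<beta> \<gamma> p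
    \<comment> \<open>Any point of the second factor serves, here \<open>undefined\<close>, since
      the lifted curvature depends only on p.\<close>
    using flat_curvature[OF F that[THEN hl_in_one_forms], of "(p, undefined)"] hl_eq_zero[of _ "(p, undefined)"]
    by (simp add: curvature_lift[OF that M2.one_forms_zero M2.one_forms_zero M2.one_forms_zero])
  then show "flat M1 M1.g P1" by (simp add: flat_def fun_eq_iff)
  have "M2.R \<alpha> \<beta> \<gamma> q = 0" if "\<alpha> \<in> one_forms M2" "\<beta> \<in> one_forms M2" "\<gamma> \<in> one_forms M2" for \<alpha> \<beta> \<gamma> q
    \<comment> \<open>Evaluated over p0, where the square of \<mu> can be divided out for every
      q.\<close>
    using flat_curvature[OF F that[THEN vl_in_one_forms], of "(p0, q)"] vl_eq_zero[of _ "(p0, q)"] assms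
    by (simp add: curvature_lift[OF M1.one_forms_zero M1.one_forms_zero M1.one_forms_zero that])
  then show "flat M2 M2.g P2" by (simp add: flat_def fun_eq_iff)
next
  assume "flat M1 M1.g P1 \<and> flat M2 M2.g P2"
  then have F: "flat M1 M1.g P1" "flat M2 M2.g P2" by auto
  have R1: "M1.R \<alpha> \<beta> \<gamma> p = 0" if "\<alpha> \<in> one_forms M1" "\<beta> \<in> one_forms M1" "\<gamma> \<in> one_forms M1" for \<alpha> \<beta> \<gamma> p
    by (rule M1.flat_curvature[OF F(1) that])
  have R2: "M2.R \<alpha> \<beta> \<gamma> p = 0" if "\<alpha> \<in> one_forms M2" "\<beta> \<in> one_forms M2" "\<gamma> \<in> one_forms M2" for \<alpha> \<beta> \<gamma> p
    by (rule M2.flat_curvature[OF F(2) that])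
  note s = M1.differential_in_one_forms M2.differential_in_one_forms
  \<comment> \<open>Zero forms and constant functions are fillers that turn each clause of the
    bundled lift lemmas into a rewrite rule of its own.\<close>
  note z1 = M1.one_forms_zero and z2 = M2.one_forms_zero and c1 = M1.smooth_fun_const and c2 = M2.smooth_fun_const
  note R = curvature_lift(1)[OF _ _ _ z2 z2 z2] curvature_lift(2)[OF _ _ z1 z2 z2 _]
    curvature_lift(3)[OF _ z1 _ z2 _ z2] curvature_lift(4)[OF _ z1 z1 z2 _ _]
    curvature_lift(5)[OF z1 z1 _ _ _ z2] curvature_lift(6)[OF z1 z1 z1]
    curvature_lift(7)[OF z1 _ _ _ z2 z2] curvature_lift(8)[OF z1 _ z1 _ z2 _]
  note A = anchor_defect_lift(1)[OF _ _ _ z2 z2 c2] anchor_defect_lift(2)[OF _ _ c1 z2 z2 _]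
    anchor_defect_lift(3)[OF _ z1 _ z2 _ c2] anchor_defect_lift(4)[OF _ z1 c1 z2 _ _]
    anchor_defect_lift(5)[OF z1 _ _ _ z2 c2] anchor_defect_lift(6)[OF z1 _ c1 _ z2 _]
    anchor_defect_lift(7)[OF z1 z1 _ _ _ c2] anchor_defect_lift(8)[OF z1 z1 c1]
  show "flat M g W"
  proof (rule flat_if_generators[OF generates_lifts])
    fix a b c x assume "a \<in> lifts" "b \<in> lifts" "c \<in> lifts"
    then show "R (differential M a) (differential M b) (differential M c) x = 0"
      "anchor_defect (differential M a) (differential M b) c x = 0"
      unfolding lifts_def
      by (auto simp: differential_fst differential_snd R A s R1 R2 hl_zero vl_zero
          M1.flat_anchor_defect[OF F(1)] M2.flat_anchor_defect[OF F(2)])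
  qed
qed

end

theorem theorem5p4:
  fixes M1 :: "('a::{t2_space,second_countable_topology}, 'e::euclidean_space) manifold"
    and M2 :: "('b::{t2_space,second_countable_topology}, 'd::euclidean_space) manifold"
    and gt1 :: "('a, 'e) cov_tensor" and gt2 :: "('b, 'd) cov_tensor"
    and P1 :: "('a, 'e) con_tensor" and P2 :: "('b, 'd) con_tensor"
    and f \<mu> :: "'a \<Rightarrow> real"
  assumes "smooth_manifold M1" and "smooth_manifold M2"
    and "pseudo_riemannian_metric M1 gt1" and "pseudo_riemannian_metric M2 gt2"
    and "bivector_field M1 P1" and "bivector_field M2 P2"
    and "smooth_fun M1 f" and "\<forall>p. f p > 0"
    and "smooth_fun M1 \<mu>"
    and "casimir M1 P1 f"
    and "essentially_constant \<mu>" and "\<exists>p. \<mu> p \<noteq> 0"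
  shows "flat (product_manifold M1 M2)
           (warped_cometric f (cometric gt1) (cometric gt2)) (warped_bivector \<mu> P1 P2)
         \<longleftrightarrow> flat M1 (cometric gt1) P1 \<and> flat M2 (cometric gt2) P2"
proof -
  interpret casimir_warped_pair M1 P1 gt1 M2 P2 gt2 f \<mu>
    by unfold_locales (use assms in auto)
  obtain p0 where "\<mu> p0 \<noteq> 0" using assms(12) by blast
  then show ?thesis unfolding warped_cometric by (rule flat_warped_iff)
qed

end
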